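(* Let $G$ be a finite graph and let $\mathcal{D}(G)$ be the complex of bigraded modules, with bigrading-preserving differential, constructed in the context. Then: (i) The homotopy class of the complex $\mathcal{D}(G)$ is an invariant of the graph $G$: up to homotopy equivalence of complexes of bigraded modules, $\mathcal{D}(G)$ does not depend on the choices made in the construction (the orderings of the vertices and of the edges and the choice of which endpoint of each edge is called $i$ and which $j$; a change of the ordering of the vertices is accompanied by the corresponding relabeling of the variables of the polynomial ring). (ii) The bigraded Euler characteristic of $\mathcal{D}(G)$ is equal to the dichromatic polynomial $D_G(t,q)$, i.e. $$\sum_{j=-m}^{0}(-1)^j\, q\dim H^j(G)=D_G(t,q),$$ where $m=|E(G)|$ and $H^j(G)$ is the term of $\mathcal{D}(G)$ in cohomological degree $j$.
   Context: A graph $G$ has a finite vertex set $V(G)$ and a finite edge set $E(G)$; put $n=|V(G)|$, $m=|E(G)|$. For an edge $e$, $G-e$ denotes $G$ with $e$ deleted and $G/e$ denotes $G$ with $e$ contracted (identify the endpoints of $e$ and delete $e$). Dichromatic polynomial: $P_G(q,v)$ is determined by $P_G=P_{G-e}-qP_{G/e}$ for every edge $e$ and $P_{N_k}=v^k$, where $N_k$ is the graph with $k$ vertices and no edges. The parametrization used here is $$D_G(t,q)=(1+t^{-1}q)^m\,P_G\!\left(q,\frac{1+t^{-1}q}{1-q}\right),$$ where $1/(1-q)$ is expanded as a power series in $q$. Bigraded conventions: for a bigraded $\mathbb{Q}$-vector space $M=\bigoplus_{k,l}M_{k,l}$ with finite-dimensional pieces, $q\dim M=\sum_{k,l}t^kq^l\dim_{\mathbb{Q}}M_{k,l}$,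 and $\{a,b\}$ denotes the shift of bigrading with $q\dim M\{a,b\}=t^aq^b\,q\dim M$. Construction of $\mathcal{D}(G)$: Order the vertices, and let $R=\mathbb{Q}[x_1,\dots,x_n]$, with $x_i$ assigned to the $i$-th vertex, $x_i$ in bidegree $(0,1)$ and $\mathbb{Q}$ in bidegree $(0,0)$. For an edge $e$ with endpoints the $i$-th and $j$-th vertices define two-term ("horizontal", Koszul) complexes of bigraded $R$-modules $$\mathcal{D}(e+):\ 0\to R\{-1,1\}\xrightarrow{x_i-x_j}R\to 0,\qquad \mathcal{D}(e-):\ 0\to R\{-1,1\}\xrightarrow{\ 0\ }R\to 0 .$$ Let $d(e):\mathcal{D}(e+)\{0,1\}\to\mathcal{D}(e-)$ be the bigrading-preserving morphism of complexes which is multiplication by $x_i-x_j$ on the left terms, $R\{-1,2\}\to R\{-1,1\}$, and $0$ on the right terms, $R\{0,1\}\to R$. Let $\mathcal{D}_e$ be the complex of complexes $0\to\mathcal{D}(e+)\{0,1\}\xrightarrow{d(e)}\mathcal{D}(e-)\to0$ with $\mathcal{D}(e+)\{0,1\}$ in cohomological degree $-1$ and $\mathcal{D}(e-)$ in cohomological degree $0$. To every vertex of $G$ assign one further copy of the horizontal complex $0\to R\{-1,1\}\xrightarrow{0}R\to0$, placed in cohomological degree $0$. Tensor over $R$ the complexes of complexes $\mathcal{D}_e$ over all edges $e$ (with the usual signs in the tensor product, with respect to a chosen ordering of the edges), together with the horizontal complexes assigned to all the vertices. The result is a complex of horizontal complexes. Its term in cohomological degree $j$, $-m\le j\le 0$,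 is the direct sum, over $s\subset E(G)$ with $|s|=-j$, of $\mathcal{D}(s)\{0,|s|\}$, where $\mathcal{D}(s)$ is the tensor product of $\mathcal{D}(e+)$ for $e\in s$, of $\mathcal{D}(f-)$ for $f\in E(G)\setminus s$, and of the $n$ vertex complexes. Let $H^j(G)$ be the total cohomology (the direct sum of all the cohomology groups) of the horizontal complex in cohomological degree $j$, a bigraded module. Then $\mathcal{D}(G)$ is the complex with terms $H^j(G)$ and with differentials $H^j(G)\to H^{j+1}(G)$ induced by the tensor product of the maps $d(e)$. *)

theory Defs
  imports
    "HOL-Library.Uprod"
    "HOL-Library.Poly_Mapping"
    "HOL-Library.Product_Plus"
    "HOL-Computational_Algebra.Formal_Laurent_Series"
    "HOL-Algebra.AbelCoset"
    "Jordan_Normal_Form.VS_Connect"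
begin

section \<open>Graphs\<close>

text \<open>Loops and multiple edges are allowed; contraction produces both.\<close>

record ('v, 'e) graph =
  verts :: "'v set"
  edges :: "'e set"
  ends :: "'e \<Rightarrow> 'v uprod"

definition finite_graph :: "('v, 'e) graph \<Rightarrow> bool" where
  "finite_graph G \<longleftrightarrow> finite (verts G) \<and> finite (edges G) \<and>
     (\<forall>e\<in>edges G. set_uprod (ends G e) \<subseteq> verts G)"

definition delete_edge :: "('v, 'e) graph \<Rightarrow> 'e \<Rightarrow> ('v, 'e) graph" where
  "delete_edge G e = G\<lparr>edges := edges G - {e}\<rparr>"

text \<open>The edge \<open>e\<close> has endpoints \<open>u\<close> and \<open>w\<close>; the vertex resulting from their identification
  is represented by \<open>u\<close>.\<close>

definition contract_edge :: "('v, 'e) graph \<Rightarrow> 'e \<Rightarrow> 'v \<Rightarrow> 'v \<Rightarrow> ('v, 'e) graph" where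
  "contract_edge G e u w =
     \<lparr>verts = id(w := u) ` verts G, edges = edges G - {e},
      ends = map_uprod (id(w := u)) \<circ> ends G\<rparr>"


section \<open>The dichromatic polynomial\<close>

text \<open>Elements of \<^typ>\<open>int poly poly\<close> are polynomials in \<open>v\<close> whose coefficients are polynomials
  in \<open>q\<close>.\<close>

abbreviation poly_q :: "int poly poly" where "poly_q \<equiv> [:[:0, 1:]:]"
abbreviation poly_v :: "int poly poly" where "poly_v \<equiv> [:0, 1:]"

definition is_dichromatic :: "(('v, 'e) graph \<Rightarrow> int poly poly) \<Rightarrow> bool" where
  "is_dichromatic P \<longleftrightarrow>
     (\<forall>G. finite_graph G \<longrightarrow> edges G = {} \<longrightarrow> P G = poly_v ^ card (verts G)) \<and>
     (\<forall>G e u w. finite_graph G \<longrightarrow> e \<in> edges G \<longrightarrow> ends G e = Upair u w \<longrightarrow>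
        P G = P (delete_edge G e) - poly_q * P (contract_edge G e u w))"

definition dichromatic_poly :: "('v, 'e) graph \<Rightarrow> int poly poly" where
  "dichromatic_poly = (SOME P. is_dichromatic P)"

text \<open>Existence and uniqueness on finite graphs of the polynomials characterised by
  \<^const>\<open>is_dichromatic\<close>; existence is shown with the expansion over spanning subgraphs.\<close>

lemma finite_graph_delete: "finite_graph G \<Longrightarrow> finite_graph (delete_edge G e)"
  by (auto simp: finite_graph_def delete_edge_def)

lemma finite_graph_contract:
  assumes "finite_graph G"
  shows "finite_graph (contract_edge G e u w)"
proof -
  have "set_uprod (map_uprod (id(w := u)) (ends G a)) \<subseteq> id(w := u) ` verts G" if "a \<in> edges G" for a
    using that assms by (auto simp: finite_graph_def uprod.set_map)
  with assms show ?thesis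
    by (auto simp: finite_graph_def contract_edge_def)
qed

lemma is_dichromatic_unique:
  assumes "is_dichromatic P" "is_dichromatic Q" "finite_graph G"
  shows "P G = Q G"
  using assms(3)
proof (induction "card (edges G)" arbitrary: G)
  case 0
  then have "edges G = {}" by (auto simp: finite_graph_def)
  with 0 assms show ?case by (simp add: is_dichromatic_def)
next
  case (Suc k)
  then obtain e where e: "e \<in> edges G"
    by (metis card.empty ex_in_conv nat.simps(3))
  obtain u w where uw: "ends G e = Upair u w" by (cases "ends G e")
  have "card (edges (delete_edge G e)) = k" "card (edges (contract_edge G e u w)) = k"
    using Suc e by (auto simp: delete_edge_def contract_edge_def finite_graph_def)
  then have "P (delete_edge G e) = Q (delete_edge G e)"
    "P (contract_edge G e u w) = Q (contract_edge G e u w)"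
    using Suc finite_graph_delete finite_graph_contract by metis+
  then show ?case
    using assms Suc.prems e uw unfolding is_dichromatic_def by metis
qed

definition edge_rel :: "('v, 'e) graph \<Rightarrow> 'e set \<Rightarrow> ('v \<times> 'v) set" where
  "edge_rel G s = {(x, y). \<exists>e\<in>s. ends G e = Upair x y}"

definition num_components :: "('v, 'e) graph \<Rightarrow> 'e set \<Rightarrow> nat" where
  "num_components G s = card ((\<lambda>x. (edge_rel G s)\<^sup>* `` {x}) ` verts G)"

definition subgraph_expansion :: "('v, 'e) graph \<Rightarrow> int poly poly" where
  "subgraph_expansion G = (\<Sum>s\<in>Pow (edges G). (- poly_q) ^ card s * poly_v ^ num_components G s)"

lemma sym_edge_rel: "sym (edge_rel G s)"
proof (rule symI)
  fix x y
  assume "(x, y) \<in> edge_rel G s"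
  moreover have "Upair x y = Upair y x" by simp
  ultimately show "(y, x) \<in> edge_rel G s" by (simp add: edge_rel_def)
qed

lemma card_image_eq_kernel:
  assumes "\<And>x y. x \<in> A \<Longrightarrow> y \<in> A \<Longrightarrow> g x = g y \<longleftrightarrow> h x = h y"
  shows "card (g ` A) = card (h ` A)"
proof -
  have "bij_betw (\<lambda>z. h (inv_into A g z)) (g ` A) (h ` A)"
    unfolding bij_betw_def
  proof
    show "inj_on (\<lambda>z. h (inv_into A g z)) (g ` A)"
      by (rule inj_onI) (metis assms f_inv_into_f inv_into_into)
    have "h (inv_into A g (g x)) = h x" if "x \<in> A" for x
      using that by (metis assms f_inv_into_f inv_into_into imageI)
    then show "(\<lambda>z. h (inv_into A g z)) ` g ` A = h ` A"
      by (simp add: image_image cong: image_cong)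
  qed
  then show ?thesis by (rule bij_betw_same_card)
qed

lemma rtrancl_class_eq:
  assumes "sym r"
  shows "r\<^sup>* `` {x} = r\<^sup>* `` {y} \<longleftrightarrow> (x, y) \<in> r\<^sup>*"
  using sym_rtrancl[OF assms] by (auto dest: symD intro: rtrancl_trans)

lemma num_components_contract:
  assumes "e \<in> s" and uw: "ends G e = Upair u w"
  shows "num_components (contract_edge G e u w) (s - {e}) = num_components G s"
proof -
  let ?f = "id(w := u)" and ?H = "contract_edge G e u w"
  let ?r = "edge_rel G s" and ?r' = "edge_rel ?H (s - {e})"
  have step_edge: "(?f x, ?f y) \<in> ?r'\<^sup>*" if xy: "(x, y) \<in> ?r" for x y
  proof -
    obtain a where a: "a \<in> s" "ends G a = Upair x y"
      using xy by (auto simp: edge_rel_def)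
    show ?thesis
    proof (cases "a = e")
      case True
      then have "?f x = ?f y" using a uw by auto
      then show ?thesis by simp
    next
      case False
      then have "(?f x, ?f y) \<in> ?r'"
        using a by (auto simp: edge_rel_def contract_edge_def intro!: bexI[of _ a])
      then show ?thesis by blast
    qed
  qed
  have forth: "(?f x, ?f y) \<in> ?r'\<^sup>*" if "(x, y) \<in> ?r\<^sup>*" for x y
    using that
  proof (induction rule: rtrancl_induct)
    case (step y z)
    show ?case by (rule rtrancl_trans[OF step.IH step_edge[OF step.hyps(2)]])
  qed simp
  have "(w, u) \<in> ?r" "(u, w) \<in> ?r"
    using assms by (auto simp: edge_rel_def intro!: bexI[of _ e])
  then have f: "(x, ?f x) \<in> ?r\<^sup>*" "(?f x, x) \<in> ?r\<^sup>*" for x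
    by auto
  have step': "(x, y) \<in> ?r\<^sup>*" if "(x, y) \<in> ?r'" for x y
  proof -
    have "\<exists>a\<in>s - {e}. map_uprod ?f (ends G a) = Upair x y"
      using that by (simp add: edge_rel_def contract_edge_def)
    then obtain a where a: "a \<in> s" "map_uprod ?f (ends G a) = Upair x y" by blast
    obtain x' y' where xy': "ends G a = Upair x' y'" by (cases "ends G a")
    have "(x', y') \<in> ?r" "(y', x') \<in> ?r"
      using a xy' by (auto simp: edge_rel_def intro!: bexI[of _ a])
    then have "(?f x', ?f y') \<in> ?r\<^sup>*" "(?f y', ?f x') \<in> ?r\<^sup>*"
      using f by (meson rtrancl.rtrancl_into_rtrancl rtrancl_trans)+
    then show ?thesis
      using a xy' by (auto simp del: fun_upd_apply)
  qed
  have bwd: "(x, y) \<in> ?r\<^sup>*" if "(x, y) \<in> ?r'\<^sup>*" for x y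
    using that by (induction rule: rtrancl_induct) (auto intro: rtrancl_trans step')
  have "(x, y) \<in> ?r\<^sup>* \<longleftrightarrow> (?f x, ?f y) \<in> ?r'\<^sup>*" for x y
    using forth bwd f by (meson rtrancl_trans)
  then have "card ((\<lambda>x. ?r\<^sup>* `` {x}) ` verts G) = card ((\<lambda>x. ?r'\<^sup>* `` {?f x}) ` verts G)"
    by (intro card_image_eq_kernel) (simp add: rtrancl_class_eq sym_edge_rel del: fun_upd_apply)
  also have "(\<lambda>x. ?r'\<^sup>* `` {?f x}) ` verts G = (\<lambda>x. ?r'\<^sup>* `` {x}) ` verts ?H"
    by (simp add: contract_edge_def image_image del: fun_upd_apply fun_upd_image image_id)
  finally show ?thesis by (simp add: num_components_def)
qed

lemma is_dichromatic_subgraph_expansion: "is_dichromatic subgraph_expansion"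
  unfolding is_dichromatic_def
proof (intro conjI allI impI)
  fix G :: "('v, 'e) graph"
  assume "finite_graph G" "edges G = {}"
  then show "subgraph_expansion G = poly_v ^ card (verts G)"
    by (simp add: subgraph_expansion_def num_components_def edge_rel_def card_image)
next
  fix G :: "('v, 'e) graph" and e u w
  assume G: "finite_graph G" and e: "e \<in> edges G" and uw: "ends G e = Upair u w"
  let ?E = "edges G - {e}" and ?H = "contract_edge G e u w"
  let ?t = "\<lambda>G s. (- poly_q) ^ card s * poly_v ^ num_components G s"
  have fin: "finite (edges G)" using G by (simp add: finite_graph_def)
  have inj: "inj_on (insert e) (Pow ?E)" by (auto simp: inj_on_def)
  have "?t G (insert e s) = - poly_q * ?t ?H s" if "s \<subseteq> ?E" for s
  proof -
    have "insert e s - {e} = s" "e \<notin> s" using that by auto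
    then have "num_components G (insert e s) = num_components ?H s"
      using num_components_contract[of e "insert e s" G u w] uw by simp
    moreover have "card (insert e s) = Suc (card s)"
      using \<open>e \<notin> s\<close> finite_subset[OF that] fin by simp
    ultimately show ?thesis by (simp only: power_Suc mult.assoc)
  qed
  then have "sum (?t G) (insert e ` Pow ?E) = (\<Sum>s\<in>Pow ?E. - poly_q * ?t ?H s)"
    by (subst sum.reindex[OF inj]) (auto intro!: sum.cong)
  also have "\<dots> = - poly_q * subgraph_expansion ?H"
    by (simp only: subgraph_expansion_def sum_distrib_left) (simp add: contract_edge_def)
  finally have with_e: "sum (?t G) (insert e ` Pow ?E) = - poly_q * subgraph_expansion ?H" .
  have without_e: "sum (?t G) (Pow ?E) = subgraph_expansion (delete_edge G e)"
    by (simp add: subgraph_expansion_def delete_edge_def num_components_def edge_rel_def)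
  have "Pow (edges G) = Pow ?E \<union> insert e ` Pow ?E"
    using Pow_insert[of e ?E] e by (simp add: insert_absorb)
  moreover have "sum (?t G) (Pow ?E \<union> insert e ` Pow ?E) = sum (?t G) (Pow ?E) + sum (?t G) (insert e ` Pow ?E)"
    by (rule sum.union_disjoint) (use fin in auto)
  ultimately have "subgraph_expansion G = sum (?t G) (Pow ?E) + sum (?t G) (insert e ` Pow ?E)"
    by (simp only: subgraph_expansion_def)
  then show "subgraph_expansion G = subgraph_expansion (delete_edge G e) - poly_q * subgraph_expansion ?H"
    by (simp only: with_e without_e mult_minus_left diff_conv_add_uminus)
qed

lemma is_dichromatic_dichromatic_poly: "is_dichromatic dichromatic_poly"
  unfolding dichromatic_poly_def by (rule someI[of is_dichromatic, OF is_dichromatic_subgraph_expansion])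

definition eval_qv :: "int poly poly \<Rightarrow> 'a :: comm_ring_1 \<Rightarrow> 'a \<Rightarrow> 'a" where
  "eval_qv P q v = poly (map_poly (\<lambda>c. poly (map_poly of_int c) q) P) v"

text \<open>\<open>D\<^sub>G(t, q)\<close> as a Laurent series in \<open>q\<close> whose coefficients are Laurent series in \<open>t\<close>;
  the division is thus the expansion in powers of \<open>q\<close>.\<close>

definition dichromatic_series :: "('v, 'e) graph \<Rightarrow> rat fls fls" where
  "dichromatic_series G =
     (let q = fls_X; t = fls_const fls_X
      in (1 + inverse t * q) ^ card (edges G)
         * eval_qv (dichromatic_poly G) q ((1 + inverse t * q) / (1 - q)))"


section \<open>Bigraded modules over polynomial rings\<close>

text \<open>Polynomials over the rationals in variables indexed by natural numbers;
  \<open>poly_ring n\<close> uses the variables with index less than \<open>n\<close>.\<close>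

type_synonym qpoly = "(nat \<Rightarrow>\<^sub>0 nat) \<Rightarrow>\<^sub>0 rat"

definition var :: "nat \<Rightarrow> qpoly" where
  "var i = Poly_Mapping.single (Poly_Mapping.single i 1) 1"

definition const :: "rat \<Rightarrow> qpoly" where
  "const c = Poly_Mapping.single 0 c"

definition mdeg :: "(nat \<Rightarrow>\<^sub>0 nat) \<Rightarrow> nat" where
  "mdeg m = (\<Sum>i\<in>Poly_Mapping.keys m. Poly_Mapping.lookup m i)"

definition poly_ring :: "nat \<Rightarrow> qpoly ring" where
  "poly_ring n = class_ring\<lparr>carrier :=
     {p. \<forall>m\<in>Poly_Mapping.keys p. Poly_Mapping.keys m \<subseteq> {..<n}}\<rparr>"

definition homogeneous :: "nat \<Rightarrow> qpoly \<Rightarrow> bool" where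
  "homogeneous l p \<longleftrightarrow> (\<forall>m\<in>Poly_Mapping.keys p. mdeg m = l)"

text \<open>The substitution of \<open>var (\<sigma> i)\<close> for \<open>var i\<close>.\<close>

definition rename_vars :: "(nat \<Rightarrow> nat) \<Rightarrow> qpoly \<Rightarrow> qpoly" where
  "rename_vars \<sigma> p =
     (\<Sum>m\<in>Poly_Mapping.keys p. Poly_Mapping.single
        (\<Sum>i\<in>Poly_Mapping.keys m. Poly_Mapping.single (\<sigma> i) (Poly_Mapping.lookup m i))
        (Poly_Mapping.lookup p m))"

text \<open>The fields \<^const>\<open>mult\<close> and \<^const>\<open>one\<close>, which \<^typ>\<open>('a, 'b) module\<close> inherits from rings,
  play no role for modules.\<close>

record ('a, 'b) bigmod = "('a, 'b) module" +
  piece :: "int \<times> int \<Rightarrow> 'b set"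

definition bigraded_module :: "nat \<Rightarrow> (qpoly, 'b) bigmod \<Rightarrow> bool" where
  "bigraded_module n M \<longleftrightarrow>
     module (poly_ring n) M \<and>
     (\<forall>d. additive_subgroup (piece M d) M) \<and>
     (\<forall>x\<in>carrier M. \<exists>!c. (\<forall>d. c d \<in> piece M d) \<and> finite {d. c d \<noteq> \<zero>\<^bsub>M\<^esub>} \<and>
        x = (\<Oplus>\<^bsub>M\<^esub>d\<in>{d. c d \<noteq> \<zero>\<^bsub>M\<^esub>}. c d)) \<and>
     (\<forall>l d. \<forall>r\<in>carrier (poly_ring n). \<forall>x\<in>piece M d. homogeneous l r \<longrightarrow>
        r \<odot>\<^bsub>M\<^esub> x \<in> piece M (d + (0, int l)))"

definition bigraded_hom :: "nat \<Rightarrow> (qpoly, 'b) bigmod \<Rightarrow> (qpoly, 'c) bigmod \<Rightarrow> ('b \<Rightarrow> 'c) set" where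
  "bigraded_hom n M N =
     {f \<in> module_hom (poly_ring n) M N. \<forall>d. f ` piece M d \<subseteq> piece N d}"

definition restrict_scalars :: "('a \<Rightarrow> 'c) \<Rightarrow> ('c, 'b) bigmod \<Rightarrow> ('a, 'b) bigmod" where
  "restrict_scalars \<phi> M =
     \<lparr>carrier = carrier M, mult = mult M, one = one M, zero = zero M, add = add M,
      smult = (\<lambda>r x. \<phi> r \<odot>\<^bsub>M\<^esub> x), piece = piece M\<rparr>"

text \<open>The graded piece of bidegree \<open>d\<close> as a vector space over the rationals.\<close>

definition piece_space :: "(qpoly, 'b) bigmod \<Rightarrow> int \<times> int \<Rightarrow> (rat, 'b) bigmod" where
  "piece_space M d = (restrict_scalars const M)\<lparr>carrier := piece M d\<rparr>"

definition finite_dim_pieces :: "(qpoly, 'b) bigmod \<Rightarrow> bool" where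
  "finite_dim_pieces M \<longleftrightarrow> (\<forall>d. vectorspace.fin_dim class_ring (piece_space M d))"

text \<open>The coefficient of \<open>t\<^sup>kq\<^sup>l\<close> in the graded dimension \<open>q dim M\<close>.\<close>

definition qdim :: "(qpoly, 'b) bigmod \<Rightarrow> int \<Rightarrow> int \<Rightarrow> nat" where
  "qdim M k l = vectorspace.dim class_ring (piece_space M (k, l))"


section \<open>Complexes of bigraded modules\<close>

record ('a, 'b) bigcomplex =
  obj :: "int \<Rightarrow> ('a, 'b) bigmod"
  diff :: "int \<Rightarrow> 'b \<Rightarrow> 'b"

definition bigraded_complex :: "nat \<Rightarrow> (qpoly, 'b) bigcomplex \<Rightarrow> bool" where
  "bigraded_complex n C \<longleftrightarrow>
     (\<forall>j. bigraded_module n (obj C j) \<and>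
          diff C j \<in> bigraded_hom n (obj C j) (obj C (j + 1)) \<and>
          (\<forall>x\<in>carrier (obj C j). diff C (j + 1) (diff C j x) = \<zero>\<^bsub>obj C (j + 2)\<^esub>))"

definition chain_map ::
  "nat \<Rightarrow> (qpoly, 'b) bigcomplex \<Rightarrow> (qpoly, 'c) bigcomplex \<Rightarrow> (int \<Rightarrow> 'b \<Rightarrow> 'c) \<Rightarrow> bool" where
  "chain_map n C D f \<longleftrightarrow>
     (\<forall>j. f j \<in> bigraded_hom n (obj C j) (obj D j) \<and>
          (\<forall>x\<in>carrier (obj C j). diff D j (f j x) = f (j + 1) (diff C j x)))"

definition chain_homotopic ::
  "nat \<Rightarrow> (qpoly, 'b) bigcomplex \<Rightarrow> (qpoly, 'c) bigcomplex \<Rightarrow>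
     (int \<Rightarrow> 'b \<Rightarrow> 'c) \<Rightarrow> (int \<Rightarrow> 'b \<Rightarrow> 'c) \<Rightarrow> bool" where
  "chain_homotopic n C D f g \<longleftrightarrow>
     (\<exists>h. \<forall>j. h j \<in> bigraded_hom n (obj C j) (obj D (j - 1)) \<and>
        (\<forall>x\<in>carrier (obj C j).
           f j x = g j x \<oplus>\<^bsub>obj D j\<^esub> (diff D (j - 1) (h j x) \<oplus>\<^bsub>obj D j\<^esub> h (j + 1) (diff C j x))))"

definition homotopy_equivalent ::
  "nat \<Rightarrow> (qpoly, 'b) bigcomplex \<Rightarrow> (qpoly, 'c) bigcomplex \<Rightarrow> bool" where
  "homotopy_equivalent n C D \<longleftrightarrow>
     bigraded_complex n C \<and> bigraded_complex n D \<and>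
     (\<exists>f g. chain_map n C D f \<and> chain_map n D C g \<and>
        chain_homotopic n C C (\<lambda>j x. g j (f j x)) (\<lambda>j x. x) \<and>
        chain_homotopic n D D (\<lambda>j x. f j (g j x)) (\<lambda>j x. x))"

definition relabel_complex ::
  "(nat \<Rightarrow> nat) \<Rightarrow> (qpoly, 'b) bigcomplex \<Rightarrow> (qpoly, 'b) bigcomplex" where
  "relabel_complex \<sigma> C = C\<lparr>obj := (\<lambda>j. restrict_scalars (rename_vars \<sigma>) (obj C j))\<rparr>"


section \<open>Complexes of horizontal complexes\<close>

text \<open>All the modules before passing to cohomology are free of finite rank and given by a finite
  set of homogeneous generators. A generator of bidegree \<open>(a, b)\<close> contributes a summand
  \<open>R{a, b}\<close>. Differentials are given by matrices: \<open>hdiff C x y\<close> is the coefficient at \<open>y\<close> of the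
  image of \<open>x\<close>.\<close>

record 'b hcomplex =
  gens :: "'b set"
  hdeg :: "'b \<Rightarrow> int"
  bideg :: "'b \<Rightarrow> int \<times> int"
  hdiff :: "'b \<Rightarrow> 'b \<Rightarrow> qpoly"

text \<open>\<open>cdeg\<close> is the cohomological degree in which the horizontal complex containing a given
  generator is placed, and \<open>vdiff\<close> consists of maps of horizontal complexes.\<close>

record 'b bicomplex = "'b hcomplex" +
  cdeg :: "'b \<Rightarrow> int"
  vdiff :: "'b \<Rightarrow> 'b \<Rightarrow> qpoly"

datatype side = LeftTerm | RightTerm

text \<open>The complex \<open>0 \<rightarrow> R{-1, 1} \<rightarrow> R \<rightarrow> 0\<close> whose differential is multiplication by \<open>a\<close>.\<close>

definition koszul :: "qpoly \<Rightarrow> side hcomplex" where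
  "koszul a =
     \<lparr>gens = {LeftTerm, RightTerm},
      hdeg = (\<lambda>x. case x of LeftTerm \<Rightarrow> -1 | RightTerm \<Rightarrow> 0),
      bideg = (\<lambda>x. case x of LeftTerm \<Rightarrow> (-1, 1) | RightTerm \<Rightarrow> (0, 0)),
      hdiff = (\<lambda>x y. if x = LeftTerm \<and> y = RightTerm then a else 0)\<rparr>"

definition shift :: "int \<times> int \<Rightarrow> 'b hcomplex \<Rightarrow> 'b hcomplex" where
  "shift d C = C\<lparr>bideg := (\<lambda>x. bideg C x + d)\<rparr>"

text \<open>The complex of complexes \<open>0 \<rightarrow> C \<rightarrow> D \<rightarrow> 0\<close> with \<open>D\<close> in cohomological degree 0.\<close>

definition two_term ::
  "'b hcomplex \<Rightarrow> ('b \<Rightarrow> 'c \<Rightarrow> qpoly) \<Rightarrow> 'c hcomplex \<Rightarrow> ('b + 'c) bicomplex" where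
  "two_term C f D =
     \<lparr>gens = gens C <+> gens D,
      hdeg = case_sum (hdeg C) (hdeg D),
      bideg = case_sum (bideg C) (bideg D),
      hdiff = (\<lambda>x y. case (x, y) of
                 (Inl a, Inl b) \<Rightarrow> hdiff C a b | (Inr a, Inr b) \<Rightarrow> hdiff D a b | _ \<Rightarrow> 0),
      cdeg = case_sum (\<lambda>_. -1) (\<lambda>_. 0),
      vdiff = (\<lambda>x y. case (x, y) of (Inl a, Inr b) \<Rightarrow> f a b | _ \<Rightarrow> 0)\<rparr>"

definition in_degree_zero :: "'b hcomplex \<Rightarrow> ('b + 'b) bicomplex" where
  "in_degree_zero C = two_term (C\<lparr>gens := {}\<rparr>) (\<lambda>_ _. 0) C"

definition koszul_sign :: "int \<Rightarrow> qpoly" where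
  "koszul_sign k = (if even k then 1 else -1)"

text \<open>The tensor product over \<open>R\<close> of free modules is free on the pairs of generators; a pair
  \<open>(x, ys)\<close> is written \<open>x # ys\<close> so that tensor products can be iterated. The signs of the
  horizontal differential only depend on horizontal degrees and those of the vertical one only on
  cohomological degrees, so that the two differentials commute.\<close>

definition tensor :: "'b bicomplex \<Rightarrow> 'b list bicomplex \<Rightarrow> 'b list bicomplex" where
  "tensor C D =
     \<lparr>gens = {x # ys | x ys. x \<in> gens C \<and> ys \<in> gens D},
      hdeg = (\<lambda>z. hdeg C (hd z) + hdeg D (tl z)),
      bideg = (\<lambda>z. bideg C (hd z) + bideg D (tl z)),
      hdiff = (\<lambda>z z'.
         (if tl z = tl z' then hdiff C (hd z) (hd z') else 0) +
         (if hd z = hd z' then koszul_sign (hdeg C (hd z)) * hdiff D (tl z) (tl z') else 0)),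
      cdeg = (\<lambda>z. cdeg C (hd z) + cdeg D (tl z)),
      vdiff = (\<lambda>z z'.
         (if tl z = tl z' then vdiff C (hd z) (hd z') else 0) +
         (if hd z = hd z' then koszul_sign (cdeg C (hd z)) * vdiff D (tl z) (tl z') else 0))\<rparr>"

definition tensor_unit :: "'b list bicomplex" where
  "tensor_unit =
     \<lparr>gens = {[]}, hdeg = (\<lambda>_. 0), bideg = (\<lambda>_. (0, 0)), hdiff = (\<lambda>_ _. 0),
      cdeg = (\<lambda>_. 0), vdiff = (\<lambda>_ _. 0)\<rparr>"

definition tensor_list :: "'b bicomplex list \<Rightarrow> 'b list bicomplex" where
  "tensor_list Cs = foldr tensor Cs tensor_unit"


section \<open>Passing to horizontal cohomology\<close>

definition apply_matrix ::
  "'b bicomplex \<Rightarrow> ('b \<Rightarrow> 'b \<Rightarrow> qpoly) \<Rightarrow> ('b \<Rightarrow> qpoly) \<Rightarrow> 'b \<Rightarrow> qpoly" where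
  "apply_matrix C A c = (\<lambda>y. if y \<in> gens C then \<Sum>x\<in>gens C. c x * A x y else 0)"

text \<open>The total module of the horizontal complex in cohomological degree \<open>j\<close>. A monomial \<open>m\<close>
  times a generator \<open>x\<close> has bidegree \<open>bideg C x + (0, mdeg m)\<close>.\<close>

definition free_term :: "nat \<Rightarrow> 'b bicomplex \<Rightarrow> int \<Rightarrow> (qpoly, 'b \<Rightarrow> qpoly) bigmod" where
  "free_term n C j =
     (let F = {c. (\<forall>x. c x \<in> carrier (poly_ring n)) \<and> (\<forall>x. c x \<noteq> 0 \<longrightarrow> x \<in> gens C \<and> cdeg C x = j)}
      in \<lparr>carrier = F, mult = undefined, one = undefined,
          zero = (\<lambda>_. 0), add = (\<lambda>c c' x. c x + c' x), smult = (\<lambda>r c x. r * c x),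
          piece = (\<lambda>d. {c \<in> F. \<forall>x. \<forall>m\<in>Poly_Mapping.keys (c x). bideg C x + (0, int (mdeg m)) = d})\<rparr>)"

definition cocycles :: "nat \<Rightarrow> 'b bicomplex \<Rightarrow> int \<Rightarrow> ('b \<Rightarrow> qpoly) set" where
  "cocycles n C j = {c \<in> carrier (free_term n C j). apply_matrix C (hdiff C) c = (\<lambda>_. 0)}"

definition coboundaries :: "nat \<Rightarrow> 'b bicomplex \<Rightarrow> int \<Rightarrow> ('b \<Rightarrow> qpoly) set" where
  "coboundaries n C j = apply_matrix C (hdiff C) ` carrier (free_term n C j)"

definition subquotient :: "('a, 'b) bigmod \<Rightarrow> 'b set \<Rightarrow> 'b set \<Rightarrow> ('a, 'b set) bigmod" where
  "subquotient M Z B =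
     \<lparr>carrier = (\<lambda>z. B +>\<^bsub>M\<^esub> z) ` Z, mult = undefined, one = undefined,
      zero = B, add = (\<lambda>X Y. X <+>\<^bsub>M\<^esub> Y), smult = (\<lambda>r X. \<Union>x\<in>X. B +>\<^bsub>M\<^esub> (r \<odot>\<^bsub>M\<^esub> x)),
      piece = (\<lambda>d. (\<lambda>z. B +>\<^bsub>M\<^esub> z) ` (Z \<inter> piece M d))\<rparr>"

text \<open>The horizontal differential is homogeneous of horizontal degree 1, so the kernel modulo the
  image on the total module is the direct sum of the cohomology groups in all horizontal degrees.
  The differential sends the class of \<open>x\<close> to the class of its image under the vertical
  differential.\<close>

definition cohomology_complex :: "nat \<Rightarrow> 'b bicomplex \<Rightarrow> (qpoly, ('b \<Rightarrow> qpoly) set) bigcomplex" where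
  "cohomology_complex n C =
     \<lparr>obj = (\<lambda>j. subquotient (free_term n C j) (cocycles n C j) (coboundaries n C j)),
      diff = (\<lambda>j X. \<Union>x\<in>X. coboundaries n C (j + 1) +>\<^bsub>free_term n C (j + 1)\<^esub>
                               apply_matrix C (vdiff C) x)\<rparr>"


section \<open>The complex of a graph\<close>

text \<open>The choices: an ordering \<open>vs\<close> of the vertices, an ordering \<open>es\<close> of the edges, and for each
  edge \<open>e\<close> an ordering \<open>ori e\<close> of its endpoints. Positions in lists, and with them the variables,
  are counted from 0.\<close>

definition is_presentation ::
  "('v, 'e) graph \<Rightarrow> 'v list \<Rightarrow> 'e list \<Rightarrow> ('e \<Rightarrow> 'v \<times> 'v) \<Rightarrow> bool" where
  "is_presentation G vs es ori \<longleftrightarrow>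
     distinct vs \<and> set vs = verts G \<and> distinct es \<and> set es = edges G \<and>
     (\<forall>e\<in>edges G. Upair (fst (ori e)) (snd (ori e)) = ends G e)"

definition position :: "'v list \<Rightarrow> 'v \<Rightarrow> nat" where
  "position vs v = (THE i. i < length vs \<and> vs ! i = v)"

definition edge_factor :: "nat \<Rightarrow> nat \<Rightarrow> (side + side) bicomplex" where
  "edge_factor i j =
     two_term (shift (0, 1) (koszul (var i - var j)))
       (\<lambda>x y. if x = LeftTerm \<and> y = LeftTerm then var i - var j else 0)
       (koszul 0)"

definition vertex_factor :: "(side + side) bicomplex" where
  "vertex_factor = in_degree_zero (koszul 0)"

definition graph_bicomplex ::
  "'v list \<Rightarrow> 'e list \<Rightarrow> ('e \<Rightarrow> 'v \<times> 'v) \<Rightarrow> (side + side) list bicomplex" where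
  "graph_bicomplex vs es ori =
     tensor_list
       (map (\<lambda>e. edge_factor (position vs (fst (ori e))) (position vs (snd (ori e)))) es @
        map (\<lambda>_. vertex_factor) vs)"

definition graph_complex ::
  "'v list \<Rightarrow> 'e list \<Rightarrow> ('e \<Rightarrow> 'v \<times> 'v) \<Rightarrow>
     (qpoly, ((side + side) list \<Rightarrow> qpoly) set) bigcomplex" where
  "graph_complex vs es ori = cohomology_complex (length vs) (graph_bicomplex vs es ori)"

text \<open>The \<open>i\<close>-th vertex in \<open>vs\<close> is the \<open>relabeling vs vs' i\<close>-th vertex in \<open>vs'\<close>.\<close>

definition relabeling :: "'v list \<Rightarrow> 'v list \<Rightarrow> nat \<Rightarrow> nat" where
  "relabeling vs vs' i = (if i < length vs then position vs' (vs ! i) else i)"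

end

theory Submission
  imports Defs "HOL-Library.Function_Algebras"
begin

text \<open>(i) A different presentation changes the bicomplex of the graph by an isomorphism: exchanging two
  tensor factors needs a sign for each of the two gradings, reversing an edge negates one of the four
  generators of its factor, and reordering the vertices renames the variables. So even the complexes
  of cohomology modules are isomorphic.

  (ii) The Euler characteristic satisfies the deletion-contraction recursion. The horizontal complex of
  an edge is the direct sum of its parts in cohomological degrees \<open>-1\<close> and \<open>0\<close>. The latter has zero
  differential and contributes a factor \<open>1 + t\<inverse>q\<close>. If the edge joins distinct vertices \<open>i\<close> and \<open>k\<close>, the
  former is a resolution of the quotient ring by \<open>x\<^sub>i - x\<^sub>k\<close>, so that tensoring with it amounts to
  identifying the two variables, that is, to contracting the edge. Since the number \<open>r\<close> of vertex
  factors does not change under contraction, the induction is over graphs with an arbitrary \<open>r\<close>.\<close>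

section \<open>Polynomials\<close>

text \<open>In (ii) only the cohomological degree carries a sign. The horizontal differential raises
  the exponent of t by one and the horizontal cohomology groups are added without signs, so ranks of
  free modules do not cancel in the horizontal direction: the cohomology itself has to be computed,
  bidegree by bidegree. Contracting an edge removes a variable from the ground ring, and the
  remaining indices need no longer be an initial segment; hence cochains, cocycles and coboundaries
  are set up for polynomials in an arbitrary set V of variables. Dimensions are recorded by
  coordinate maps on cocycles instead of cosets, so that explicit surjections between groups of
  cocycles compare them. In (i) every isomorphism is a signed bijection of generators together with
  a renaming of variables, so it can be checked on matrix entries.\<close>

abbreviation "lookup \<equiv> Poly_Mapping.lookup"
abbreviation "keys \<equiv> Poly_Mapping.keys"
abbreviation "single \<equiv> Poly_Mapping.single"

definition polys :: "nat set \<Rightarrow> qpoly set" where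
  "polys V = {p. \<forall>m\<in>keys p. keys m \<subseteq> V}"

lemma carrier_poly_ring: "carrier (poly_ring n) = polys {..<n}"
  by (simp add: poly_ring_def polys_def)

lemma keys_uminus: "keys (- p) = keys (p :: 'a \<Rightarrow>\<^sub>0 'b::ab_group_add)"
  by (auto simp: in_keys_iff)

lemma keys_minus_subset: "keys (p - q) \<subseteq> keys p \<union> keys (q :: 'a \<Rightarrow>\<^sub>0 'b::ab_group_add)"
  by (auto simp: in_keys_iff lookup_minus)

lemma keys_sum_subset: "keys (sum f A) \<subseteq> (\<Union>a\<in>A. keys (f a :: 'a \<Rightarrow>\<^sub>0 'b::comm_monoid_add))"
  by (induction A rule: infinite_finite_induct) (use keys_add in fastforce)+

lemma keys_plus_nat: "keys (m + m' :: 'a \<Rightarrow>\<^sub>0 nat) = keys m \<union> keys m'"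
  by (auto simp: in_keys_iff lookup_add)

lemma polys_0 [simp]: "0 \<in> polys V"
  by (simp add: polys_def)

lemma polys_add [intro]: "p \<in> polys V \<Longrightarrow> q \<in> polys V \<Longrightarrow> p + q \<in> polys V"
  using keys_add[of p q] by (auto simp: polys_def)

lemma polys_uminus_iff [simp]: "- p \<in> polys V \<longleftrightarrow> p \<in> polys V"
  by (simp add: polys_def keys_uminus)

lemma polys_diff [intro]: "p \<in> polys V \<Longrightarrow> q \<in> polys V \<Longrightarrow> p - q \<in> polys V"
  using keys_minus_subset[of p q] by (auto simp: polys_def)

lemma polys_sum [intro]: "(\<And>a. a \<in> A \<Longrightarrow> f a \<in> polys V) \<Longrightarrow> sum f A \<in> polys V"
  by (induction A rule: infinite_finite_induct) auto

lemma polys_mult [intro]: "p \<in> polys V \<Longrightarrow> q \<in> polys V \<Longrightarrow> p * q \<in> polys V"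
  using keys_mult[of p q] by (fastforce simp: polys_def keys_plus_nat)

lemma polys_single: "keys m \<subseteq> V \<Longrightarrow> single m c \<in> polys V"
  by (auto simp: polys_def split: if_splits)

lemma polys_1 [simp]: "1 \<in> polys V"
  by (simp add: polys_def)

lemma polys_const [simp]: "const c \<in> polys V"
  by (auto simp: const_def intro!: polys_single)

lemma polys_var: "i \<in> V \<Longrightarrow> var i \<in> polys V"
  by (auto simp: var_def intro!: polys_single)

lemma polys_mono: "V \<subseteq> W \<Longrightarrow> p \<in> polys V \<Longrightarrow> p \<in> polys W"
  by (auto simp: polys_def)

lemma polys_koszul_sign [simp]: "koszul_sign k \<in> polys V"
  by (auto simp: koszul_sign_def)

lemma mdeg_superset: "finite A \<Longrightarrow> keys m \<subseteq> A \<Longrightarrow> mdeg m = (\<Sum>i\<in>A. lookup m i)"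
  unfolding mdeg_def by (rule sum.mono_neutral_left) (auto simp: in_keys_iff)

lemma mdeg_0 [simp]: "mdeg 0 = 0"
  by (simp add: mdeg_def)

lemma mdeg_add [simp]: "mdeg (m + m') = mdeg m + mdeg m'"
proof -
  let ?A = "keys m \<union> keys m'"
  have "mdeg (m + m') = (\<Sum>i\<in>?A. lookup (m + m') i)"
    by (rule mdeg_superset) (auto simp: keys_plus_nat)
  then show ?thesis
    by (simp add: lookup_add sum.distrib mdeg_superset[of ?A m] mdeg_superset[of ?A m'])
qed

lemma mdeg_single [simp]: "mdeg (single i k) = k"
  by (simp add: mdeg_def)

lemma mdeg_sum: "mdeg (sum f A) = (\<Sum>a\<in>A. mdeg (f a))"
  by (induction A rule: infinite_finite_induct) auto


subsection \<open>Renaming of variables\<close>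

definition rename_monom :: "(nat \<Rightarrow> nat) \<Rightarrow> (nat \<Rightarrow>\<^sub>0 nat) \<Rightarrow> nat \<Rightarrow>\<^sub>0 nat" where
  "rename_monom \<sigma> m = (\<Sum>i\<in>keys m. single (\<sigma> i) (lookup m i))"

lemma rename_monom_superset:
  "finite A \<Longrightarrow> keys m \<subseteq> A \<Longrightarrow> rename_monom \<sigma> m = (\<Sum>i\<in>A. single (\<sigma> i) (lookup m i))"
  unfolding rename_monom_def by (rule sum.mono_neutral_left) (auto simp: in_keys_iff)

lemma rename_monom_0 [simp]: "rename_monom \<sigma> 0 = 0"
  by (simp add: rename_monom_def)

lemma rename_monom_add: "rename_monom \<sigma> (m + m') = rename_monom \<sigma> m + rename_monom \<sigma> m'"
proof -
  let ?A = "keys m \<union> keys m'"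
  have "rename_monom \<sigma> (m + m') = (\<Sum>i\<in>?A. single (\<sigma> i) (lookup (m + m') i))"
    by (rule rename_monom_superset) (auto simp: keys_plus_nat)
  then show ?thesis
    by (simp add: lookup_add single_add sum.distrib rename_monom_superset[of ?A m]
        rename_monom_superset[of ?A m'])
qed

lemma rename_monom_single [simp]: "rename_monom \<sigma> (single i k) = single (\<sigma> i) k"
  by (cases "k = 0") (simp_all add: rename_monom_def)

lemma rename_monom_sum: "rename_monom \<sigma> (sum f A) = (\<Sum>a\<in>A. rename_monom \<sigma> (f a))"
  by (induction A rule: infinite_finite_induct) (auto simp: rename_monom_add)

lemma mdeg_rename_monom [simp]: "mdeg (rename_monom \<sigma> m) = mdeg m"
  by (simp add: rename_monom_def mdeg_sum mdeg_def[of m])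

lemma keys_rename_monom: "keys (rename_monom \<sigma> m) \<subseteq> \<sigma> ` keys m"
proof -
  have "keys (rename_monom \<sigma> m) \<subseteq> (\<Union>i\<in>keys m. keys (single (\<sigma> i) (lookup m i)))"
    unfolding rename_monom_def by (rule keys_sum_subset)
  then show ?thesis by (auto split: if_splits)
qed

lemma monom_eq_sum: "m = (\<Sum>i\<in>keys m. single i (lookup m i))"
  by (rule poly_mapping_eqI) (auto simp: lookup_sum lookup_single when_def in_keys_iff sum.If_cases)

lemma rename_monom_ident:
  assumes "\<And>i. i \<in> keys m \<Longrightarrow> \<sigma> i = i"
  shows "rename_monom \<sigma> m = m"
  using assms by (subst (2) monom_eq_sum) (simp add: rename_monom_def)

lemma rename_monom_comp: "rename_monom \<sigma> (rename_monom \<tau> m) = rename_monom (\<sigma> \<circ> \<tau>) m"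
  unfolding rename_monom_def[of \<tau>] rename_monom_sum by (simp add: rename_monom_def[of "\<sigma> \<circ> \<tau>"])

lemma rename_vars_alt:
  "rename_vars \<sigma> p = (\<Sum>m\<in>keys p. single (rename_monom \<sigma> m) (lookup p m))"
  by (simp add: rename_vars_def rename_monom_def)

lemma rename_vars_superset:
  "finite A \<Longrightarrow> keys p \<subseteq> A \<Longrightarrow>
    rename_vars \<sigma> p = (\<Sum>m\<in>A. single (rename_monom \<sigma> m) (lookup p m))"
  unfolding rename_vars_alt by (rule sum.mono_neutral_left) (auto simp: in_keys_iff)

lemma rename_vars_0 [simp]: "rename_vars \<sigma> 0 = 0"
  by (simp add: rename_vars_alt)

lemma rename_vars_add: "rename_vars \<sigma> (p + q) = rename_vars \<sigma> p + rename_vars \<sigma> q"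
proof -
  let ?A = "keys p \<union> keys q"
  have "rename_vars \<sigma> (p + q) = (\<Sum>m\<in>?A. single (rename_monom \<sigma> m) (lookup (p + q) m))"
    by (rule rename_vars_superset) (use keys_add[of p q] in auto)
  then show ?thesis
    by (simp add: lookup_add single_add sum.distrib rename_vars_superset[of ?A p]
        rename_vars_superset[of ?A q])
qed

lemma rename_vars_uminus: "rename_vars \<sigma> (- p) = - rename_vars \<sigma> p"
  by (metis ab_left_minus add.right_inverse add_eq_0_iff rename_vars_0 rename_vars_add)

lemma rename_vars_diff: "rename_vars \<sigma> (p - q) = rename_vars \<sigma> p - rename_vars \<sigma> q"
  using rename_vars_add[of \<sigma> p "- q"] by (simp add: rename_vars_uminus)

lemma rename_vars_sum: "rename_vars \<sigma> (sum f A) = (\<Sum>a\<in>A. rename_vars \<sigma> (f a))"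
  by (induction A rule: infinite_finite_induct) (auto simp: rename_vars_add)

lemma rename_vars_single [simp]: "rename_vars \<sigma> (single m c) = single (rename_monom \<sigma> m) c"
  by (cases "c = 0") (simp_all add: rename_vars_alt)

lemma poly_eq_sum: "p = (\<Sum>m\<in>keys p. single m (lookup p m))"
  by (rule poly_mapping_eqI) (auto simp: lookup_sum lookup_single when_def in_keys_iff sum.If_cases)

lemma rename_vars_mult: "rename_vars \<sigma> (p * q) = rename_vars \<sigma> p * rename_vars \<sigma> q"
proof -
  have "rename_vars \<sigma> (p * q) =
      rename_vars \<sigma> ((\<Sum>m\<in>keys p. single m (lookup p m)) * (\<Sum>m\<in>keys q. single m (lookup q m)))"
    using poly_eq_sum[of p] poly_eq_sum[of q] by simp
  also have "\<dots> = rename_vars \<sigma> p * rename_vars \<sigma> q"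
    by (simp add: sum_product rename_vars_sum mult_single rename_monom_add rename_vars_alt[of \<sigma> p]
        rename_vars_alt[of \<sigma> q])
  finally show ?thesis .
qed

lemma rename_vars_1 [simp]: "rename_vars \<sigma> 1 = 1"
  using rename_vars_single[of \<sigma> 0 1] by (simp del: rename_vars_single)

lemma rename_vars_var [simp]: "rename_vars \<sigma> (var i) = var (\<sigma> i)"
  by (simp add: var_def)

lemma rename_vars_koszul_sign [simp]: "rename_vars \<sigma> (koszul_sign k) = koszul_sign k"
  by (simp add: koszul_sign_def rename_vars_uminus)

lemma rename_vars_comp: "rename_vars \<sigma> (rename_vars \<tau> p) = rename_vars (\<sigma> \<circ> \<tau>) p"
  unfolding rename_vars_alt[of \<tau>] rename_vars_sum
  by (simp add: rename_monom_comp rename_vars_alt[of "\<sigma> \<circ> \<tau>"])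

lemma rename_vars_ident:
  assumes "p \<in> polys V" "\<And>i. i \<in> V \<Longrightarrow> \<sigma> i = i"
  shows "rename_vars \<sigma> p = p"
proof -
  have "rename_monom \<sigma> m = m" if "m \<in> keys p" for m
    using that assms by (intro rename_monom_ident) (auto simp: polys_def)
  then show ?thesis
    by (subst (2) poly_eq_sum) (simp add: rename_vars_alt)
qed

lemma keys_rename_vars: "keys (rename_vars \<sigma> p) \<subseteq> rename_monom \<sigma> ` keys p"
proof -
  have "keys (rename_vars \<sigma> p) \<subseteq> (\<Union>m\<in>keys p. keys (single (rename_monom \<sigma> m) (lookup p m)))"
    unfolding rename_vars_alt by (rule keys_sum_subset)
  then show ?thesis by (auto split: if_splits)
qed

lemma rename_vars_in_polys: "p \<in> polys V \<Longrightarrow> \<sigma> ` V \<subseteq> W \<Longrightarrow> rename_vars \<sigma> p \<in> polys W"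
  using keys_rename_vars[of \<sigma> p] keys_rename_monom[of \<sigma>] by (fastforce simp: polys_def)

lemma homogeneous_rename_vars: "homogeneous l p \<Longrightarrow> homogeneous l (rename_vars \<sigma> p)"
  using keys_rename_vars[of \<sigma> p] by (fastforce simp: homogeneous_def)

text \<open>Telescoping: a monomial in which one factor \<open>x\<^sub>k\<close> is replaced by \<open>x\<^sub>i\<close> changes by a multiple
  of \<open>x\<^sub>i - x\<^sub>k\<close>.\<close>

lemma monom_diff_divisible:
  assumes "i \<in> V" "k \<in> V" "keys m \<subseteq> V"
  shows "\<exists>q\<in>polys V. single (m + single k e) c - single (m + single i e) c = (var i - var k) * q \<and>
    (\<forall>m'\<in>keys q. mdeg m' + 1 = mdeg m + e)"
  using assms(3)
proof (induction e arbitrary: m)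
  case 0
  show ?case by (intro bexI[of _ 0]) auto
next
  case (Suc e)
  have "keys (m + single k 1) \<subseteq> V" using Suc.prems assms by (auto simp: keys_plus_nat)
  then obtain q where q: "q \<in> polys V"
    "single (m + single k 1 + single k e) c - single (m + single k 1 + single i e) c = (var i - var k) * q"
    "\<forall>m'\<in>keys q. mdeg m' + 1 = mdeg (m + single k 1) + e"
    using Suc.IH by blast
  \<comment> \<open>With c = 1 and m written multiplicatively: m x_k^(e+1) - m x_i^(e+1) = (m
    x_k)(x_k^e - x_i^e) + m x_i^e (x_k - x_i). The induction hypothesis handles the first summand,
    and \<open>?r\<close> is the quotient of the second by x_i - x_k.\<close>
  let ?r = "single (m + single i e) (- c)"
  have "(var i - var k) * ?r =
      single (m + single i e + single k 1) c - single (m + single i e + single i 1) c"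
    by (simp add: var_def left_diff_distrib mult_single single_uminus add.commute)
  moreover have "single k (Suc e) = single k 1 + single k e" "single i (Suc e) = single i 1 + single i e"
    by (simp_all add: single_add[symmetric])
  ultimately have "single (m + single k (Suc e)) c - single (m + single i (Suc e)) c = (var i - var k) * (q + ?r)"
    using q(2) by (simp add: algebra_simps)
  moreover have "?r \<in> polys V"
    using Suc.prems assms by (intro polys_single) (auto simp: keys_plus_nat split: if_splits)
  moreover have "\<forall>m'\<in>keys (q + ?r). mdeg m' + 1 = mdeg m + Suc e"
    using q(3) keys_add[of q ?r] by (fastforce split: if_splits)
  ultimately show ?case using q(1) by blast
qed

text \<open>The kernel of the substitution of x_i for x_k is the ideal generated by x_i - x_k. The
  control of the degrees in q makes the quotient homogeneous, of degree one less, whenever p is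
  homogeneous.\<close>

lemma diff_rename_divisible:
  assumes "p \<in> polys V" "i \<in> V" "k \<in> V"
  shows "\<exists>q\<in>polys V. p - rename_vars (id(k := i)) p = (var i - var k) * q \<and>
    (\<forall>m\<in>keys q. mdeg m + 1 \<in> mdeg ` keys p)"
proof -
  let ?f = "id(k := i)"
  have "\<exists>q\<in>polys V. single m c - single (rename_monom ?f m) c = (var i - var k) * q \<and>
      (\<forall>m'\<in>keys q. mdeg m' + 1 = mdeg m)" if "m \<in> keys p" for m c
  proof -
    \<comment> \<open>The part of m free of x_k, which the renaming fixes; what is left is a pure
      power of x_k.\<close>
    define m0 where "m0 = m - single k (lookup m k)"
    have m: "m = m0 + single k (lookup m k)"
      by (rule poly_mapping_eqI) (simp add: m0_def lookup_add lookup_minus lookup_single when_def)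
    have "k \<notin> keys m0" by (simp add: m0_def in_keys_iff lookup_minus)
    then have "rename_monom ?f m0 = m0" by (intro rename_monom_ident) auto
    then have r: "rename_monom ?f m = m0 + single i (lookup m k)"
      by (subst m) (simp add: rename_monom_add)
    have "keys m0 \<subseteq> keys m" using keys_plus_nat[of m0 "single k (lookup m k)"] m by auto
    then have "keys m0 \<subseteq> V" using that assms(1) by (auto simp: polys_def)
    from monom_diff_divisible[OF assms(2,3) this, of "lookup m k" c] show ?thesis
      by (subst (1 3) m) (simp add: r)
  qed
  then obtain Q where Q: "\<And>m c. m \<in> keys p \<Longrightarrow> Q m c \<in> polys V"
    "\<And>m c. m \<in> keys p \<Longrightarrow> single m c - single (rename_monom ?f m) c = (var i - var k) * Q m c"
    "\<And>m c m'. m \<in> keys p \<Longrightarrow> m' \<in> keys (Q m c) \<Longrightarrow> mdeg m' + 1 = mdeg m"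
    by metis
  let ?q = "\<Sum>m\<in>keys p. Q m (lookup p m)"
  have "p - rename_vars ?f p = (\<Sum>m\<in>keys p. single m (lookup p m) - single (rename_monom ?f m) (lookup p m))"
    unfolding sum_subtractf rename_vars_alt using poly_eq_sum[of p] by simp
  also have "\<dots> = (var i - var k) * ?q"
    by (simp add: Q(2) sum_distrib_left)
  finally have "p - rename_vars ?f p = (var i - var k) * ?q" .
  moreover have "?q \<in> polys V" using Q(1) by auto
  moreover have "mdeg m + 1 \<in> mdeg ` keys p" if "m \<in> keys ?q" for m
    using subsetD[OF keys_sum_subset that] Q(3) by auto
  ultimately show ?thesis by blast
qed

lemma var_diff_nonzero: "i \<noteq> k \<Longrightarrow> var i - var k \<noteq> 0"
proof
  assume "i \<noteq> k" "var i - var k = 0"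
  then have "lookup (var i) (single i 1) = lookup (var k) (single i 1)" by simp
  moreover have "single i (1::nat) \<noteq> single k 1"
    using \<open>i \<noteq> k\<close> by (metis keys_single one_neq_zero singleton_inject)
  ultimately show False by (simp add: var_def lookup_single when_def split: if_splits)
qed


subsection \<open>Filtering monomials\<close>

text \<open>Serves to cut the coefficients of a cochain into homogeneous components.\<close>

definition filter_poly :: "((nat \<Rightarrow>\<^sub>0 nat) \<Rightarrow> bool) \<Rightarrow> qpoly \<Rightarrow> qpoly" where
  "filter_poly P p = Poly_Mapping.mapp (\<lambda>m c. c when P m) p"

lemma lookup_filter_poly: "lookup (filter_poly P p) m = (lookup p m when P m)"
  by (simp add: filter_poly_def lookup_mapp when_def in_keys_iff)

lemma keys_filter_poly: "keys (filter_poly P p) = {m \<in> keys p. P m}"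
  by (auto simp: in_keys_iff lookup_filter_poly when_def split: if_splits)

lemma filter_poly_add: "filter_poly P (p + q) = filter_poly P p + filter_poly P q"
  by (rule poly_mapping_eqI) (simp add: lookup_filter_poly lookup_add when_def)

lemma filter_poly_0 [simp]: "filter_poly P 0 = 0"
  by (rule poly_mapping_eqI) (simp add: lookup_filter_poly)

lemma filter_poly_in_polys: "p \<in> polys V \<Longrightarrow> filter_poly P p \<in> polys V"
  by (auto simp: polys_def keys_filter_poly)

section \<open>Subquotients of graded modules\<close>

text \<open>As rewrite rules these would also apply inside the eta-expanded terms that inductions produce.\<close>

declare plus_fun_apply [simp del] zero_fun_apply [simp del] minus_apply [simp del] uminus_apply [simp del]

lemmas fun_apply = plus_fun_apply zero_fun_apply minus_apply uminus_apply

text \<open>All modules in question carry pointwise addition of functions, so the type class group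
  can replace the additive group of the module record.\<close>

definition add_subgroup :: "'a::ab_group_add set \<Rightarrow> bool" where
  "add_subgroup B \<longleftrightarrow> 0 \<in> B \<and> (\<forall>x\<in>B. \<forall>y\<in>B. x - y \<in> B)"

lemma add_subgroupD:
  assumes "add_subgroup B"
  shows "0 \<in> B" "x \<in> B \<Longrightarrow> y \<in> B \<Longrightarrow> x - y \<in> B" "x \<in> B \<Longrightarrow> y \<in> B \<Longrightarrow> x + y \<in> B"
    "x \<in> B \<Longrightarrow> - x \<in> B"
proof -
  have minus: "x - y \<in> B" if "x \<in> B" "y \<in> B" for x y
    using assms that by (simp add: add_subgroup_def)
  show zero: "0 \<in> B" using assms by (simp add: add_subgroup_def)
  show uminus: "- x \<in> B" if "x \<in> B" for x using minus[OF zero that] by simp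
  show "x - y \<in> B" if "x \<in> B" "y \<in> B" using minus that .
  show "x + y \<in> B" if "x \<in> B" "y \<in> B" using minus[OF that(1) uminus[OF that(2)]] by simp
qed

lemma add_subgroup_sum:
  assumes "add_subgroup B" "\<And>a. a \<in> A \<Longrightarrow> f a \<in> B"
  shows "sum f A \<in> B"
  using assms(2) by (induction A rule: infinite_finite_induct) (auto intro: add_subgroupD[OF assms(1)])

definition coset :: "'a::ab_group_add set \<Rightarrow> 'a \<Rightarrow> 'a set" where
  "coset B z = (\<lambda>b. b + z) ` B"

lemma a_r_coset_eq_coset: "add M = (+) \<Longrightarrow> B +>\<^bsub>M\<^esub> z = coset B z"
  by (auto simp: a_r_coset_def r_coset_def coset_def)

lemma set_add_eq: "add M = (+) \<Longrightarrow> X <+>\<^bsub>M\<^esub> Y = {x + y | x y. x \<in> X \<and> y \<in> Y}"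
  by (auto simp: set_add_def set_mult_def)

lemma mem_coset: "add_subgroup B \<Longrightarrow> x \<in> coset B z \<longleftrightarrow> x - z \<in> B"
  unfolding coset_def by (metis (no_types, lifting) add_diff_cancel_right' diff_add_cancel image_iff)

lemma coset_eq_iff:
  assumes "add_subgroup B"
  shows "coset B x = coset B y \<longleftrightarrow> x - y \<in> B"
proof
  assume "coset B x = coset B y"
  moreover have "x \<in> coset B x" using add_subgroupD(1)[OF assms] by (simp add: mem_coset assms)
  ultimately show "x - y \<in> B" by (simp add: mem_coset assms)
next
  assume *: "x - y \<in> B"
  have "z - x \<in> B \<longleftrightarrow> z - y \<in> B" for z
    using add_subgroupD(2)[OF assms, of "z - y" "x - y"] add_subgroupD(3)[OF assms, of "z - x" "x - y"] *
    by auto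
  then show "coset B x = coset B y" by (auto simp: mem_coset assms)
qed

lemma coset_0 [simp]: "coset B 0 = B"
  by (simp add: coset_def)

lemma coset_eq_self_iff: "add_subgroup B \<Longrightarrow> coset B x = B \<longleftrightarrow> x \<in> B"
  using coset_eq_iff[of B x 0] by simp

lemma coset_add:
  assumes "add_subgroup B"
  shows "{x + y | x y. x \<in> coset B a \<and> y \<in> coset B b} = coset B (a + b)"
proof (intro equalityI subsetI)
  fix z assume "z \<in> {x + y | x y. x \<in> coset B a \<and> y \<in> coset B b}"
  then obtain x y where "z = x + y" "x - a \<in> B" "y - b \<in> B" by (auto simp: mem_coset assms)
  moreover have "x + y - (a + b) = (x - a) + (y - b)" by simp
  ultimately show "z \<in> coset B (a + b)"
    using add_subgroupD(3)[OF assms] by (metis mem_coset assms)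
next
  fix z assume "z \<in> coset B (a + b)"
  then have "(z - b) - a \<in> B" by (simp add: mem_coset assms algebra_simps)
  then have "z = (z - b) + b" "z - b \<in> coset B a" "b \<in> coset B b"
    using add_subgroupD(1)[OF assms] by (auto simp: mem_coset assms)
  then show "z \<in> {x + y | x y. x \<in> coset B a \<and> y \<in> coset B b}" by blast
qed

text \<open>Well-definedness of induced maps: the values of g on a coset all lie in the same coset
  of B'. Scalar multiplication, differentials and comparison maps on cohomology are defined as such
  unions and are evaluated on representatives through this lemma.\<close>

lemma UN_coset:
  assumes "add_subgroup B" "add_subgroup B'" "\<And>b. b \<in> B \<Longrightarrow> g (b + z) - g z \<in> B'"
  shows "(\<Union>x\<in>coset B z. coset B' (g x)) = coset B' (g z)"
proof -
  have "coset B' (g x) = coset B' (g z)" if "x \<in> coset B z" for x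
    using that assms(3)[of "x - z"] by (simp add: mem_coset assms(1) coset_eq_iff assms(2))
  moreover have "z \<in> coset B z" using add_subgroupD(1)[OF assms(1)] by (simp add: mem_coset assms)
  ultimately show ?thesis by blast
qed

definition scale :: "qpoly \<Rightarrow> ('b \<Rightarrow> qpoly) \<Rightarrow> 'b \<Rightarrow> qpoly" where
  "scale r c = (\<lambda>x. r * c x)"

lemma scale_simps:
  "scale (r + s) c = scale r c + scale s c" "scale r (c + c') = scale r c + scale r c'"
  "scale (r * s) c = scale r (scale s c)" "scale 1 c = c" "scale r 0 = 0" "scale 0 c = 0"
  "scale r (c - c') = scale r c - scale r c'"
  by (auto simp: scale_def fun_eq_iff fun_apply algebra_simps)

text \<open>This is \<open>subquotient\<close> for a free term, with the operations of the record
  replaced by those on functions. \<open>P d\<close> may be larger than the set of cochains of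
  bidegree d, since only its intersection with Z enters.\<close>

definition quotient_module ::
  "('b \<Rightarrow> qpoly) set \<Rightarrow> ('b \<Rightarrow> qpoly) set \<Rightarrow> (int \<times> int \<Rightarrow> ('b \<Rightarrow> qpoly) set) \<Rightarrow>
    (qpoly, ('b \<Rightarrow> qpoly) set) bigmod" where
  "quotient_module Z B P =
     \<lparr>carrier = coset B ` Z, mult = undefined, one = undefined, zero = B,
      add = (\<lambda>X Y. {x + y | x y. x \<in> X \<and> y \<in> Y}), smult = (\<lambda>r X. \<Union>x\<in>X. coset B (scale r x)),
      piece = (\<lambda>d. coset B ` (Z \<inter> P d))\<rparr>"

lemma cring_poly_ring: "cring (poly_ring n)"
proof (rule cringI)
  show "abelian_group (poly_ring n)"
  proof (rule abelian_groupI)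
    fix x assume "x \<in> carrier (poly_ring n)"
    then show "\<exists>y\<in>carrier (poly_ring n). y \<oplus>\<^bsub>poly_ring n\<^esub> x = \<zero>\<^bsub>poly_ring n\<^esub>"
      by (intro bexI[of _ "- x"]) (auto simp: poly_ring_def polys_def[symmetric])
  qed (auto simp: poly_ring_def polys_def[symmetric] ac_simps)
  show "comm_monoid (poly_ring n)"
    by (rule comm_monoidI) (auto simp: poly_ring_def polys_def[symmetric] ac_simps)
qed (auto simp: poly_ring_def distrib_right)

lemma poly_ring_simps [simp]:
  "add (poly_ring n) = (+)" "mult (poly_ring n) = (*)" "one (poly_ring n) = 1" "zero (poly_ring n) = 0"
  by (simp_all add: poly_ring_def)

text \<open>The point is that the projection \<open>cmp d\<close> to bidegree d preserves both Z and
  B, so both are graded and the grading descends to cosets.\<close>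

locale graded_subquotient =
  fixes n :: nat and Z B :: "('b \<Rightarrow> qpoly) set" and P :: "int \<times> int \<Rightarrow> ('b \<Rightarrow> qpoly) set"
    and cmp :: "int \<times> int \<Rightarrow> ('b \<Rightarrow> qpoly) \<Rightarrow> 'b \<Rightarrow> qpoly"
  assumes Z: "add_subgroup Z" and B: "add_subgroup B" and P: "\<And>d. add_subgroup (P d)"
    and scale_Z: "\<And>r x. r \<in> polys {..<n} \<Longrightarrow> x \<in> Z \<Longrightarrow> scale r x \<in> Z"
    and scale_B: "\<And>r x. r \<in> polys {..<n} \<Longrightarrow> x \<in> B \<Longrightarrow> scale r x \<in> B"
    and scale_P: "\<And>r l x d. homogeneous l r \<Longrightarrow> x \<in> P d \<Longrightarrow> scale r x \<in> P (d + (0, int l))"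
    and comp_add: "\<And>d x y. cmp d (x + y) = cmp d x + cmp d y"
    and comp_P: "\<And>d x. cmp d x \<in> P d"
    and comp_Z: "\<And>d x. x \<in> Z \<Longrightarrow> cmp d x \<in> Z"
    and comp_B: "\<And>d x. x \<in> B \<Longrightarrow> cmp d x \<in> B"
    and comp_same: "\<And>d x. x \<in> P d \<Longrightarrow> cmp d x = x"
    and comp_other: "\<And>d d' x. x \<in> P d \<Longrightarrow> d' \<noteq> d \<Longrightarrow> cmp d' x = 0"
    and comp_finite: "\<And>x. x \<in> Z \<Longrightarrow> finite {d. cmp d x \<noteq> 0}"
    and comp_sum: "\<And>x. x \<in> Z \<Longrightarrow> x = (\<Sum>d\<in>{d. cmp d x \<noteq> 0}. cmp d x)"
begin

abbreviation "Q \<equiv> quotient_module Z B P"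

lemma smult_coset: "r \<in> polys {..<n} \<Longrightarrow> r \<odot>\<^bsub>Q\<^esub> coset B z = coset B (scale r z)"
  unfolding quotient_module_def
  by (simp, rule UN_coset) (use B scale_B in \<open>auto simp: scale_simps\<close>)

lemma add_coset: "coset B x \<oplus>\<^bsub>Q\<^esub> coset B y = coset B (x + y)"
  by (simp add: quotient_module_def coset_add B)

lemma carrier_Q: "carrier Q = coset B ` Z" and zero_Q: "\<zero>\<^bsub>Q\<^esub> = coset B 0"
  and piece_Q: "piece Q d = coset B ` (Z \<inter> P d)"
  by (simp_all add: quotient_module_def)

lemma abelian_group_Q: "abelian_group Q"
proof (rule abelian_groupI)
  fix X assume "X \<in> carrier Q"
  then obtain x where "x \<in> Z" "X = coset B x" by (auto simp: carrier_Q)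
  then show "\<exists>Y\<in>carrier Q. Y \<oplus>\<^bsub>Q\<^esub> X = \<zero>\<^bsub>Q\<^esub>"
    by (intro bexI[of _ "coset B (- x)"])
      (use add_subgroupD(4)[OF Z] in \<open>auto simp: add_coset carrier_Q zero_Q\<close>)
qed (use add_subgroupD(1,3)[OF Z] in \<open>auto simp: carrier_Q add_coset zero_Q simp del: coset_0 intro!: imageI, (simp add: ac_simps)+\<close>)

lemma module_Q: "module (poly_ring n) Q"
proof (rule moduleI)
  show "cring (poly_ring n)" by (rule cring_poly_ring)
  show "abelian_group Q" by (rule abelian_group_Q)
qed (auto simp: carrier_Q carrier_poly_ring add_coset smult_coset scale_Z scale_simps polys_add polys_mult)

lemma comp_0: "cmp d 0 = 0"
  using comp_add[of d 0 0] by simp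

lemma comp_sum_distrib: "cmp d (sum f A) = (\<Sum>a\<in>A. cmp d (f a))"
  by (induction A rule: infinite_finite_induct) (auto simp: comp_0 comp_add)

lemma comp_diff: "cmp d (x - y) = cmp d x - cmp d y"
  by (metis comp_add diff_add_cancel add_diff_cancel)

lemma finsum_coset:
  assumes "finite A" "\<And>a. a \<in> A \<Longrightarrow> z a \<in> Z"
  shows "(\<Oplus>\<^bsub>Q\<^esub>a\<in>A. coset B (z a)) = coset B (sum z A)"
proof -
  interpret abelian_group Q by (rule abelian_group_Q)
  show ?thesis using assms
  proof (induction A rule: finite_induct)
    case empty
    show ?case by (simp add: zero_Q)
  next
    case (insert a A)
    then show ?case by (subst finsum_insert) (auto simp: carrier_Q add_coset)
  qed
qed

text \<open>Existence comes from projecting a representative to each bidegree. For uniqueness, the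
  difference between x and the sum of representatives of any other decomposition lies in B, and so
  do its projections.\<close>

lemma decomposition:
  assumes "x \<in> Z"
  shows "\<exists>!c. (\<forall>d. c d \<in> piece Q d) \<and> finite {d. c d \<noteq> \<zero>\<^bsub>Q\<^esub>} \<and>
    coset B x = (\<Oplus>\<^bsub>Q\<^esub>d\<in>{d. c d \<noteq> \<zero>\<^bsub>Q\<^esub>}. c d)"
proof (rule ex1I[of _ "\<lambda>d. coset B (cmp d x)"])
  let ?D = "{d. cmp d x \<noteq> 0}" and ?S = "{d. coset B (cmp d x) \<noteq> \<zero>\<^bsub>Q\<^esub>}"
  \<comment> \<open>A component may be nonzero and still lie in B, so the classes can have smaller
    support than the components. The components in the gap add up to an element of B.\<close>
  have sub: "?S \<subseteq> ?D" by (auto simp: zero_Q)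
  then have fin: "finite ?S" using comp_finite[OF assms] finite_subset by blast
  have "x - sum (\<lambda>d. cmp d x) ?S = sum (\<lambda>d. cmp d x) ?D - sum (\<lambda>d. cmp d x) ?S"
    using comp_sum[OF assms] by simp
  also have "\<dots> = sum (\<lambda>d. cmp d x) (?D - ?S)"
    using sub comp_finite[OF assms] by (simp add: sum_diff)
  also have "\<dots> \<in> B"
    using coset_eq_self_iff[OF B] by (intro add_subgroup_sum[OF B]) (auto simp: zero_Q)
  finally have "coset B x = coset B (\<Sum>d\<in>?S. cmp d x)"
    by (simp add: coset_eq_iff B)
  then show "(\<forall>d. coset B (cmp d x) \<in> piece Q d) \<and> finite ?S \<and>
      coset B x = (\<Oplus>\<^bsub>Q\<^esub>d\<in>?S. coset B (cmp d x))"
    using fin comp_P comp_Z assms by (simp add: finsum_coset piece_Q)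
next
  fix c assume c: "(\<forall>d. c d \<in> piece Q d) \<and> finite {d. c d \<noteq> \<zero>\<^bsub>Q\<^esub>} \<and>
    coset B x = (\<Oplus>\<^bsub>Q\<^esub>d\<in>{d. c d \<noteq> \<zero>\<^bsub>Q\<^esub>}. c d)"
  let ?S = "{d. c d \<noteq> \<zero>\<^bsub>Q\<^esub>}"
  have "\<exists>z. z \<in> Z \<inter> P d \<and> c d = coset B z" for d
    using c by (auto simp: piece_Q simp del: split_paired_All)
  then obtain z where z: "\<And>d. z d \<in> Z" "\<And>d. z d \<in> P d" "\<And>d. c d = coset B (z d)"
    by (metis IntE)
  have "(\<Oplus>\<^bsub>Q\<^esub>d\<in>?S. c d) = (\<Oplus>\<^bsub>Q\<^esub>d\<in>?S. coset B (z d))"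
    by (simp add: z(3))
  also have "\<dots> = coset B (sum z ?S)"
    using c z by (intro finsum_coset) auto
  finally have xB: "x - sum z ?S \<in> B"
    using c by (simp add: coset_eq_iff B)
  have "c d = coset B (cmp d x)" for d
  proof -
    \<comment> \<open>The projection to bidegree d picks out the single summand \<open>z d\<close>,
      or nothing when the class \<open>c d\<close> is zero.\<close>
    have "cmp d (x - sum z ?S) = cmp d x - (\<Sum>d'\<in>?S. cmp d (z d'))"
      by (simp add: comp_diff comp_sum_distrib)
    also have "(\<Sum>d'\<in>?S. cmp d (z d')) = (\<Sum>d'\<in>?S. if d' = d then z d else 0)"
      using z(2) comp_same comp_other by (intro sum.cong) metis+
    also have "\<dots> = (if d \<in> ?S then z d else 0)"
      using c by (simp add: sum.delta)
    finally have "cmp d x - (if d \<in> ?S then z d else 0) \<in> B"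
      using comp_B[OF xB, of d] by simp
    then have "coset B (cmp d x) = coset B (if d \<in> ?S then z d else 0)"
      by (simp add: coset_eq_iff B)
    also have "\<dots> = c d" using z(3)[of d] by (auto simp: zero_Q)
    finally show ?thesis by simp
  qed
  then show "c = (\<lambda>d. coset B (cmp d x))" by auto
qed

lemma bigraded_module_Q: "bigraded_module n Q"
  unfolding bigraded_module_def
proof (intro conjI allI ballI impI)
  show "module (poly_ring n) Q" by (rule module_Q)
  interpret abelian_group Q by (rule abelian_group_Q)
  fix d
  have "add_subgroup (Z \<inter> P d)" using Z P[of d] by (auto simp: add_subgroup_def)
  note ZP = add_subgroupD[OF this]
  have "subgroup (piece Q d) (add_monoid Q)"
  proof (rule add.subgroupI)
    show "piece Q d \<subseteq> carrier Q" "piece Q d \<noteq> {}"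
      using ZP(1) by (auto simp: piece_Q carrier_Q)
    fix X assume "X \<in> piece Q d"
    then obtain x where x: "x \<in> Z \<inter> P d" "X = coset B x" by (auto simp: piece_Q)
    have "\<ominus>\<^bsub>Q\<^esub> X = coset B (- x)"
      using x ZP(4) by (intro minus_equality) (auto simp: carrier_Q add_coset zero_Q)
    then show "\<ominus>\<^bsub>Q\<^esub> X \<in> piece Q d" using x ZP(4) by (simp add: piece_Q)
    fix Y assume "Y \<in> piece Q d"
    then obtain y where y: "y \<in> Z \<inter> P d" "Y = coset B y" by (auto simp: piece_Q)
    show "X \<oplus>\<^bsub>Q\<^esub> Y \<in> piece Q d" using x y ZP(3) by (simp add: piece_Q add_coset)
  qed
  then show "additive_subgroup (piece Q d) Q" by (rule additive_subgroup.intro)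
next
  fix X assume "X \<in> carrier Q"
  then show "\<exists>!c. (\<forall>d. c d \<in> piece Q d) \<and> finite {d. c d \<noteq> \<zero>\<^bsub>Q\<^esub>} \<and>
      X = (\<Oplus>\<^bsub>Q\<^esub>d\<in>{d. c d \<noteq> \<zero>\<^bsub>Q\<^esub>}. c d)"
    using decomposition unfolding carrier_Q by blast
next
  fix l d r X assume "r \<in> carrier (poly_ring n)" "X \<in> piece Q d" "homogeneous l r"
  then show "r \<odot>\<^bsub>Q\<^esub> X \<in> piece Q (d + (0, int l))"
    using scale_Z scale_P[of l r _ d]
    by (auto simp: piece_Q smult_coset carrier_poly_ring intro!: imageI)
qed

end

lemma restrict_scalars_simps [simp]:
  "carrier (restrict_scalars \<phi> M) = carrier M" "zero (restrict_scalars \<phi> M) = zero M"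
  "add (restrict_scalars \<phi> M) = add M" "piece (restrict_scalars \<phi> M) = piece M"
  "smult (restrict_scalars \<phi> M) = (\<lambda>r. smult M (\<phi> r))"
  by (simp_all add: restrict_scalars_def)

lemma bigraded_module_restrict_scalars:
  assumes M: "bigraded_module n M"
    and \<phi>: "\<And>r. r \<in> polys {..<n} \<Longrightarrow> \<phi> r \<in> polys {..<n}" "\<And>r s. \<phi> (r + s) = \<phi> r + \<phi> s"
      "\<And>r s. \<phi> (r * s) = \<phi> r * \<phi> s" "\<phi> 1 = 1" "\<And>l r. homogeneous l r \<Longrightarrow> homogeneous l (\<phi> r)"
  shows "bigraded_module n (restrict_scalars \<phi> M)"
proof -
  interpret module "poly_ring n" M using M by (simp add: bigraded_module_def)
  have finsum: "finsum (restrict_scalars \<phi> M) = finsum M"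
    by (simp add: finsum_def fun_eq_iff)
  have "abelian_group M" by (rule M.abelian_group_axioms)
  then have group: "abelian_group (restrict_scalars \<phi> M)"
    by (simp add: abelian_group_def abelian_monoid_def abelian_group_axioms_def)
  have "module (poly_ring n) (restrict_scalars \<phi> M)"
    by (rule moduleI[OF cring_poly_ring group])
      (use smult_l_distr smult_assoc1 smult_r_distr smult_one smult_closed \<phi> in
        \<open>auto simp: carrier_poly_ring\<close>)
  moreover have "additive_subgroup H M \<Longrightarrow> additive_subgroup H (restrict_scalars \<phi> M)" for H
    by (simp add: additive_subgroup_def)
  ultimately show ?thesis
    using M \<phi>(1,5) by (auto simp: bigraded_module_def finsum carrier_poly_ring simp del: split_paired_All)
qed

section \<open>The cohomology complex of a bicomplex\<close>

definition cochains :: "nat set \<Rightarrow> 'b bicomplex \<Rightarrow> int \<Rightarrow> ('b \<Rightarrow> qpoly) set" where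
  "cochains V C j = {c. (\<forall>x. c x \<in> polys V) \<and> (\<forall>x. c x \<noteq> 0 \<longrightarrow> x \<in> gens C \<and> cdeg C x = j)}"

definition degree_part :: "'b bicomplex \<Rightarrow> int \<times> int \<Rightarrow> ('b \<Rightarrow> qpoly) set" where
  "degree_part C d = {c. \<forall>x. \<forall>m\<in>keys (c x). bideg C x + (0, int (mdeg m)) = d}"

definition hcocycles :: "nat set \<Rightarrow> 'b bicomplex \<Rightarrow> int \<Rightarrow> ('b \<Rightarrow> qpoly) set" where
  "hcocycles V C j = {c \<in> cochains V C j. apply_matrix C (hdiff C) c = 0}"

definition hcoboundaries :: "nat set \<Rightarrow> 'b bicomplex \<Rightarrow> int \<Rightarrow> ('b \<Rightarrow> qpoly) set" where
  "hcoboundaries V C j = apply_matrix C (hdiff C) ` cochains V C j"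

lemma free_term_simps:
  "carrier (free_term n C j) = cochains {..<n} C j" "add (free_term n C j) = (+)"
  "zero (free_term n C j) = 0" "smult (free_term n C j) = scale"
  "piece (free_term n C j) d = cochains {..<n} C j \<inter> degree_part C d"
  by (auto simp: free_term_def Let_def cochains_def degree_part_def carrier_poly_ring plus_fun_def
      zero_fun_def scale_def fun_eq_iff)

lemma cocycles_eq: "cocycles n C j = hcocycles {..<n} C j"
  by (simp add: cocycles_def hcocycles_def free_term_simps zero_fun_def)

lemma coboundaries_eq: "coboundaries n C j = hcoboundaries {..<n} C j"
  by (simp add: coboundaries_def hcoboundaries_def free_term_simps)

lemma obj_cohomology_complex:
  "obj (cohomology_complex n C) j =
    quotient_module (hcocycles {..<n} C j) (hcoboundaries {..<n} C j) (degree_part C)"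
proof -
  have "hcocycles {..<n} C j \<inter> (cochains {..<n} C j \<inter> degree_part C d) = hcocycles {..<n} C j \<inter> degree_part C d" for d
    by (auto simp: hcocycles_def)
  then show ?thesis
    by (simp add: cohomology_complex_def subquotient_def quotient_module_def cocycles_eq coboundaries_eq
        a_r_coset_eq_coset set_add_eq free_term_simps cong: image_cong)
qed

lemma diff_cohomology_complex:
  "diff (cohomology_complex n C) j X =
    (\<Union>x\<in>X. coset (hcoboundaries {..<n} C (j + 1)) (apply_matrix C (vdiff C) x))"
  by (simp add: cohomology_complex_def coboundaries_eq a_r_coset_eq_coset free_term_simps)

text \<open>\<open>\<delta>\<close>, k and h are the shifts of bidegree, cohomological degree and
  horizontal degree. For the horizontal differential \<open>\<delta>\<close> is (1, 0): the left
  generator of a Koszul complex has bidegree (-1, 1), while x_i - x_j times the right one has (0,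
  1).\<close>

definition homogeneous_matrix ::
  "nat set \<Rightarrow> 'b bicomplex \<Rightarrow> int \<times> int \<Rightarrow> int \<Rightarrow> int \<Rightarrow> ('b \<Rightarrow> 'b \<Rightarrow> qpoly) \<Rightarrow> bool" where
  "homogeneous_matrix V C \<delta> k h A \<longleftrightarrow>
     (\<forall>x\<in>gens C. \<forall>y\<in>gens C. A x y \<in> polys V \<and>
        (\<forall>m\<in>keys (A x y). bideg C y + (0, int (mdeg m)) = bideg C x + \<delta>) \<and>
        (A x y \<noteq> 0 \<longrightarrow> cdeg C y = cdeg C x + k \<and> hdeg C y = hdeg C x + h))"

text \<open>Matrices act on row vectors, so A is applied before A'.\<close>

definition matrix_mult :: "'b bicomplex \<Rightarrow> ('b \<Rightarrow> 'b \<Rightarrow> qpoly) \<Rightarrow> ('b \<Rightarrow> 'b \<Rightarrow> qpoly) \<Rightarrow> 'b \<Rightarrow> 'b \<Rightarrow> qpoly" where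
  "matrix_mult C A A' x z = (\<Sum>y\<in>gens C. A x y * A' y z)"

text \<open>The degree conditions on nonzero entries are part of this notion because the signs in
  \<open>tensor\<close> depend on the parities of both gradings; they make the notion stable under
  tensor products.\<close>

definition wf_bicomplex :: "nat set \<Rightarrow> 'b bicomplex \<Rightarrow> bool" where
  "wf_bicomplex V C \<longleftrightarrow> finite (gens C) \<and>
     homogeneous_matrix V C (1, 0) 0 1 (hdiff C) \<and> homogeneous_matrix V C (0, 0) 1 0 (vdiff C) \<and>
     (\<forall>x\<in>gens C. \<forall>z\<in>gens C. matrix_mult C (hdiff C) (hdiff C) x z = 0 \<and>
        matrix_mult C (vdiff C) (vdiff C) x z = 0 \<and>
        matrix_mult C (hdiff C) (vdiff C) x z = matrix_mult C (vdiff C) (hdiff C) x z)"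

lemma apply_matrix_add: "apply_matrix C A (c + c') = apply_matrix C A c + apply_matrix C A c'"
  by (auto simp: apply_matrix_def fun_eq_iff fun_apply distrib_right sum.distrib)

lemma apply_matrix_uminus: "apply_matrix C A (- c) = - apply_matrix C A c"
  by (auto simp: apply_matrix_def fun_eq_iff fun_apply sum_negf)

lemma apply_matrix_diff: "apply_matrix C A (c - c') = apply_matrix C A c - apply_matrix C A c'"
  by (auto simp: apply_matrix_def fun_eq_iff fun_apply left_diff_distrib sum_subtractf)

lemma apply_matrix_0 [simp]: "apply_matrix C A 0 = 0"
  by (auto simp: apply_matrix_def fun_eq_iff fun_apply)

lemma apply_matrix_sum: "apply_matrix C A (sum f S) = (\<Sum>s\<in>S. apply_matrix C A (f s))"
  by (induction S rule: infinite_finite_induct) (auto simp: apply_matrix_add)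

lemma apply_matrix_scale: "apply_matrix C A (scale r c) = scale r (apply_matrix C A c)"
  by (auto simp: apply_matrix_def scale_def fun_eq_iff sum_distrib_left mult.assoc)

lemma apply_matrix_mult:
  assumes "finite (gens C)"
  shows "apply_matrix C A' (apply_matrix C A c) = apply_matrix C (matrix_mult C A A') c"
proof
  fix z
  have "(\<Sum>y\<in>gens C. (\<Sum>x\<in>gens C. c x * A x y) * A' y z) =
      (\<Sum>x\<in>gens C. c x * (\<Sum>y\<in>gens C. A x y * A' y z))"
    by (simp add: sum_distrib_left sum_distrib_right mult.assoc) (rule sum.swap)
  then show "apply_matrix C A' (apply_matrix C A c) z = apply_matrix C (matrix_mult C A A') c z"
    by (simp add: apply_matrix_def matrix_mult_def)
qed

lemma apply_matrix_cong:
  "(\<And>x y. x \<in> gens C \<Longrightarrow> y \<in> gens C \<Longrightarrow> A x y = A' x y) \<Longrightarrow> apply_matrix C A c = apply_matrix C A' c"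
  by (auto simp: apply_matrix_def fun_eq_iff intro!: sum.cong)

lemma cochains_subgroup: "add_subgroup (cochains V C j)"
  by (auto simp: add_subgroup_def cochains_def fun_apply) metis+

lemma degree_part_subgroup: "add_subgroup (degree_part C d)"
  using keys_minus_subset by (fastforce simp: add_subgroup_def degree_part_def fun_apply)

lemma scale_cochains: "r \<in> polys V \<Longrightarrow> c \<in> cochains V C j \<Longrightarrow> scale r c \<in> cochains V C j"
  by (auto simp: cochains_def scale_def)

lemma scale_degree_part:
  assumes "homogeneous l r" "c \<in> degree_part C d"
  shows "scale r c \<in> degree_part C (d + (0, int l))"
proof -
  have "bideg C x + (0, int (mdeg m)) = d + (0, int l)" if "m \<in> keys (r * c x)" for x m
  proof -
    obtain a b where "a \<in> keys r" "b \<in> keys (c x)" "m = a + b"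
      using \<open>m \<in> keys (r * c x)\<close> keys_mult[of r "c x"] by auto
    moreover from this have "mdeg a = l" "bideg C x + (0, int (mdeg b)) = d"
      using assms by (auto simp: homogeneous_def degree_part_def)
    ultimately show ?thesis by (auto simp: prod_eq_iff)
  qed
  then show ?thesis by (simp add: degree_part_def scale_def)
qed

lemma apply_matrix_cochains:
  assumes "homogeneous_matrix V C \<delta> k h A" "c \<in> cochains V C j"
  shows "apply_matrix C A c \<in> cochains V C (j + k)"
proof -
  have "(\<Sum>x\<in>gens C. c x * A x y) \<in> polys V" if "y \<in> gens C" for y
    using that assms by (intro polys_sum polys_mult) (auto simp: cochains_def homogeneous_matrix_def)
  moreover have "cdeg C y = j + k" if "y \<in> gens C" "(\<Sum>x\<in>gens C. c x * A x y) \<noteq> 0" for y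
  proof -
    obtain x where "x \<in> gens C" "c x * A x y \<noteq> 0" using \<open>_ \<noteq> 0\<close> by (rule sum.not_neutral_contains_not_neutral)
    then have "c x \<noteq> 0" "A x y \<noteq> 0" by auto
    then show ?thesis using assms \<open>x \<in> gens C\<close> \<open>y \<in> gens C\<close> by (auto simp: cochains_def homogeneous_matrix_def)
  qed
  ultimately show ?thesis by (auto simp: cochains_def apply_matrix_def)
qed

lemma apply_matrix_degree_part:
  assumes A: "homogeneous_matrix V C \<delta> k h A" and c: "c \<in> degree_part C d"
  shows "apply_matrix C A c \<in> degree_part C (d + \<delta>)"
proof -
  have "bideg C y + (0, int (mdeg m)) = d + \<delta>"
    if y: "y \<in> gens C" and m: "m \<in> keys (\<Sum>x\<in>gens C. c x * A x y)" for y m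
  proof -
    obtain x where x: "x \<in> gens C" "m \<in> keys (c x * A x y)"
      using subsetD[OF keys_sum_subset m] by auto
    then obtain a b where ab: "a \<in> keys (c x)" "b \<in> keys (A x y)" "m = a + b"
      using keys_mult[of "c x" "A x y"] by auto
    then have "bideg C x + (0, int (mdeg a)) = d" "bideg C y + (0, int (mdeg b)) = bideg C x + \<delta>"
      using x y A c by (auto simp: homogeneous_matrix_def degree_part_def)
    then show ?thesis using ab(3) by (auto simp: prod_eq_iff)
  qed
  then show ?thesis by (simp add: degree_part_def apply_matrix_def)
qed

section \<open>Homogeneous components of cochains\<close>

definition component :: "'b bicomplex \<Rightarrow> int \<times> int \<Rightarrow> ('b \<Rightarrow> qpoly) \<Rightarrow> 'b \<Rightarrow> qpoly" where
  "component C d c = (\<lambda>x. filter_poly (\<lambda>m. bideg C x + (0, int (mdeg m)) = d) (c x))"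

lemma component_add: "component C d (c + c') = component C d c + component C d c'"
  by (auto simp: component_def fun_eq_iff fun_apply filter_poly_add)

lemma component_0: "component C d 0 = 0"
  by (auto simp: component_def fun_eq_iff fun_apply)

lemma component_sum: "component C d (sum f S) = (\<Sum>s\<in>S. component C d (f s))"
  by (induction S rule: infinite_finite_induct) (auto simp: component_add component_0)

lemma component_degree_part: "component C d c \<in> degree_part C d"
  by (auto simp: component_def degree_part_def keys_filter_poly)

lemma component_cochains: "c \<in> cochains V C j \<Longrightarrow> component C d c \<in> cochains V C j"
  by (auto simp: component_def cochains_def filter_poly_in_polys) (metis filter_poly_0)+

lemma component_same: "c \<in> degree_part C d \<Longrightarrow> component C d c = c"
  by (rule ext, rule poly_mapping_eqI)
    (auto simp: component_def degree_part_def lookup_filter_poly when_def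
      not_in_keys_iff_lookup_eq_zero[symmetric])

lemma component_other: "c \<in> degree_part C d \<Longrightarrow> d' \<noteq> d \<Longrightarrow> component C d' c = 0"
  by (rule ext, rule poly_mapping_eqI)
    (auto simp: component_def degree_part_def lookup_filter_poly when_def fun_apply
      not_in_keys_iff_lookup_eq_zero[symmetric])

lemma finite_components:
  assumes "finite (gens C)" "c \<in> cochains V C j"
  shows "finite {d. component C d c \<noteq> 0}"
proof (rule finite_subset)
  show "{d. component C d c \<noteq> 0} \<subseteq>
      (\<lambda>(x, m). bideg C x + (0, int (mdeg m))) ` (SIGMA x:gens C. keys (c x))"
  proof
    fix d assume "d \<in> {d. component C d c \<noteq> 0}"
    then obtain x where "component C d c x \<noteq> 0" by (auto simp: fun_eq_iff fun_apply)
    then obtain m where "m \<in> keys (component C d c x)"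
      by (metis in_keys_iff lookup_zero poly_mapping_eqI)
    then show "d \<in> (\<lambda>(x, m). bideg C x + (0, int (mdeg m))) ` (SIGMA x:gens C. keys (c x))"
      using assms(2) by (force simp: component_def keys_filter_poly cochains_def)
  qed
qed (use assms in auto)

lemma sum_components:
  assumes "finite (gens C)" "c \<in> cochains V C j"
  shows "c = (\<Sum>d\<in>{d. component C d c \<noteq> 0}. component C d c)"
proof (rule ext, rule poly_mapping_eqI)
  fix x m
  let ?D = "{d. component C d c \<noteq> 0}" and ?d = "bideg C x + (0, int (mdeg m))"
  have sum_apply: "sum f S x = (\<Sum>s\<in>S. f s x)" for f :: "int \<times> int \<Rightarrow> 'a \<Rightarrow> qpoly" and S
    by (induction S rule: infinite_finite_induct) (auto simp: fun_apply)
  have "lookup ((\<Sum>d\<in>?D. component C d c) x) m = (\<Sum>d\<in>?D. lookup (component C d c x) m)"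
    by (simp add: sum_apply lookup_sum)
  also have "\<dots> = (\<Sum>d\<in>?D. if ?d = d then lookup (component C ?d c x) m else 0)"
    by (rule sum.cong) (auto simp: component_def lookup_filter_poly when_def)
  also have "\<dots> = (if ?d \<in> ?D then lookup (component C ?d c x) m else 0)"
    using finite_components[OF assms] by (simp add: sum.delta)
  also have "\<dots> = lookup (component C ?d c x) m" by (auto simp: fun_apply)
  also have "\<dots> = lookup (c x) m" by (simp add: component_def lookup_filter_poly)
  finally show "lookup (c x) m = lookup ((\<Sum>d\<in>?D. component C d c) x) m" by simp
qed

text \<open>Each component of c is sent into a single bidegree, so only the one in
  \<open>d - \<delta>\<close> can reach d. For the horizontal differential this makes cocycles and
  coboundaries graded.\<close>

lemma component_apply_matrix:
  assumes fin: "finite (gens C)" and A: "homogeneous_matrix V C \<delta> k h A" and c: "c \<in> cochains V C j"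
  shows "component C d (apply_matrix C A c) = apply_matrix C A (component C (d - \<delta>) c)"
proof -
  let ?D = "{d. component C d c \<noteq> 0}"
  have "component C d (apply_matrix C A c) =
      (\<Sum>d'\<in>?D. component C d (apply_matrix C A (component C d' c)))"
    by (subst sum_components[OF fin c]) (simp add: apply_matrix_sum component_sum)
  also have "\<dots> = (\<Sum>d'\<in>?D. if d - \<delta> = d' then apply_matrix C A (component C (d - \<delta>) c) else 0)"
  proof (rule sum.cong[OF refl])
    fix d'
    have "apply_matrix C A (component C d' c) \<in> degree_part C (d' + \<delta>)"
      by (rule apply_matrix_degree_part[OF A component_degree_part])
    then show "component C d (apply_matrix C A (component C d' c)) =
        (if d - \<delta> = d' then apply_matrix C A (component C (d - \<delta>) c) else 0)"
      by (cases "d = d' + \<delta>") (auto simp: component_same component_other)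
  qed
  also have "\<dots> = apply_matrix C A (component C (d - \<delta>) c)"
    using finite_components[OF fin c] by (auto simp: sum.delta)
  finally show ?thesis .
qed

section \<open>Horizontal cocycles and coboundaries\<close>

context
  fixes V :: "nat set" and C :: "'b bicomplex"
  assumes wf: "wf_bicomplex V C"
begin

lemma finite_gens: "finite (gens C)"
  and hom_hdiff: "homogeneous_matrix V C (1, 0) 0 1 (hdiff C)"
  and hom_vdiff: "homogeneous_matrix V C (0, 0) 1 0 (vdiff C)"
  using wf by (simp_all add: wf_bicomplex_def)

lemma hdiff_hdiff: "apply_matrix C (hdiff C) (apply_matrix C (hdiff C) c) = 0" (is ?hh)
  and vdiff_vdiff: "apply_matrix C (vdiff C) (apply_matrix C (vdiff C) c) = 0" (is ?vv)
  and hdiff_vdiff: "apply_matrix C (hdiff C) (apply_matrix C (vdiff C) c) =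
    apply_matrix C (vdiff C) (apply_matrix C (hdiff C) c)" (is ?hv)
proof -
  have zero: "apply_matrix C A c = 0" if "\<And>x y. x \<in> gens C \<Longrightarrow> y \<in> gens C \<Longrightarrow> A x y = 0" for A
    using that by (auto simp: apply_matrix_def fun_eq_iff fun_apply)
  show ?hh ?vv
    using wf by (auto simp: apply_matrix_mult[OF finite_gens] wf_bicomplex_def intro!: zero)
  show ?hv
    using wf by (auto simp: apply_matrix_mult[OF finite_gens] wf_bicomplex_def intro!: apply_matrix_cong)
qed

lemma hdiff_cochains: "c \<in> cochains V C j \<Longrightarrow> apply_matrix C (hdiff C) c \<in> cochains V C j"
  using apply_matrix_cochains[OF hom_hdiff] by fastforce

lemma vdiff_cochains: "c \<in> cochains V C j \<Longrightarrow> apply_matrix C (vdiff C) c \<in> cochains V C (j + 1)"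
  by (rule apply_matrix_cochains[OF hom_vdiff])

lemma hcocycles_subgroup: "add_subgroup (hcocycles V C j)"
  using cochains_subgroup[of V C j] by (auto simp: add_subgroup_def hcocycles_def apply_matrix_diff)

lemma hcoboundaries_subgroup: "add_subgroup (hcoboundaries V C j)"
  unfolding add_subgroup_def hcoboundaries_def
proof (intro conjI ballI)
  note sub = add_subgroupD[OF cochains_subgroup[of V C j]]
  show "0 \<in> apply_matrix C (hdiff C) ` cochains V C j"
    using sub(1) by (intro image_eqI[of _ _ 0]) auto
  fix x y assume "x \<in> apply_matrix C (hdiff C) ` cochains V C j" "y \<in> apply_matrix C (hdiff C) ` cochains V C j"
  then show "x - y \<in> apply_matrix C (hdiff C) ` cochains V C j"
    using sub(2) by (auto simp: apply_matrix_diff[symmetric])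
qed

lemma vdiff_hcocycles: "c \<in> hcocycles V C j \<Longrightarrow> apply_matrix C (vdiff C) c \<in> hcocycles V C (j + 1)"
  by (auto simp: hcocycles_def vdiff_cochains hdiff_vdiff)

lemma vdiff_hcoboundaries: "c \<in> hcoboundaries V C j \<Longrightarrow> apply_matrix C (vdiff C) c \<in> hcoboundaries V C (j + 1)"
  using vdiff_cochains by (auto simp: hcoboundaries_def hdiff_vdiff[symmetric])

end

lemma graded_subquotient_cohomology:
  assumes wf: "wf_bicomplex {..<n} C"
  shows "graded_subquotient n (hcocycles {..<n} C j) (hcoboundaries {..<n} C j) (degree_part C) (component C)"
proof
  let ?V = "{..<n}"
  note fin = finite_gens[OF wf]
  show "add_subgroup (hcocycles ?V C j)" "add_subgroup (hcoboundaries ?V C j)" "add_subgroup (degree_part C d)" for d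
    by (rule hcocycles_subgroup[OF wf] hcoboundaries_subgroup[OF wf] degree_part_subgroup)+
  show "scale r x \<in> hcocycles ?V C j" if "r \<in> polys ?V" "x \<in> hcocycles ?V C j" for r x
    using that by (auto simp: hcocycles_def scale_cochains apply_matrix_scale scale_simps)
  show "scale r x \<in> hcoboundaries ?V C j" if "r \<in> polys ?V" "x \<in> hcoboundaries ?V C j" for r x
    using that by (auto simp: hcoboundaries_def apply_matrix_scale[symmetric] scale_cochains)
  \<comment> \<open>The image of the component in bidegree d is the component of the zero image in
    bidegree \<open>d + (1, 0)\<close>.\<close>
  show "component C d x \<in> hcocycles ?V C j" if "x \<in> hcocycles ?V C j" for d x
    using that component_apply_matrix[OF fin hom_hdiff[OF wf], of x j "d + (1, 0)"]
    by (auto simp: hcocycles_def component_cochains component_0)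
  show "component C d x \<in> hcoboundaries ?V C j" if "x \<in> hcoboundaries ?V C j" for d x
  proof -
    obtain y where "y \<in> cochains ?V C j" "x = apply_matrix C (hdiff C) y"
      using \<open>x \<in> hcoboundaries ?V C j\<close> by (auto simp: hcoboundaries_def)
    then show ?thesis
      using component_apply_matrix[OF fin hom_hdiff[OF wf], of y j d]
      by (simp add: hcoboundaries_def component_cochains)
  qed
  show "finite {d. component C d x \<noteq> 0}" if "x \<in> hcocycles ?V C j" for x
    using that finite_components[OF fin] by (auto simp: hcocycles_def)
  show "x = (\<Sum>d\<in>{d. component C d x \<noteq> 0}. component C d x)" if "x \<in> hcocycles ?V C j" for x
    using that sum_components[OF fin] by (auto simp: hcocycles_def)
qed (rule scale_degree_part component_add component_degree_part component_same component_other; assumption?)+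

theorem bigraded_complex_cohomology_complex:
  assumes wf: "wf_bicomplex {..<n} C"
  shows "bigraded_complex n (cohomology_complex n C)"
  unfolding bigraded_complex_def
proof (intro allI conjI ballI)
  fix j
  let ?V = "{..<n}" and ?D = "cohomology_complex n C" and ?v = "apply_matrix C (vdiff C)"
  let ?Z = "hcocycles {..<n} C" and ?B = "hcoboundaries {..<n} C"
  have subq: "graded_subquotient n (?Z j) (?B j) (degree_part C) (component C)" for j
    by (rule graded_subquotient_cohomology[OF wf])
  note B = hcoboundaries_subgroup[OF wf]
  show "bigraded_module n (obj ?D j)"
    unfolding obj_cohomology_complex by (rule graded_subquotient.bigraded_module_Q[OF subq])
  have diff: "diff ?D j (coset (?B j) x) = coset (?B (j + 1)) (?v x)" for j x
    unfolding diff_cohomology_complex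
    by (rule UN_coset[OF B B]) (simp add: apply_matrix_add vdiff_hcoboundaries[OF wf])
  show "diff ?D j \<in> bigraded_hom n (obj ?D j) (obj ?D (j + 1))"
    unfolding bigraded_hom_def module_hom_def obj_cohomology_complex
  proof (intro CollectI conjI allI impI)
    show "diff ?D j \<in> carrier (quotient_module (?Z j) (?B j) (degree_part C)) \<rightarrow>
        carrier (quotient_module (?Z (j + 1)) (?B (j + 1)) (degree_part C))"
      using vdiff_hcocycles[OF wf]
      by (auto simp: graded_subquotient.carrier_Q[OF subq] diff)
    show "diff ?D j ` piece (quotient_module (?Z j) (?B j) (degree_part C)) d
        \<subseteq> piece (quotient_module (?Z (j + 1)) (?B (j + 1)) (degree_part C)) d" for d
      using vdiff_hcocycles[OF wf] apply_matrix_degree_part[OF hom_vdiff[OF wf], of _ d]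
      by (auto simp: graded_subquotient.piece_Q[OF subq] diff zero_prod_def[symmetric] intro!: imageI)
  qed (auto simp: graded_subquotient.carrier_Q[OF subq] graded_subquotient.add_coset[OF subq]
      graded_subquotient.smult_coset[OF subq] carrier_poly_ring diff apply_matrix_add apply_matrix_scale)
  fix X assume "X \<in> carrier (obj ?D j)"
  then obtain x where "X = coset (?B j) x"
    by (auto simp: obj_cohomology_complex graded_subquotient.carrier_Q[OF subq])
  moreover have "j + 1 + 1 = j + 2" by simp
  ultimately have "diff ?D (j + 1) (diff ?D j X) = coset (?B (j + 2)) (?v (?v x))"
    by (simp only: diff)
  also have "\<dots> = \<zero>\<^bsub>obj ?D (j + 2)\<^esub>"
    by (simp add: vdiff_vdiff[OF wf] obj_cohomology_complex quotient_module_def)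
  finally show "diff ?D (j + 1) (diff ?D j X) = \<zero>\<^bsub>obj ?D (j + 2)\<^esub>" .
qed

section \<open>Tensor products of bicomplexes\<close>

text \<open>The common shape of both differentials of \<open>tensor\<close>; s is the grading whose
  parity gives the sign, namely \<open>hdeg\<close> for the horizontal and \<open>cdeg\<close> for
  the vertical one.\<close>

definition tensor_matrix ::
  "('b \<Rightarrow> int) \<Rightarrow> ('b \<Rightarrow> 'b \<Rightarrow> qpoly) \<Rightarrow> ('b list \<Rightarrow> 'b list \<Rightarrow> qpoly) \<Rightarrow> 'b list \<Rightarrow> 'b list \<Rightarrow> qpoly" where
  "tensor_matrix s A A' z z' =
     (if tl z = tl z' then A (hd z) (hd z') else 0) +
     (if hd z = hd z' then koszul_sign (s (hd z)) * A' (tl z) (tl z') else 0)"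

lemma tensor_simps [simp]:
  "hdeg (tensor C D) (x # ys) = hdeg C x + hdeg D ys"
  "cdeg (tensor C D) (x # ys) = cdeg C x + cdeg D ys"
  "bideg (tensor C D) (x # ys) = bideg C x + bideg D ys"
  "hdiff (tensor C D) = tensor_matrix (hdeg C) (hdiff C) (hdiff D)"
  "vdiff (tensor C D) = tensor_matrix (cdeg C) (vdiff C) (vdiff D)"
  "x # ys \<in> gens (tensor C D) \<longleftrightarrow> x \<in> gens C \<and> ys \<in> gens D"
  "[] \<notin> gens (tensor C D)"
  by (auto simp: tensor_def tensor_matrix_def fun_eq_iff)

lemma gens_tensor: "gens (tensor C D) = (\<lambda>(x, ys). x # ys) ` (gens C \<times> gens D)"
  by (auto simp: tensor_def)

lemma gens_tensorE:
  assumes "z \<in> gens (tensor C D)"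
  obtains x ys where "z = x # ys" "x \<in> gens C" "ys \<in> gens D"
  using assms by (auto simp: gens_tensor)

lemma sum_gens_tensor:
  "(\<Sum>z\<in>gens (tensor C D). f z) = (\<Sum>x\<in>gens C. \<Sum>ys\<in>gens D. f (x # ys))"
proof -
  have "inj_on (\<lambda>(x, ys). x # ys) (gens C \<times> gens D)" by (auto simp: inj_on_def)
  then show ?thesis
    by (simp add: gens_tensor sum.reindex sum.cartesian_product case_prod_unfold)
qed

lemma tensor_matrix_Cons [simp]:
  "tensor_matrix s A A' (x # ys) (x' # ys') =
     (if ys = ys' then A x x' else 0) + (if x = x' then koszul_sign (s x) * A' ys ys' else 0)"
  by (simp add: tensor_matrix_def)

lemma koszul_sign_square [simp]: "koszul_sign k * koszul_sign k = 1"
  by (simp add: koszul_sign_def)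

lemma koszul_sign_Suc: "koszul_sign (k + 1) = - koszul_sign k" "koszul_sign (1 + k) = - koszul_sign k"
  by (simp_all add: koszul_sign_def)

lemma koszul_sign_0 [simp]: "koszul_sign 0 = 1"
  by (simp add: koszul_sign_def)

lemma koszul_sign_cases: "koszul_sign k = 1 \<or> koszul_sign k = -1"
  by (simp add: koszul_sign_def)

lemma keys_koszul_sign_mult [simp]: "keys (koszul_sign k * p) = keys p"
  by (auto simp: koszul_sign_def keys_uminus)

lemma homogeneous_matrix_tensor:
  assumes A: "homogeneous_matrix V C \<delta> k h A" and A': "homogeneous_matrix V D \<delta> k h A'"
  shows "homogeneous_matrix V (tensor C D) \<delta> k h (tensor_matrix s A A')"
  unfolding homogeneous_matrix_def
proof (intro ballI)
  fix z z' assume "z \<in> gens (tensor C D)" "z' \<in> gens (tensor C D)"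
  then obtain x ys x' ys' where z: "z = x # ys" "x \<in> gens C" "ys \<in> gens D"
    "z' = x' # ys'" "x' \<in> gens C" "ys' \<in> gens D" by (auto elim!: gens_tensorE)
  let ?a = "if ys = ys' then A x x' else 0"
  let ?b = "if x = x' then koszul_sign (s x) * A' ys ys' else 0"
  have "?a \<in> polys V" "?b \<in> polys V"
    using A A' z by (auto simp: homogeneous_matrix_def)
  moreover have "\<forall>m\<in>keys (?a + ?b). bideg (tensor C D) z' + (0, int (mdeg m)) = bideg (tensor C D) z + \<delta>"
  proof
    fix m assume "m \<in> keys (?a + ?b)"
    then have "m \<in> keys ?a \<or> m \<in> keys ?b" using keys_add[of ?a ?b] by blast
    moreover have "m \<in> keys (A x x') \<Longrightarrow> bideg C x' + (0, int (mdeg m)) = bideg C x + \<delta>"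
      "m \<in> keys (A' ys ys') \<Longrightarrow> bideg D ys' + (0, int (mdeg m)) = bideg D ys + \<delta>"
      using A A' z unfolding homogeneous_matrix_def by blast+
    ultimately have "(ys = ys' \<and> bideg C x' + (0, int (mdeg m)) = bideg C x + \<delta>) \<or>
        (x = x' \<and> bideg D ys' + (0, int (mdeg m)) = bideg D ys + \<delta>)"
      by (simp only: keys_zero keys_koszul_sign_mult empty_iff split: if_splits) blast+
    then show "bideg (tensor C D) z' + (0, int (mdeg m)) = bideg (tensor C D) z + \<delta>"
      by (auto simp: z prod_eq_iff)
  qed
  moreover have "cdeg (tensor C D) z' = cdeg (tensor C D) z + k \<and>
      hdeg (tensor C D) z' = hdeg (tensor C D) z + h" if "?a + ?b \<noteq> 0"
  proof -
    have "(ys = ys' \<and> A x x' \<noteq> 0) \<or> (x = x' \<and> A' ys ys' \<noteq> 0)"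
      using that by (auto split: if_splits)
    then show ?thesis using A A' z by (auto simp: homogeneous_matrix_def)
  qed
  ultimately show "tensor_matrix s A A' z z' \<in> polys V \<and>
      (\<forall>m\<in>keys (tensor_matrix s A A' z z'). bideg (tensor C D) z' + (0, int (mdeg m)) = bideg (tensor C D) z + \<delta>) \<and>
      (tensor_matrix s A A' z z' \<noteq> 0 \<longrightarrow> cdeg (tensor C D) z' = cdeg (tensor C D) z + k \<and>
        hdeg (tensor C D) z' = hdeg (tensor C D) z + h)"
    unfolding z(1,4) tensor_matrix_Cons by auto
qed

lemma sum_if_mult:
  fixes f g :: "'b \<Rightarrow> 'c::semiring_0"
  assumes "finite S" "a \<in> S"
  shows "(\<Sum>w\<in>S. (if a = w then f w else 0) * g w) = f a * g a"
    "(\<Sum>w\<in>S. g w * (if w = a then f w else 0)) = g a * f a"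
proof -
  have "(\<Sum>w\<in>S. (if a = w then f w else 0) * g w) = (\<Sum>w\<in>S. if a = w then f a * g a else 0)"
    "(\<Sum>w\<in>S. g w * (if w = a then f w else 0)) = (\<Sum>w\<in>S. if w = a then g a * f a else 0)"
    by (auto intro!: sum.cong)
  then show "(\<Sum>w\<in>S. (if a = w then f w else 0) * g w) = f a * g a"
    "(\<Sum>w\<in>S. g w * (if w = a then f w else 0)) = g a * f a"
    using assms by (simp_all add: sum.delta sum.delta')
qed

text \<open>The Kronecker deltas collapse the double sum to four terms. In the two mixed terms one
  matrix acts on each factor; these are the terms for which the signs matter.\<close>

lemma matrix_mult_tensor:
  assumes fin: "finite (gens C)" "finite (gens D)"
    and x: "x \<in> gens C" "z \<in> gens C" and y: "ys \<in> gens D" "zs \<in> gens D"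
  shows "matrix_mult (tensor C D) (tensor_matrix s A A') (tensor_matrix t B B') (x # ys) (z # zs) =
    (if ys = zs then matrix_mult C A B x z else 0) + A x z * (koszul_sign (t z) * B' ys zs) +
    koszul_sign (s x) * A' ys zs * B x z +
    (if x = z then koszul_sign (s x) * koszul_sign (t x) * matrix_mult D A' B' ys zs else 0)"
proof -
  let ?a = "\<lambda>y ws. if ys = ws then A x y else 0" and ?a' = "\<lambda>y ws. if x = y then koszul_sign (s x) * A' ys ws else 0"
  let ?b = "\<lambda>y ws. if ws = zs then B y z else 0" and ?b' = "\<lambda>y ws. if y = z then koszul_sign (t y) * B' ws zs else 0"
  let ?S = "\<lambda>f. \<Sum>y\<in>gens C. \<Sum>ws\<in>gens D. f y ws"
  have "matrix_mult (tensor C D) (tensor_matrix s A A') (tensor_matrix t B B') (x # ys) (z # zs) =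
      ?S (\<lambda>y ws. (?a y ws + ?a' y ws) * (?b y ws + ?b' y ws))"
    by (simp add: matrix_mult_def sum_gens_tensor)
  also have "\<dots> = ?S (\<lambda>y ws. ?a y ws * ?b y ws) + ?S (\<lambda>y ws. ?a y ws * ?b' y ws) +
      ?S (\<lambda>y ws. ?a' y ws * ?b y ws) + ?S (\<lambda>y ws. ?a' y ws * ?b' y ws)"
    by (simp only: distrib_left distrib_right sum.distrib) (simp only: ac_simps)
  also have "?S (\<lambda>y ws. ?a y ws * ?b y ws) = (if ys = zs then matrix_mult C A B x z else 0)"
    using fin y by (subst sum_if_mult(1)) (auto simp: matrix_mult_def)
  also have "?S (\<lambda>y ws. ?a y ws * ?b' y ws) = A x z * (koszul_sign (t z) * B' ys zs)"
    using fin x y by (subst sum_if_mult(1), simp, simp) (subst sum_if_mult(2), auto)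
  also have "?S (\<lambda>y ws. ?a' y ws * ?b y ws) = koszul_sign (s x) * A' ys zs * B x z"
    using fin x y by (subst sum_if_mult(2), simp, simp) (subst sum_if_mult(1), auto)
  also have "?S (\<lambda>y ws. ?a' y ws * ?b' y ws) =
      (\<Sum>ws\<in>gens D. \<Sum>y\<in>gens C. ?a' y ws * ?b' y ws)"
    by (rule sum.swap)
  also have "\<dots> = (if x = z then koszul_sign (s x) * koszul_sign (t x) * matrix_mult D A' B' ys zs else 0)"
    using fin x by (subst sum_if_mult(1)) (auto simp: matrix_mult_def sum_distrib_left intro!: sum.cong)
  finally show ?thesis .
qed

lemma wf_tensor:
  assumes C: "wf_bicomplex V C" and D: "wf_bicomplex V D"
  shows "wf_bicomplex V (tensor C D)"
proof -
  note fin = finite_gens[OF C] finite_gens[OF D]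
  have "matrix_mult (tensor C D) (hdiff (tensor C D)) (hdiff (tensor C D)) z z' = 0 \<and>
      matrix_mult (tensor C D) (vdiff (tensor C D)) (vdiff (tensor C D)) z z' = 0 \<and>
      matrix_mult (tensor C D) (hdiff (tensor C D)) (vdiff (tensor C D)) z z' =
      matrix_mult (tensor C D) (vdiff (tensor C D)) (hdiff (tensor C D)) z z'"
    if zz: "z \<in> gens (tensor C D)" "z' \<in> gens (tensor C D)" for z z'
  proof -
    obtain x ys x' ys' where z: "z = x # ys" "x \<in> gens C" "ys \<in> gens D"
      "z' = x' # ys'" "x' \<in> gens C" "ys' \<in> gens D"
      using zz by (auto elim!: gens_tensorE)
    \<comment> \<open>A nonzero entry changes the parity of its own grading and fixes the other one.
      So the mixed terms cancel in the square of a differential, and they coincide in the two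
      composites of the horizontal with the vertical differential.\<close>
    have h: "hdiff C x x' = 0 \<or> (cdeg C x' = cdeg C x \<and> hdeg C x' = hdeg C x + 1)"
      and v: "vdiff C x x' = 0 \<or> (cdeg C x' = cdeg C x + 1 \<and> hdeg C x' = hdeg C x)"
      using hom_hdiff[OF C] hom_vdiff[OF C] z by (auto simp: homogeneous_matrix_def)
    have "matrix_mult C (hdiff C) (hdiff C) x x' = 0" "matrix_mult C (vdiff C) (vdiff C) x x' = 0"
      "matrix_mult C (hdiff C) (vdiff C) x x' = matrix_mult C (vdiff C) (hdiff C) x x'"
      "matrix_mult D (hdiff D) (hdiff D) ys ys' = 0" "matrix_mult D (vdiff D) (vdiff D) ys ys' = 0"
      "matrix_mult D (hdiff D) (vdiff D) ys ys' = matrix_mult D (vdiff D) (hdiff D) ys ys'"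
      using C D z by (auto simp: wf_bicomplex_def)
    then show ?thesis
      using h v unfolding z(1,4) tensor_simps
      by (auto simp: matrix_mult_tensor[OF fin z(2,5,3,6)] koszul_sign_Suc ac_simps)
  qed
  moreover have "finite (gens (tensor C D))" using fin by (simp add: gens_tensor)
  ultimately show ?thesis
    using homogeneous_matrix_tensor[OF hom_hdiff[OF C] hom_hdiff[OF D]]
      homogeneous_matrix_tensor[OF hom_vdiff[OF C] hom_vdiff[OF D]]
    by (simp add: wf_bicomplex_def)
qed

section \<open>Edge factors, vertex factors and iterated tensor products\<close>

lemma gens_edge_factor:
  "gens (edge_factor i j) = {Inl LeftTerm, Inl RightTerm, Inr LeftTerm, Inr RightTerm}"
  by (auto simp: edge_factor_def two_term_def shift_def koszul_def)

lemma gens_vertex_factor: "gens vertex_factor = {Inr LeftTerm, Inr RightTerm}"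
  by (auto simp: vertex_factor_def in_degree_zero_def two_term_def koszul_def)

lemmas factor_defs = edge_factor_def vertex_factor_def in_degree_zero_def two_term_def shift_def koszul_def

lemma keys_var_diff: "m \<in> keys (var i - var j) \<Longrightarrow> mdeg m = 1"
  using keys_minus_subset[of "var i" "var j"] by (auto simp: var_def split: if_splits)

lemma wf_edge_factor: "i \<in> V \<Longrightarrow> j \<in> V \<Longrightarrow> wf_bicomplex V (edge_factor i j)"
  unfolding wf_bicomplex_def homogeneous_matrix_def matrix_mult_def gens_edge_factor
  by (auto simp: factor_defs polys_diff polys_var keys_var_diff)

lemma wf_vertex_factor: "wf_bicomplex V vertex_factor"
  unfolding wf_bicomplex_def homogeneous_matrix_def matrix_mult_def gens_vertex_factor
  by (auto simp: factor_defs)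

lemma wf_tensor_unit: "wf_bicomplex V tensor_unit"
  by (auto simp: wf_bicomplex_def homogeneous_matrix_def matrix_mult_def tensor_unit_def)

lemma tensor_list_simps [simp]:
  "tensor_list [] = tensor_unit" "tensor_list (C # Cs) = tensor C (tensor_list Cs)"
  by (simp_all add: tensor_list_def)

lemma wf_tensor_list: "(\<And>C. C \<in> set Cs \<Longrightarrow> wf_bicomplex V C) \<Longrightarrow> wf_bicomplex V (tensor_list Cs)"
  by (induction Cs) (auto intro: wf_tensor_unit wf_tensor)


section \<open>Isomorphisms of bicomplexes\<close>

text \<open>A base change by a bijection of generators and a diagonal matrix of signs, after
  renaming the variables. A sign is its own inverse, so conjugation multiplies the entry at x, y by
  \<open>\<epsilon> x * \<epsilon> y\<close>.\<close>

definition is_bicomplex_iso ::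
  "(nat \<Rightarrow> nat) \<Rightarrow> 'b bicomplex \<Rightarrow> 'c bicomplex \<Rightarrow> ('b \<Rightarrow> 'c) \<Rightarrow> ('b \<Rightarrow> qpoly) \<Rightarrow> bool" where
  "is_bicomplex_iso \<rho> C C' \<sigma> \<epsilon> \<longleftrightarrow>
     bij_betw \<sigma> (gens C) (gens C') \<and>
     (\<forall>x\<in>gens C. (\<epsilon> x = 1 \<or> \<epsilon> x = -1) \<and> hdeg C' (\<sigma> x) = hdeg C x \<and> cdeg C' (\<sigma> x) = cdeg C x \<and>
        bideg C' (\<sigma> x) = bideg C x) \<and>
     (\<forall>x\<in>gens C. \<forall>y\<in>gens C.
        hdiff C' (\<sigma> x) (\<sigma> y) = \<epsilon> x * \<epsilon> y * rename_vars \<rho> (hdiff C x y) \<and>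
        vdiff C' (\<sigma> x) (\<sigma> y) = \<epsilon> x * \<epsilon> y * rename_vars \<rho> (vdiff C x y))"

definition bicomplex_iso :: "(nat \<Rightarrow> nat) \<Rightarrow> 'b bicomplex \<Rightarrow> 'c bicomplex \<Rightarrow> bool" where
  "bicomplex_iso \<rho> C C' \<longleftrightarrow> (\<exists>\<sigma> \<epsilon>. is_bicomplex_iso \<rho> C C' \<sigma> \<epsilon>)"

lemma bicomplex_iso_trans:
  assumes "bicomplex_iso \<rho> C D" "bicomplex_iso \<tau> D E"
  shows "bicomplex_iso (\<tau> \<circ> \<rho>) C E"
proof -
  obtain \<sigma> \<epsilon> where 1: "is_bicomplex_iso \<rho> C D \<sigma> \<epsilon>" using assms by (auto simp: bicomplex_iso_def)
  obtain \<sigma>' \<epsilon>' where 2: "is_bicomplex_iso \<tau> D E \<sigma>' \<epsilon>'" using assms by (auto simp: bicomplex_iso_def)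
  have D: "\<sigma> x \<in> gens D" if "x \<in> gens C" for x
    using 1 that by (auto simp: is_bicomplex_iso_def bij_betw_def)
  have "rename_vars \<tau> (\<epsilon> x) = \<epsilon> x" if "x \<in> gens C" for x
    using 1 that by (auto simp: is_bicomplex_iso_def rename_vars_uminus)
  moreover have sign: "\<epsilon> x * \<epsilon>' (\<sigma> x) = 1 \<or> \<epsilon> x * \<epsilon>' (\<sigma> x) = - 1" if "x \<in> gens C" for x
  proof -
    have "\<epsilon> x = 1 \<or> \<epsilon> x = - 1" "\<epsilon>' (\<sigma> x) = 1 \<or> \<epsilon>' (\<sigma> x) = - 1"
      using 1 2 D that by (auto simp: is_bicomplex_iso_def)
    then show ?thesis by auto
  qed
  moreover have "bij_betw (\<sigma>' \<circ> \<sigma>) (gens C) (gens E)"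
    using 1 2 by (auto simp: is_bicomplex_iso_def intro: bij_betw_trans)
  ultimately have "is_bicomplex_iso (\<tau> \<circ> \<rho>) C E (\<sigma>' \<circ> \<sigma>) (\<lambda>x. \<epsilon> x * \<epsilon>' (\<sigma> x))"
    using 1 2 D sign unfolding is_bicomplex_iso_def
    by (simp add: rename_vars_mult rename_vars_comp ac_simps)
  then show ?thesis by (auto simp: bicomplex_iso_def)
qed

lemma bicomplex_iso_refl: "bicomplex_iso id C C"
  unfolding bicomplex_iso_def is_bicomplex_iso_def
  by (intro exI[of _ id] exI[of _ "\<lambda>_. 1"]) (auto simp: rename_vars_ident[of _ UNIV] polys_def)

lemma bicomplex_iso_tensor:
  assumes "bicomplex_iso \<rho> C C'" "bicomplex_iso \<rho> D D'"
  shows "bicomplex_iso \<rho> (tensor C D) (tensor C' D')"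
proof -
  obtain \<sigma> \<epsilon> where 1: "is_bicomplex_iso \<rho> C C' \<sigma> \<epsilon>" using assms by (auto simp: bicomplex_iso_def)
  obtain \<sigma>' \<epsilon>' where 2: "is_bicomplex_iso \<rho> D D' \<sigma>' \<epsilon>'" using assms by (auto simp: bicomplex_iso_def)
  have inj: "inj_on \<sigma> (gens C)" "inj_on \<sigma>' (gens D)" and im: "\<sigma> ` gens C = gens C'" "\<sigma>' ` gens D = gens D'"
    using 1 2 by (auto simp: is_bicomplex_iso_def bij_betw_def)
  let ?\<sigma> = "\<lambda>z. \<sigma> (hd z) # \<sigma>' (tl z)" and ?\<epsilon> = "\<lambda>z. \<epsilon> (hd z) * \<epsilon>' (tl z)"
  have bij: "bij_betw ?\<sigma> (gens (tensor C D)) (gens (tensor C' D'))"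
  proof (rule bij_betw_imageI)
    show "inj_on ?\<sigma> (gens (tensor C D))"
      using inj by (auto simp: inj_on_def gens_tensor)
    show "?\<sigma> ` gens (tensor C D) = gens (tensor C' D')"
      unfolding gens_tensor im[symmetric] by (force simp: image_iff)
  qed
  \<comment> \<open>Covers both differentials, with k the degree of x in the relevant grading. On
    the diagonal of one factor the two signs of that factor cancel, leaving those of the
    other.\<close>
  have combine: "(if \<sigma>' ys = \<sigma>' ys' then A' (\<sigma> x) (\<sigma> x') else 0) +
        (if \<sigma> x = \<sigma> x' then koszul_sign k * B' (\<sigma>' ys) (\<sigma>' ys') else 0) =
      \<epsilon> x * \<epsilon>' ys * (\<epsilon> x' * \<epsilon>' ys') *
        rename_vars \<rho> ((if ys = ys' then A x x' else 0) + (if x = x' then koszul_sign k * B ys ys' else 0))"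
    if "A' (\<sigma> x) (\<sigma> x') = \<epsilon> x * \<epsilon> x' * rename_vars \<rho> (A x x')"
      "B' (\<sigma>' ys) (\<sigma>' ys') = \<epsilon>' ys * \<epsilon>' ys' * rename_vars \<rho> (B ys ys')"
      "x \<in> gens C" "x' \<in> gens C" "ys \<in> gens D" "ys' \<in> gens D" for A A' B B' x x' ys ys' k
  proof -
    have "\<sigma> x = \<sigma> x' \<longleftrightarrow> x = x'" "\<sigma>' ys = \<sigma>' ys' \<longleftrightarrow> ys = ys'"
      using inj that by (auto simp: inj_on_def)
    moreover have "\<epsilon> x = 1 \<or> \<epsilon> x = -1" "\<epsilon> x' = 1 \<or> \<epsilon> x' = -1"
      "\<epsilon>' ys = 1 \<or> \<epsilon>' ys = -1" "\<epsilon>' ys' = 1 \<or> \<epsilon>' ys' = -1"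
      using that 1 2 by (auto simp: is_bicomplex_iso_def)
    ultimately show ?thesis
      using that(1,2) by (cases "x = x'"; cases "ys = ys'") (auto simp: rename_vars_add rename_vars_mult)
  qed
  have "hdiff (tensor C' D') (\<sigma> x # \<sigma>' ys) (\<sigma> x' # \<sigma>' ys') =
      \<epsilon> x * \<epsilon>' ys * (\<epsilon> x' * \<epsilon>' ys') * rename_vars \<rho> (hdiff (tensor C D) (x # ys) (x' # ys'))"
    if "x \<in> gens C" "x' \<in> gens C" "ys \<in> gens D" "ys' \<in> gens D" for x x' ys ys'
  proof -
    have "hdeg C' (\<sigma> x) = hdeg C x" using 1 that by (simp add: is_bicomplex_iso_def)
    then show ?thesis unfolding tensor_simps tensor_matrix_Cons
      by (simp only:) (rule combine, use 1 2 that in \<open>simp_all add: is_bicomplex_iso_def\<close>)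
  qed
  moreover have "vdiff (tensor C' D') (\<sigma> x # \<sigma>' ys) (\<sigma> x' # \<sigma>' ys') =
      \<epsilon> x * \<epsilon>' ys * (\<epsilon> x' * \<epsilon>' ys') * rename_vars \<rho> (vdiff (tensor C D) (x # ys) (x' # ys'))"
    if "x \<in> gens C" "x' \<in> gens C" "ys \<in> gens D" "ys' \<in> gens D" for x x' ys ys'
  proof -
    have "cdeg C' (\<sigma> x) = cdeg C x" using 1 that by (simp add: is_bicomplex_iso_def)
    then show ?thesis unfolding tensor_simps tensor_matrix_Cons
      by (simp only:) (rule combine, use 1 2 that in \<open>simp_all add: is_bicomplex_iso_def\<close>)
  qed
  moreover have "\<epsilon> x * \<epsilon>' ys = 1" if "x \<in> gens C" "ys \<in> gens D" "\<epsilon> x * \<epsilon>' ys \<noteq> -1" for x ys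
  proof -
    have "\<epsilon> x = 1 \<or> \<epsilon> x = - 1" "\<epsilon>' ys = 1 \<or> \<epsilon>' ys = - 1"
      using 1 2 that by (auto simp: is_bicomplex_iso_def)
    then show ?thesis using that(3) by auto
  qed
  moreover have "hdeg C' (\<sigma> x) = hdeg C x \<and> cdeg C' (\<sigma> x) = cdeg C x \<and> bideg C' (\<sigma> x) = bideg C x"
    if "x \<in> gens C" for x using 1 that by (simp add: is_bicomplex_iso_def)
  moreover have "hdeg D' (\<sigma>' ys) = hdeg D ys \<and> cdeg D' (\<sigma>' ys) = cdeg D ys \<and> bideg D' (\<sigma>' ys) = bideg D ys"
    if "ys \<in> gens D" for ys using 2 that by (simp add: is_bicomplex_iso_def)
  ultimately have "is_bicomplex_iso \<rho> (tensor C D) (tensor C' D') ?\<sigma> ?\<epsilon>"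
    using bij unfolding is_bicomplex_iso_def
    by (auto elim!: gens_tensorE simp del: tensor_simps(4,5))
  then show ?thesis by (auto simp: bicomplex_iso_def)
qed

text \<open>A differential of B standing behind x acquires the sign of the degree of x. When it
  raises the degree of y by one, the product of the degrees of x and y grows by exactly the degree
  of x. This holds for each grading separately, and a differential leaves the other grading alone,
  so the exponent of the sign is the sum of the two products.\<close>

lemma bicomplex_iso_swap:
  assumes A: "wf_bicomplex V A" and B: "wf_bicomplex V B"
  shows "bicomplex_iso id (tensor A (tensor B D)) (tensor B (tensor A D))"
proof -
  let ?\<sigma> = "\<lambda>z. hd (tl z) # hd z # tl (tl z)"
  let ?e = "\<lambda>x y. koszul_sign (hdeg A x * hdeg B y + cdeg A x * cdeg B y)"
  let ?\<epsilon> = "\<lambda>z. ?e (hd z) (hd (tl z))"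
  have bij: "bij_betw ?\<sigma> (gens (tensor A (tensor B D))) (gens (tensor B (tensor A D)))"
  proof (rule bij_betw_imageI)
    show "inj_on ?\<sigma> (gens (tensor A (tensor B D)))" by (auto simp: inj_on_def gens_tensor)
    show "?\<sigma> ` gens (tensor A (tensor B D)) = gens (tensor B (tensor A D))"
      unfolding gens_tensor by (force simp: image_iff)
  qed
  have ident: "rename_vars id p = p" for p
    by (rule rename_vars_ident[of _ UNIV]) (auto simp: polys_def)
  have hB: "koszul_sign (hdeg A x) = ?e x y * ?e x y'" if "hdiff B y y' \<noteq> 0" "y \<in> gens B" "y' \<in> gens B" for x y y'
  proof -
    have "hdeg B y' = hdeg B y + 1" "cdeg B y' = cdeg B y"
      using that hom_hdiff[OF B] by (auto simp: homogeneous_matrix_def)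
    then show ?thesis by (simp add: koszul_sign_def algebra_simps)
  qed
  have hA: "koszul_sign (hdeg B y) = ?e x y * ?e x' y" if "hdiff A x x' \<noteq> 0" "x \<in> gens A" "x' \<in> gens A" for x x' y
  proof -
    have "hdeg A x' = hdeg A x + 1" "cdeg A x' = cdeg A x"
      using that hom_hdiff[OF A] by (auto simp: homogeneous_matrix_def)
    then show ?thesis by (simp add: koszul_sign_def algebra_simps)
  qed
  have vB: "koszul_sign (cdeg A x) = ?e x y * ?e x y'" if "vdiff B y y' \<noteq> 0" "y \<in> gens B" "y' \<in> gens B" for x y y'
  proof -
    have "hdeg B y' = hdeg B y" "cdeg B y' = cdeg B y + 1"
      using that hom_vdiff[OF B] by (auto simp: homogeneous_matrix_def)
    then show ?thesis by (simp add: koszul_sign_def algebra_simps)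
  qed
  have vA: "koszul_sign (cdeg B y) = ?e x y * ?e x' y" if "vdiff A x x' \<noteq> 0" "x \<in> gens A" "x' \<in> gens A" for x x' y
  proof -
    have "hdeg A x' = hdeg A x" "cdeg A x' = cdeg A x + 1"
      using that hom_vdiff[OF A] by (auto simp: homogeneous_matrix_def)
    then show ?thesis by (simp add: koszul_sign_def algebra_simps)
  qed
  \<comment> \<open>Here a, b and d are the entries of the differentials of A, B and D. The sign
    conditions are restricted to nonzero a and b because the degrees of two generators are related
    only across a nonzero entry.\<close>
  have combine: "(if x # zs = x' # zs' then b else 0) +
        (if y = y' then koszul_sign k' * ((if zs = zs' then a else 0) + (if x = x' then koszul_sign k * d else 0)) else 0) =
      e * e' * ((if y # zs = y' # zs' then a else 0) +
        (if x = x' then koszul_sign k * ((if zs = zs' then b else 0) + (if y = y' then koszul_sign k' * d else 0)) else 0))"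
    if "e = 1 \<or> e = -1" "e' = 1 \<or> e' = -1" "x = x' \<Longrightarrow> y = y' \<Longrightarrow> e = e'"
      "x = x' \<Longrightarrow> b \<noteq> 0 \<Longrightarrow> koszul_sign k = e * e'" "y = y' \<Longrightarrow> a \<noteq> 0 \<Longrightarrow> koszul_sign k' = e * e'"
    for x x' :: 'a and y y' :: 'a and zs zs' :: "'a list" and a b d e e' :: qpoly and k k'
  proof -
    consider "a = 0" "b = 0" | "a \<noteq> 0" "b = 0" | "a = 0" "b \<noteq> 0" | "a \<noteq> 0" "b \<noteq> 0" by auto
    then show ?thesis
    proof cases
      case 1
      then show ?thesis using that(1-3) by (auto simp: ac_simps)
    next
      case 2
      then show ?thesis using that by (auto simp: algebra_simps)
    next
      case 3
      then show ?thesis using that by (auto simp: algebra_simps)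
    next
      case 4
      then show ?thesis using that by (auto simp: algebra_simps)
    qed
  qed
  have "hdiff (tensor B (tensor A D)) (y # x # zs) (y' # x' # zs') =
      ?e x y * ?e x' y' * hdiff (tensor A (tensor B D)) (x # y # zs) (x' # y' # zs')"
    if "x \<in> gens A" "x' \<in> gens A" "y \<in> gens B" "y' \<in> gens B" for x x' y y' zs zs'
    unfolding tensor_simps tensor_matrix_Cons
    by (rule combine) (use that hB hA koszul_sign_cases in auto)
  moreover have "vdiff (tensor B (tensor A D)) (y # x # zs) (y' # x' # zs') =
      ?e x y * ?e x' y' * vdiff (tensor A (tensor B D)) (x # y # zs) (x' # y' # zs')"
    if "x \<in> gens A" "x' \<in> gens A" "y \<in> gens B" "y' \<in> gens B" for x x' y y' zs zs'
    unfolding tensor_simps tensor_matrix_Cons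
    by (rule combine) (use that vB vA koszul_sign_cases in auto)
  ultimately have "is_bicomplex_iso id (tensor A (tensor B D)) (tensor B (tensor A D)) ?\<sigma> ?\<epsilon>"
    unfolding is_bicomplex_iso_def using bij koszul_sign_cases
    by (auto simp: ident elim!: gens_tensorE simp del: tensor_simps(4,5))
  then show ?thesis by (auto simp: bicomplex_iso_def)
qed

section \<open>Homotopy equivalence of isomorphic complexes\<close>

lemma module_hom_zero:
  assumes "module R M" "module R N" "f \<in> module_hom R M N"
  shows "f \<zero>\<^bsub>M\<^esub> = \<zero>\<^bsub>N\<^esub>"
proof -
  interpret M: module R M by fact
  interpret N: module R N by fact
  have "f \<zero>\<^bsub>M\<^esub> \<in> carrier N" using module_hom_closed[OF assms(3)] by auto
  moreover have "f (\<zero>\<^bsub>R\<^esub> \<odot>\<^bsub>M\<^esub> \<zero>\<^bsub>M\<^esub>) = \<zero>\<^bsub>R\<^esub> \<odot>\<^bsub>N\<^esub> f \<zero>\<^bsub>M\<^esub>"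
    by (rule module_hom_smult[OF assms(3)]) auto
  ultimately show ?thesis by simp
qed

lemma zero_bigraded_hom:
  assumes "bigraded_module n M" "bigraded_module n N"
  shows "(\<lambda>_. \<zero>\<^bsub>N\<^esub>) \<in> bigraded_hom n M N"
proof -
  interpret N: module "poly_ring n" N using assms by (simp add: bigraded_module_def)
  have "additive_subgroup (piece N d) N" for d
    using assms(2) unfolding bigraded_module_def by blast
  then have "\<zero>\<^bsub>N\<^esub> \<in> piece N d" for d
    by (rule additive_subgroup.zero_closed)
  then show ?thesis by (auto simp: bigraded_hom_def module_hom_def)
qed

text \<open>The inverse is again a chain map and both composites are the identity on carriers, so
  the zero homotopy suffices. The condition on pieces makes the inverse respect bidegrees.\<close>

lemma homotopy_equivalent_of_bij:
  assumes C: "bigraded_complex n C" and D: "bigraded_complex n D" and f: "chain_map n C D f"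
    and bij: "\<And>j. bij_betw (f j) (carrier (obj C j)) (carrier (obj D j))"
    and piece: "\<And>j d. piece (obj D j) d \<subseteq> f j ` piece (obj C j) d"
  shows "homotopy_equivalent n C D"
proof -
  define g where "g = (\<lambda>j. inv_into (carrier (obj C j)) (f j))"
  have modC: "module (poly_ring n) (obj C j)" and modD: "module (poly_ring n) (obj D j)" for j
    using C D by (auto simp: bigraded_complex_def bigraded_module_def)
  have gf: "g j (f j x) = x" if "x \<in> carrier (obj C j)" for j x
    using bij_betw_inv_into_left[OF bij that] by (simp add: g_def)
  have fg: "f j (g j y) = y" if "y \<in> carrier (obj D j)" for j y
    using bij_betw_inv_into_right[OF bij that] by (simp add: g_def)
  have g_closed: "g j y \<in> carrier (obj C j)" if "y \<in> carrier (obj D j)" for j y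
  proof -
    have "y \<in> f j ` carrier (obj C j)" using that bij_betw_imp_surj_on[OF bij[of j]] by simp
    then show ?thesis by (simp add: g_def inv_into_into)
  qed
  have fh: "f j \<in> module_hom (poly_ring n) (obj C j) (obj D j)" for j
    using f by (simp add: chain_map_def bigraded_hom_def)
  have g_hom: "g j \<in> bigraded_hom n (obj D j) (obj C j)" for j
    unfolding bigraded_hom_def module_hom_def
  proof (intro CollectI conjI allI impI)
    interpret M: module "poly_ring n" "obj C j" by (rule modC)
    interpret N: module "poly_ring n" "obj D j" by (rule modD)
    show "g j \<in> carrier (obj D j) \<rightarrow> carrier (obj C j)" using g_closed by auto
    fix x y assume "x \<in> carrier (obj D j) \<and> y \<in> carrier (obj D j)"
    then have xy: "x \<in> carrier (obj D j)" "y \<in> carrier (obj D j)" by auto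
    have "f j (g j x \<oplus>\<^bsub>obj C j\<^esub> g j y) = x \<oplus>\<^bsub>obj D j\<^esub> y"
      using module_hom_add[OF fh g_closed[OF xy(1)] g_closed[OF xy(2)]] xy by (simp add: fg)
    then show "g j (x \<oplus>\<^bsub>obj D j\<^esub> y) = g j x \<oplus>\<^bsub>obj C j\<^esub> g j y"
      using gf[of "g j x \<oplus>\<^bsub>obj C j\<^esub> g j y" j] xy g_closed by simp
  next
    interpret M: module "poly_ring n" "obj C j" by (rule modC)
    fix r y assume "r \<in> carrier (poly_ring n) \<and> y \<in> carrier (obj D j)"
    then have ry: "r \<in> carrier (poly_ring n)" "y \<in> carrier (obj D j)" by auto
    have "f j (r \<odot>\<^bsub>obj C j\<^esub> g j y) = r \<odot>\<^bsub>obj D j\<^esub> y"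
      using module_hom_smult[OF fh ry(1) g_closed[OF ry(2)]] ry by (simp add: fg)
    then show "g j (r \<odot>\<^bsub>obj D j\<^esub> y) = r \<odot>\<^bsub>obj C j\<^esub> g j y"
      using gf[of "r \<odot>\<^bsub>obj C j\<^esub> g j y" j] ry g_closed by simp
  next
    fix d
    have "additive_subgroup (piece (obj C j) d) (obj C j)"
      using C unfolding bigraded_complex_def bigraded_module_def by blast
    then have "piece (obj C j) d \<subseteq> carrier (obj C j)"
      by (rule additive_subgroup.a_subset)
    then show "g j ` piece (obj D j) d \<subseteq> piece (obj C j) d"
      using piece[of j d] gf by fastforce
  qed
  have "chain_map n D C g"
    unfolding chain_map_def
  proof (intro allI conjI ballI)
    fix j show "g j \<in> bigraded_hom n (obj D j) (obj C j)" by (rule g_hom)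
    fix y assume y: "y \<in> carrier (obj D j)"
    have "diff C j \<in> module_hom (poly_ring n) (obj C j) (obj C (j + 1))"
      using C by (simp add: bigraded_complex_def bigraded_hom_def)
    then have "diff C j (g j y) \<in> carrier (obj C (j + 1))"
      using module_hom_closed g_closed[OF y] by blast
    moreover have "f (j + 1) (diff C j (g j y)) = diff D j y"
      using f g_closed[OF y] fg[OF y] unfolding chain_map_def by metis
    ultimately show "diff C j (g j y) = g (j + 1) (diff D j y)"
      by (metis gf)
  qed
  moreover have "chain_homotopic n E E (\<lambda>j x. k j x) (\<lambda>j x. x)"
    if E: "bigraded_complex n E" and k: "\<And>j x. x \<in> carrier (obj E j) \<Longrightarrow> k j x = x"
    for E :: "(qpoly, 'x) bigcomplex" and k
    unfolding chain_homotopic_def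
  proof (intro exI[of _ "\<lambda>j _. \<zero>\<^bsub>obj E (j - 1)\<^esub>"] allI conjI ballI)
    fix j
    have mods: "bigraded_module n (obj E j)" for j using E by (simp add: bigraded_complex_def)
    show "(\<lambda>_. \<zero>\<^bsub>obj E (j - 1)\<^esub>) \<in> bigraded_hom n (obj E j) (obj E (j - 1))"
      by (rule zero_bigraded_hom) (rule mods)+
    interpret M: module "poly_ring n" "obj E j" using mods by (simp add: bigraded_module_def)
    have "diff E (j - 1) \<in> module_hom (poly_ring n) (obj E (j - 1)) (obj E (j - 1 + 1))"
      using E unfolding bigraded_complex_def bigraded_hom_def by blast
    then have "diff E (j - 1) \<zero>\<^bsub>obj E (j - 1)\<^esub> = \<zero>\<^bsub>obj E j\<^esub>"
      using module_hom_zero[of "poly_ring n" "obj E (j - 1)" "obj E (j - 1 + 1)"] mods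
      by (simp add: bigraded_module_def)
    moreover fix x assume "x \<in> carrier (obj E j)"
    ultimately show "k j x = x \<oplus>\<^bsub>obj E j\<^esub> (diff E (j - 1) \<zero>\<^bsub>obj E (j - 1)\<^esub> \<oplus>\<^bsub>obj E j\<^esub> \<zero>\<^bsub>obj E (j + 1 - 1)\<^esub>)"
      by (simp add: k)
  qed
  from this[OF C, of "\<lambda>j x. g j (f j x)"] this[OF D, of "\<lambda>j x. f j (g j x)"]
  have "chain_homotopic n C C (\<lambda>j x. g j (f j x)) (\<lambda>j x. x)"
    "chain_homotopic n D D (\<lambda>j x. f j (g j x)) (\<lambda>j x. x)"
    by (simp_all add: gf fg)
  ultimately show ?thesis
    using C D f unfolding homotopy_equivalent_def by blast
qed

lemma bigraded_complex_relabel: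
  fixes C :: "(qpoly, 'b) bigcomplex"
  assumes C: "bigraded_complex n C" and \<rho>: "\<rho> ` {..<n} \<subseteq> {..<n}"
  shows "bigraded_complex n (relabel_complex \<rho> C)"
proof -
  have "bigraded_module n (restrict_scalars (rename_vars \<rho>) (obj C j))" for j
    using C \<rho> rename_vars_in_polys
    by (intro bigraded_module_restrict_scalars)
      (auto simp: bigraded_complex_def rename_vars_add rename_vars_mult homogeneous_rename_vars)
  moreover have "bigraded_hom n M N \<subseteq>
      bigraded_hom n (restrict_scalars (rename_vars \<rho>) M) (restrict_scalars (rename_vars \<rho>) N)"
    for M N :: "(qpoly, 'b) bigmod"
    using rename_vars_in_polys[OF _ \<rho>] by (auto simp: bigraded_hom_def module_hom_def carrier_poly_ring)
  ultimately show ?thesis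
    using C by (simp add: bigraded_complex_def relabel_complex_def subset_iff)
qed

text \<open>The induced map on cochains is semilinear along the renaming: multiplication by r turns
  into multiplication by \<open>rename_vars \<rho> r\<close>. Relabeling the target makes it linear,
  and \<open>\<tau>\<close> provides the inverse.\<close>

lemma bicomplex_iso_imp_homotopy_equivalent:
  fixes C :: "'b bicomplex" and C' :: "'c bicomplex"
  assumes C: "wf_bicomplex {..<n} C" and C': "wf_bicomplex {..<n} C'" and "bicomplex_iso \<rho> C C'"
    and \<rho>: "\<rho> ` {..<n} \<subseteq> {..<n}" and \<tau>: "\<tau> ` {..<n} \<subseteq> {..<n}" and inv: "\<tau> \<circ> \<rho> = id" "\<rho> \<circ> \<tau> = id"
  shows "homotopy_equivalent n (cohomology_complex n C) (relabel_complex \<rho> (cohomology_complex n C'))"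
proof -
  let ?V = "{..<n}" and ?r = "rename_vars \<rho>" and ?r' = "rename_vars \<tau>"
  obtain \<sigma> \<epsilon> where iso: "is_bicomplex_iso \<rho> C C' \<sigma> \<epsilon>"
    using assms by (auto simp: bicomplex_iso_def)
  have bij: "bij_betw \<sigma> (gens C) (gens C')" using iso by (simp add: is_bicomplex_iso_def)
  have \<sigma>: "\<sigma> x \<in> gens C'" if "x \<in> gens C" for x using bij that by (metis bij_betwE)
  have eps: "\<epsilon> x = 1 \<or> \<epsilon> x = -1" if "x \<in> gens C" for x using iso that by (simp add: is_bicomplex_iso_def)
  have ident: "rename_vars id p = p" for p by (rule rename_vars_ident[of _ UNIV]) (auto simp: polys_def)
  have rr': "?r (?r' p) = p" "?r' (?r p) = p" for p by (simp_all add: rename_vars_comp inv ident)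
  \<comment> \<open>The value 0 outside the generators makes T and T' map cochains to cochains.
    Signs are their own inverses and are fixed by renaming, so T' inverts T with the same
    \<open>\<epsilon>\<close>.\<close>
  define T where "T = (\<lambda>c y. if y \<in> gens C' then \<epsilon> (inv_into (gens C) \<sigma> y) * ?r (c (inv_into (gens C) \<sigma> y)) else 0)"
  define T' where "T' = (\<lambda>c x. if x \<in> gens C then \<epsilon> x * ?r' (c (\<sigma> x)) else 0)"
  have T: "T c (\<sigma> x) = \<epsilon> x * ?r (c x)" if "x \<in> gens C" for c x
    using that \<sigma> bij by (simp add: T_def bij_betw_inv_into_left)
  have T_eqI: "T c = c'" if "\<And>x. x \<in> gens C \<Longrightarrow> \<epsilon> x * ?r (c x) = c' (\<sigma> x)" "\<And>y. y \<notin> gens C' \<Longrightarrow> c' y = 0" for c c'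
  proof
    fix y show "T c y = c' y"
    proof (cases "y \<in> gens C'")
      case True
      then obtain x where "x \<in> gens C" "y = \<sigma> x" using bij by (metis bij_betw_imp_surj_on imageE)
      then show ?thesis by (simp add: T that)
    qed (simp add: T_def that)
  qed
  have T_add: "T (c + c') = T c + T c'" and T_diff: "T (c - c') = T c - T c'"
    and T_scale: "T (scale r c) = scale (?r r) (T c)" for c c' r
    by (auto simp: T_def fun_eq_iff fun_apply scale_def rename_vars_add rename_vars_diff rename_vars_mult algebra_simps)
  have T_matrix: "apply_matrix C' A' (T c) = T (apply_matrix C A c)"
    if "\<And>x y. x \<in> gens C \<Longrightarrow> y \<in> gens C \<Longrightarrow> A' (\<sigma> x) (\<sigma> y) = \<epsilon> x * \<epsilon> y * ?r (A x y)" for A A' c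
  proof (rule T_eqI[symmetric])
    fix y assume y: "y \<in> gens C"
    have "apply_matrix C' A' (T c) (\<sigma> y) = (\<Sum>x\<in>gens C. T c (\<sigma> x) * A' (\<sigma> x) (\<sigma> y))"
      using sum.reindex_bij_betw[OF bij, of "\<lambda>z. T c z * A' z (\<sigma> y)"] y \<sigma> by (simp add: apply_matrix_def)
    also have "\<dots> = (\<Sum>x\<in>gens C. \<epsilon> y * (?r (c x) * ?r (A x y)))"
    proof (rule sum.cong[OF refl])
      fix x assume x: "x \<in> gens C"
      show "T c (\<sigma> x) * A' (\<sigma> x) (\<sigma> y) = \<epsilon> y * (?r (c x) * ?r (A x y))"
        using eps[OF x] x y by (auto simp: T that)
    qed
    finally show "\<epsilon> y * ?r (apply_matrix C A c y) = apply_matrix C' A' (T c) (\<sigma> y)"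
      using y by (simp add: apply_matrix_def rename_vars_sum rename_vars_mult sum_distrib_left)
  qed (simp add: apply_matrix_def)
  have T_h: "apply_matrix C' (hdiff C') (T c) = T (apply_matrix C (hdiff C) c)"
    and T_v: "apply_matrix C' (vdiff C') (T c) = T (apply_matrix C (vdiff C) c)" for c
    by (rule T_matrix, use iso in \<open>simp add: is_bicomplex_iso_def\<close>)+
  have T_cochains: "T c \<in> cochains ?V C' j" if c: "c \<in> cochains ?V C j" for c j
  proof -
    have "T c y \<in> polys ?V \<and> (T c y \<noteq> 0 \<longrightarrow> y \<in> gens C' \<and> cdeg C' y = j)" for y
    proof (cases "y \<in> gens C'")
      case True
      then obtain x where x: "x \<in> gens C" "y = \<sigma> x" using bij by (metis bij_betw_imp_surj_on imageE)
      moreover have "?r (c x) \<in> polys ?V" using c rename_vars_in_polys[OF _ \<rho>] by (simp add: cochains_def)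
      moreover have "cdeg C' (\<sigma> x) = cdeg C x" using iso x by (simp add: is_bicomplex_iso_def)
      moreover have "c x \<noteq> 0 \<longrightarrow> cdeg C x = j" using c by (simp add: cochains_def)
      ultimately show ?thesis using eps[OF x(1)] True by (auto simp: T)
    qed (simp add: T_def)
    then show ?thesis by (simp add: cochains_def)
  qed
  have T'_cochains: "T' c \<in> cochains ?V C j" if c: "c \<in> cochains ?V C' j" for c j
  proof -
    have "T' c x \<in> polys ?V \<and> (T' c x \<noteq> 0 \<longrightarrow> x \<in> gens C \<and> cdeg C x = j)" for x
    proof (cases "x \<in> gens C")
      case True
      moreover have "?r' (c (\<sigma> x)) \<in> polys ?V" using c rename_vars_in_polys[OF _ \<tau>] by (simp add: cochains_def)
      moreover have "cdeg C' (\<sigma> x) = cdeg C x" using iso True by (simp add: is_bicomplex_iso_def)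
      moreover have "c (\<sigma> x) \<noteq> 0 \<longrightarrow> cdeg C' (\<sigma> x) = j" using c by (simp add: cochains_def)
      ultimately show ?thesis using eps[OF True] by (auto simp: T'_def)
    qed (simp add: T'_def)
    then show ?thesis by (simp add: cochains_def)
  qed
  have TT': "T (T' c) = c" if "c \<in> cochains ?V C' j" for c j
  proof (rule T_eqI)
    fix x assume x: "x \<in> gens C"
    have "?r (\<epsilon> x) = \<epsilon> x" using eps[OF x] by (auto simp: rename_vars_uminus)
    then show "\<epsilon> x * ?r (T' c x) = c (\<sigma> x)"
      using eps[OF x] x by (auto simp: T'_def rename_vars_mult rr')
  qed (use that in \<open>auto simp: cochains_def\<close>)
  have T'T: "T' (T c) = c" if "c \<in> cochains ?V C j" for c j
  proof
    fix x
    have "x \<notin> gens C \<Longrightarrow> c x = 0" using that by (auto simp: cochains_def)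
    moreover have "T' (T c) x = c x" if x: "x \<in> gens C"
      using eps[OF x] x by (auto simp: T'_def T rename_vars_mult rename_vars_uminus rr')
    ultimately show "T' (T c) x = c x" by (cases "x \<in> gens C") (auto simp: T'_def)
  qed
  have T_degree: "T c \<in> degree_part C' d" if c: "c \<in> degree_part C d" for c d
  proof -
    have "bideg C' y + (0, int (mdeg m)) = d" if m: "m \<in> keys (T c y)" for y m
    proof -
      have "y \<in> gens C'" using m by (auto simp: T_def split: if_splits)
      then obtain x where x: "x \<in> gens C" "y = \<sigma> x" using bij by (metis bij_betw_imp_surj_on imageE)
      have "m \<in> keys (?r (c x))" using m eps[OF x(1)] x by (auto simp: T keys_uminus)
      then obtain m' where "m' \<in> keys (c x)" "m = rename_monom \<rho> m'" using keys_rename_vars by blast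
      moreover have "bideg C' (\<sigma> x) = bideg C x" using iso x by (simp add: is_bicomplex_iso_def)
      ultimately show ?thesis using c x by (simp add: degree_part_def)
    qed
    then show ?thesis by (simp add: degree_part_def)
  qed
  have T'_degree: "T' c \<in> degree_part C d" if c: "c \<in> degree_part C' d" for c d
  proof -
    have "bideg C x + (0, int (mdeg m)) = d" if m: "m \<in> keys (T' c x)" for x and m
    proof -
      have x: "x \<in> gens C" using m by (auto simp: T'_def split: if_splits)
      have "m \<in> keys (?r' (c (\<sigma> x)))" using m eps[OF x] x by (auto simp: T'_def keys_uminus)
      then obtain m' where "m' \<in> keys (c (\<sigma> x))" "m = rename_monom \<tau> m'" using keys_rename_vars by blast
      moreover from this have "bideg C' (\<sigma> x) + (0, int (mdeg m')) = d"
        using c by (simp add: degree_part_def)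
      moreover have "bideg C' (\<sigma> x) = bideg C x" using iso x by (simp add: is_bicomplex_iso_def)
      ultimately show ?thesis by simp
    qed
    then show ?thesis by (simp add: degree_part_def)
  qed
  let ?Z = "hcocycles ?V C" and ?B = "hcoboundaries ?V C" and ?Z' = "hcocycles ?V C'" and ?B' = "hcoboundaries ?V C'"
  have T_0: "T 0 = 0" by (auto simp: T_def fun_eq_iff fun_apply)
  have T_Z: "T z \<in> ?Z' j" if "z \<in> ?Z j" for z j
    using that by (auto simp: hcocycles_def T_cochains T_h T_0)
  have T'_Z: "T' z \<in> ?Z j \<and> T (T' z) = z" if "z \<in> ?Z' j" for z j
  proof -
    have z: "z \<in> cochains ?V C' j" "apply_matrix C' (hdiff C') z = 0" using that by (auto simp: hcocycles_def)
    have "T (apply_matrix C (hdiff C) (T' z)) = 0" using T_h[of "T' z"] by (simp add: TT'[OF z(1)] z(2))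
    moreover have "apply_matrix C (hdiff C) (T' z) \<in> cochains ?V C j"
      by (rule hdiff_cochains[OF C T'_cochains[OF z(1)]])
    moreover have "T' 0 = 0" by (auto simp: T'_def fun_eq_iff fun_apply)
    ultimately have "apply_matrix C (hdiff C) (T' z) = 0" using T'T by metis
    then show ?thesis using T'_cochains[OF z(1)] TT'[OF z(1)] by (simp add: hcocycles_def)
  qed
  have T_B: "T b \<in> ?B' j" if "b \<in> ?B j" for b j
    using that T_cochains by (auto simp: hcoboundaries_def T_h[symmetric])
  \<comment> \<open>T also reflects coboundaries, which gives injectivity on cohomology.\<close>
  have T_B_iff: "b \<in> ?B j" if b: "T b \<in> ?B' j" "b \<in> cochains ?V C j" for b j
  proof -
    obtain c where c: "c \<in> cochains ?V C' j" "T b = apply_matrix C' (hdiff C') c"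
      using b by (auto simp: hcoboundaries_def)
    then have "T b = T (apply_matrix C (hdiff C) (T' c))" by (metis T_h TT')
    then have "b = apply_matrix C (hdiff C) (T' c)"
      using T'T[OF b(2)] T'T[OF hdiff_cochains[OF C T'_cochains[OF c(1)]]] by metis
    then show ?thesis using T'_cochains[OF c(1)] by (simp add: hcoboundaries_def)
  qed
  have subq: "graded_subquotient n (?Z j) (?B j) (degree_part C) (component C)"
    and subq': "graded_subquotient n (?Z' j) (?B' j) (degree_part C') (component C')" for j
    by (rule graded_subquotient_cohomology[OF C] graded_subquotient_cohomology[OF C'])+
  let ?D = "cohomology_complex n C" and ?D' = "cohomology_complex n C'"
  note B = hcoboundaries_subgroup[OF C] and B' = hcoboundaries_subgroup[OF C']
  define f where "f = (\<lambda>j X. \<Union>x\<in>X. coset (?B' j) (T x))"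
  have f: "f j (coset (?B j) z) = coset (?B' j) (T z)" for j z
    unfolding f_def by (rule UN_coset[OF B B']) (simp add: T_add T_B)
  have diff: "diff ?D j (coset (?B j) x) = coset (?B (j + 1)) (apply_matrix C (vdiff C) x)"
    and diff': "diff ?D' j (coset (?B' j) y) = coset (?B' (j + 1)) (apply_matrix C' (vdiff C') y)" for j x y
    unfolding diff_cohomology_complex
    by (rule UN_coset[OF B B], simp add: apply_matrix_add vdiff_hcoboundaries[OF C])
      (rule UN_coset[OF B' B'], simp add: apply_matrix_add vdiff_hcoboundaries[OF C'])
  note carrier = graded_subquotient.carrier_Q[OF subq] graded_subquotient.carrier_Q[OF subq']
    and pieces = graded_subquotient.piece_Q[OF subq] graded_subquotient.piece_Q[OF subq']
  have relabel: "obj (relabel_complex \<rho> ?D') j = restrict_scalars ?r (obj ?D' j)"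
    "diff (relabel_complex \<rho> ?D') = diff ?D'" for j
    by (simp_all add: relabel_complex_def)
  show ?thesis
  proof (rule homotopy_equivalent_of_bij)
    show "bigraded_complex n ?D" by (rule bigraded_complex_cohomology_complex[OF C])
    show "bigraded_complex n (relabel_complex \<rho> ?D')"
      by (rule bigraded_complex_relabel[OF bigraded_complex_cohomology_complex[OF C'] \<rho>])
    show "chain_map n ?D (relabel_complex \<rho> ?D') f"
      unfolding chain_map_def bigraded_hom_def module_hom_def relabel obj_cohomology_complex restrict_scalars_simps
      using T_Z T_degree rename_vars_in_polys[OF _ \<rho>]
      by (auto simp: carrier pieces f diff diff' T_v carrier_poly_ring T_add T_scale
        graded_subquotient.add_coset[OF subq] graded_subquotient.smult_coset[OF subq]
        graded_subquotient.add_coset[OF subq'] graded_subquotient.smult_coset[OF subq'])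
    show "bij_betw (f j) (carrier (obj ?D j)) (carrier (obj (relabel_complex \<rho> ?D') j))" for j
      unfolding relabel obj_cohomology_complex restrict_scalars_simps carrier
    proof (rule bij_betw_imageI)
      show "inj_on (f j) (coset (?B j) ` ?Z j)"
        using T_B_iff[of _ j] add_subgroupD(2)[OF cochains_subgroup[of ?V C j]]
        by (auto simp: inj_on_def f coset_eq_iff B B' T_diff[symmetric] hcocycles_def)
      show "f j ` coset (?B j) ` ?Z j = coset (?B' j) ` ?Z' j"
        using T_Z[of _ j] T'_Z[of _ j] by (force simp: image_image f)
    qed
    show "piece (obj (relabel_complex \<rho> ?D') j) d \<subseteq> f j ` piece (obj ?D j) d" for j d
      unfolding relabel obj_cohomology_complex restrict_scalars_simps pieces
      using T'_Z[of _ j] T'_degree[of _ d] by (force simp: image_image f)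
  qed
qed


section \<open>Independence of the presentation\<close>

lemma bicomplex_iso_trans_id:
  "bicomplex_iso id C D \<Longrightarrow> bicomplex_iso id D E \<Longrightarrow> bicomplex_iso id C E"
  using bicomplex_iso_trans[of id C D id E] by simp

text \<open>Adjacent swaps suffice: \<open>bicomplex_iso_swap\<close> exchanges the two leading
  factors, and tensoring with the head of Cs propagates the isomorphism of the rest.\<close>

lemma bicomplex_iso_move:
  assumes "wf_bicomplex V A" "\<And>C. C \<in> set Cs \<Longrightarrow> wf_bicomplex V C"
  shows "bicomplex_iso id (tensor A (tensor_list (Cs @ Ds))) (tensor_list (Cs @ A # Ds))"
  using assms(2)
proof (induction Cs)
  case Nil
  show ?case by (simp add: bicomplex_iso_refl del: id_apply)
next
  case (Cons C Cs)
  have "bicomplex_iso id (tensor A (tensor C (tensor_list (Cs @ Ds)))) (tensor C (tensor A (tensor_list (Cs @ Ds))))"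
    by (rule bicomplex_iso_swap) (use Cons assms in auto)
  moreover have "bicomplex_iso id (tensor C (tensor A (tensor_list (Cs @ Ds)))) (tensor C (tensor_list (Cs @ A # Ds)))"
    using Cons by (intro bicomplex_iso_tensor bicomplex_iso_refl Cons.IH) simp
  ultimately have "bicomplex_iso id (tensor A (tensor C (tensor_list (Cs @ Ds)))) (tensor C (tensor_list (Cs @ A # Ds)))"
    by (rule bicomplex_iso_trans_id)
  then show ?case by (simp del: id_apply)
qed

text \<open>The head of es is moved to its place in es', after the induction hypothesis has arranged
  the other factors. Ds stands for the vertex factors, which stay at the end.\<close>

lemma bicomplex_iso_permute:
  assumes "\<And>e. e \<in> set es \<Longrightarrow> wf_bicomplex V (F e)" "distinct es" "distinct es'" "set es = set es'"
  shows "bicomplex_iso id (tensor_list (map F es @ Ds)) (tensor_list (map F es' @ Ds))"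
  using assms
proof (induction es arbitrary: es')
  case Nil
  then show ?case by (simp add: bicomplex_iso_refl del: id_apply)
next
  case (Cons e es)
  then have "e \<in> set es'" by auto
  then obtain xs ys where es': "es' = xs @ e # ys" by (meson split_list)
  have "bicomplex_iso id (tensor_list (map F es @ Ds)) (tensor_list (map F (xs @ ys) @ Ds))"
  proof (rule Cons.IH)
    have "set es = set es' - {e}" using Cons.prems by auto
    then show "set es = set (xs @ ys)" using Cons.prems es' by auto
  qed (use Cons.prems es' in auto)
  then have "bicomplex_iso id (tensor (F e) (tensor_list (map F es @ Ds))) (tensor (F e) (tensor_list (map F xs @ map F ys @ Ds)))"
    by (intro bicomplex_iso_tensor bicomplex_iso_refl) auto
  moreover have "bicomplex_iso id (tensor (F e) (tensor_list (map F xs @ map F ys @ Ds))) (tensor_list (map F xs @ F e # map F ys @ Ds))"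
    using Cons.prems es' by (intro bicomplex_iso_move[of V]) auto
  ultimately have "bicomplex_iso id (tensor (F e) (tensor_list (map F es @ Ds))) (tensor_list (map F xs @ F e # map F ys @ Ds))"
    by (rule bicomplex_iso_trans_id)
  then show ?case by (simp add: es' del: id_apply)
qed

lemma bicomplex_iso_tensor_list:
  "list_all2 (bicomplex_iso \<rho>) Cs Cs' \<Longrightarrow> bicomplex_iso \<rho> (tensor_list Cs) (tensor_list Cs')"
proof (induction rule: list_all2_induct)
  case Nil
  have "is_bicomplex_iso \<rho> tensor_unit tensor_unit (\<lambda>_. []) (\<lambda>_. 1)"
    by (simp add: is_bicomplex_iso_def tensor_unit_def bij_betw_def)
  then show ?case by (auto simp: bicomplex_iso_def)
qed (auto intro: bicomplex_iso_tensor)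

lemma bicomplex_iso_edge_factor: "bicomplex_iso \<rho> (edge_factor i j) (edge_factor (\<rho> i) (\<rho> j))"
proof -
  have "is_bicomplex_iso \<rho> (edge_factor i j) (edge_factor (\<rho> i) (\<rho> j)) id (\<lambda>_. 1)"
    unfolding is_bicomplex_iso_def gens_edge_factor by (auto simp: factor_defs rename_vars_diff)
  then show ?thesis by (auto simp: bicomplex_iso_def)
qed

text \<open>Both nonzero entries, the horizontal and the vertical one, start at the left generator
  in cohomological degree -1. Negating this one generator therefore replaces x_i - x_j by x_j - x_i
  in both.\<close>

lemma bicomplex_iso_edge_factor_flip: "bicomplex_iso \<rho> (edge_factor i j) (edge_factor (\<rho> j) (\<rho> i))"
proof -
  have "is_bicomplex_iso \<rho> (edge_factor i j) (edge_factor (\<rho> j) (\<rho> i)) id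
      (\<lambda>x. if x = Inl LeftTerm then -1 else 1)"
    unfolding is_bicomplex_iso_def gens_edge_factor by (auto simp: factor_defs rename_vars_diff)
  then show ?thesis by (auto simp: bicomplex_iso_def)
qed

lemma bicomplex_iso_vertex_factor: "bicomplex_iso \<rho> vertex_factor vertex_factor"
proof -
  have "is_bicomplex_iso \<rho> vertex_factor vertex_factor id (\<lambda>_. 1)"
    unfolding is_bicomplex_iso_def gens_vertex_factor by (auto simp: factor_defs)
  then show ?thesis by (auto simp: bicomplex_iso_def)
qed

section \<open>Positions of vertices and the relabeling between two orders\<close>

lemma position_nth:
  assumes "distinct vs" "v \<in> set vs"
  shows "position vs v < length vs" "vs ! position vs v = v"
proof -
  have "\<exists>!i. i < length vs \<and> vs ! i = v"
    using assms by (metis distinct_Ex1)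
  from theI'[OF this] show "position vs v < length vs" "vs ! position vs v = v"
    by (simp_all add: position_def)
qed

lemma position_of_nth: "distinct vs \<Longrightarrow> i < length vs \<Longrightarrow> position vs (vs ! i) = i"
  using position_nth[of vs "vs ! i"] by (simp add: nth_eq_iff_index_eq)

lemma relabeling_position:
  "distinct vs \<Longrightarrow> v \<in> set vs \<Longrightarrow> relabeling vs vs' (position vs v) = position vs' v"
  by (simp add: relabeling_def position_nth)

lemma relabeling_less:
  assumes "distinct vs" "distinct vs'" "set vs = set vs'"
  shows "relabeling vs vs' ` {..<length vs} \<subseteq> {..<length vs}"
proof -
  have "length vs = length vs'" using assms by (metis distinct_card)
  then show ?thesis using assms position_nth(1)[of vs'] nth_mem[of _ vs] by (auto simp: relabeling_def)
qed

lemma relabeling_inverse: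
  assumes "distinct vs" "distinct vs'" "set vs = set vs'"
  shows "relabeling vs' vs \<circ> relabeling vs vs' = id"
proof
  fix i
  have len: "length vs = length vs'"
    using distinct_card[OF assms(1)] distinct_card[OF assms(2)] assms(3) by simp
  show "(relabeling vs' vs \<circ> relabeling vs vs') i = id i"
  proof (cases "i < length vs")
    case True
    then have "vs ! i \<in> set vs'" using assms(3) nth_mem by blast
    then show ?thesis using True assms relabeling_position[of vs' "vs ! i" vs]
      by (simp add: position_of_nth relabeling_def[of vs vs'])
  qed (simp add: relabeling_def len)
qed

lemma wf_edges_and_vertices:
  assumes "is_presentation G vs es ori" "finite_graph G"
  shows "e \<in> edges G \<Longrightarrow> wf_bicomplex {..<length vs} (edge_factor (position vs (fst (ori e))) (position vs (snd (ori e))))"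
    "e \<in> edges G \<Longrightarrow> fst (ori e) \<in> set vs \<and> snd (ori e) \<in> set vs"
proof -
  assume e: "e \<in> edges G"
  have "set_uprod (Upair (fst (ori e)) (snd (ori e))) \<subseteq> verts G"
    using assms e by (auto simp: is_presentation_def finite_graph_def)
  then show *: "fst (ori e) \<in> set vs \<and> snd (ori e) \<in> set vs"
    using assms by (auto simp: is_presentation_def)
  have "distinct vs" using assms by (simp add: is_presentation_def)
  with * show "wf_bicomplex {..<length vs} (edge_factor (position vs (fst (ori e))) (position vs (snd (ori e))))"
    by (intro wf_edge_factor) (auto simp: position_nth)
qed

lemma wf_graph_bicomplex:
  assumes "is_presentation G vs es ori" "finite_graph G"
  shows "wf_bicomplex {..<length vs} (graph_bicomplex vs es ori)"
  unfolding graph_bicomplex_def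
  using wf_edges_and_vertices(1)[OF assms] assms(1)
  by (intro wf_tensor_list) (auto simp: wf_vertex_factor is_presentation_def)

text \<open>Changing the order of the vertices and the orientations acts on each factor separately
  and accounts for the whole renaming. Changing the order of the edges then permutes factors over a
  fixed set of variables.\<close>

lemma graph_complex_presentation_independent:
  assumes G: "finite_graph G" and P: "is_presentation G vs es ori" and P': "is_presentation G vs' es' ori'"
  shows "homotopy_equivalent (card (verts G)) (graph_complex vs es ori)
    (relabel_complex (relabeling vs vs') (graph_complex vs' es' ori'))"
proof -
  let ?\<rho> = "relabeling vs vs'"
  have vs: "distinct vs" "distinct vs'" "set vs = set vs'" "set vs = verts G"
    and es: "distinct es" "distinct es'" "set es = set es'" "set es = edges G"
    using P P' by (auto simp: is_presentation_def)
  have len: "length vs = card (verts G)" "length vs' = card (verts G)"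
    using vs by (metis distinct_card)+
  let ?F = "\<lambda>e. edge_factor (position vs (fst (ori e))) (position vs (snd (ori e)))"
  let ?F' = "\<lambda>e. edge_factor (position vs' (fst (ori' e))) (position vs' (snd (ori' e)))"
  have "bicomplex_iso ?\<rho> (?F e) (?F' e)" if e: "e \<in> edges G" for e
  proof -
    note ends = wf_edges_and_vertices(2)[OF P G e]
    have "Upair (fst (ori e)) (snd (ori e)) = Upair (fst (ori' e)) (snd (ori' e))"
      using P P' e by (simp add: is_presentation_def)
    then consider "fst (ori' e) = fst (ori e)" "snd (ori' e) = snd (ori e)"
      | "fst (ori' e) = snd (ori e)" "snd (ori' e) = fst (ori e)" by auto
    then show ?thesis
    proof cases
      case 1
      then show ?thesis
        using bicomplex_iso_edge_factor[of ?\<rho> "position vs (fst (ori e))" "position vs (snd (ori e))"] ends vs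
        by (simp add: relabeling_position)
    next
      case 2
      then show ?thesis
        using bicomplex_iso_edge_factor_flip[of ?\<rho> "position vs (fst (ori e))" "position vs (snd (ori e))"] ends vs
        by (simp add: relabeling_position)
    qed
  qed
  moreover have "length vs = length vs'" using len by simp
  ultimately have "list_all2 (bicomplex_iso ?\<rho>) (map ?F es @ map (\<lambda>_. vertex_factor) vs)
      (map ?F' es @ map (\<lambda>_. vertex_factor) vs')"
    using es by (auto simp: list_all2_append list_all2_same list_all2_map1 list_all2_map2
        list_all2_conv_all_nth[of _ vs] bicomplex_iso_vertex_factor)
  then have "bicomplex_iso ?\<rho> (graph_bicomplex vs es ori) (graph_bicomplex vs' es ori')"
    unfolding graph_bicomplex_def by (rule bicomplex_iso_tensor_list)
  moreover have "bicomplex_iso id (graph_bicomplex vs' es ori') (graph_bicomplex vs' es' ori')"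
    unfolding graph_bicomplex_def using wf_edges_and_vertices(1)[OF P' G] es
    by (intro bicomplex_iso_permute) auto
  ultimately have "bicomplex_iso (id \<circ> ?\<rho>) (graph_bicomplex vs es ori) (graph_bicomplex vs' es' ori')"
    by (rule bicomplex_iso_trans)
  then have "bicomplex_iso ?\<rho> (graph_bicomplex vs es ori) (graph_bicomplex vs' es' ori')"
    by simp
  then show ?thesis
    using wf_graph_bicomplex[OF P G] wf_graph_bicomplex[OF P' G] len
      relabeling_less[OF vs(1-3)] relabeling_less[OF vs(2,1) vs(3)[symmetric]]
      relabeling_inverse[OF vs(1-3)] relabeling_inverse[OF vs(2,1) vs(3)[symmetric]]
    unfolding graph_complex_def len
    by (intro bicomplex_iso_imp_homotopy_equivalent[where \<tau> = "relabeling vs' vs"]) auto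
qed

section \<open>Dimensions of graded pieces\<close>

text \<open>\<open>quot_dim Z B N\<close> says that \<open>Z / (Z \<inter> B)\<close> is isomorphic to \<open>\<rat>\<^sup>N\<close>. Additive maps between rational
  vector spaces are linear, so scalars need not be mentioned.\<close>

definition quot_dim :: "'a::ab_group_add set \<Rightarrow> 'a set \<Rightarrow> nat \<Rightarrow> bool" where
  "quot_dim Z B N \<longleftrightarrow> (\<exists>\<phi> :: 'a \<Rightarrow> nat \<Rightarrow> rat. (\<forall>x\<in>Z. \<forall>y\<in>Z. \<phi> (x + y) = \<phi> x + \<phi> y) \<and>
     (\<forall>x\<in>Z. \<phi> x = 0 \<longleftrightarrow> x \<in> B) \<and> \<phi> ` Z = {f. \<forall>i\<ge>N. f i = 0})"

text \<open>An additive surjection under which B' pulls back to B induces an isomorphism of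
  quotients. It may have a kernel; for an edge factor it forgets part of a cocycle.\<close>

lemma quot_dim_iso:
  assumes "quot_dim Z' B' N" and g: "\<And>x y. x \<in> Z \<Longrightarrow> y \<in> Z \<Longrightarrow> g (x + y) = g x + g y"
    "g ` Z = Z'" "\<And>x. x \<in> Z \<Longrightarrow> g x \<in> B' \<longleftrightarrow> x \<in> B"
  shows "quot_dim Z B N"
proof -
  obtain \<phi> where \<phi>: "\<And>x y. x \<in> Z' \<Longrightarrow> y \<in> Z' \<Longrightarrow> \<phi> (x + y) = \<phi> x + \<phi> y"
    "\<And>x. x \<in> Z' \<Longrightarrow> \<phi> x = 0 \<longleftrightarrow> x \<in> B'" "\<phi> ` Z' = {f::nat \<Rightarrow> rat. \<forall>i\<ge>N. f i = 0}"
    using assms(1) unfolding quot_dim_def by blast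
  have "g x \<in> Z'" if "x \<in> Z" for x using that g(2) by blast
  then have "(\<forall>x\<in>Z. \<forall>y\<in>Z. (\<phi> \<circ> g) (x + y) = (\<phi> \<circ> g) x + (\<phi> \<circ> g) y) \<and>
      (\<forall>x\<in>Z. (\<phi> \<circ> g) x = 0 \<longleftrightarrow> x \<in> B) \<and> (\<phi> \<circ> g) ` Z = {f. \<forall>i\<ge>N. f i = 0}"
    using \<phi> g by (auto simp: image_comp[symmetric])
  then show ?thesis unfolding quot_dim_def by blast
qed

lemma quot_dim_Times:
  assumes "quot_dim Z B N" "quot_dim Z' B' N'"
  shows "quot_dim (Z \<times> Z') (B \<times> B') (N + N')"
proof -
  obtain \<phi> where \<phi>: "\<And>x y. x \<in> Z \<Longrightarrow> y \<in> Z \<Longrightarrow> \<phi> (x + y) = \<phi> x + \<phi> y"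
    "\<And>x. x \<in> Z \<Longrightarrow> \<phi> x = 0 \<longleftrightarrow> x \<in> B" "\<phi> ` Z = {f::nat \<Rightarrow> rat. \<forall>i\<ge>N. f i = 0}"
    using assms(1) unfolding quot_dim_def by blast
  obtain \<phi>' where \<phi>': "\<And>x y. x \<in> Z' \<Longrightarrow> y \<in> Z' \<Longrightarrow> \<phi>' (x + y) = \<phi>' x + \<phi>' y"
    "\<And>x. x \<in> Z' \<Longrightarrow> \<phi>' x = 0 \<longleftrightarrow> x \<in> B'" "\<phi>' ` Z' = {f::nat \<Rightarrow> rat. \<forall>i\<ge>N'. f i = 0}"
    using assms(2) unfolding quot_dim_def by blast
  \<comment> \<open>Coordinates are concatenated: N of them from the first factor, the following
    ones from the second.\<close>
  define \<psi> where "\<psi> = (\<lambda>(x, y) i. if i < N then \<phi> x i else \<phi>' y (i - N))"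
  have "\<psi> (x + y) = \<psi> x + \<psi> y" if "x \<in> Z \<times> Z'" "y \<in> Z \<times> Z'" for x y
    using that \<phi>(1) \<phi>'(1) by (auto simp: \<psi>_def fun_eq_iff fun_apply)
  moreover have "\<psi> x = 0 \<longleftrightarrow> x \<in> B \<times> B'" if "x \<in> Z \<times> Z'" for x
  proof -
    obtain a b where x: "x = (a, b)" "a \<in> Z" "b \<in> Z'" using \<open>x \<in> Z \<times> Z'\<close> by auto
    have "\<forall>i\<ge>N. \<phi> a i = 0" using \<phi>(3) x by blast
    moreover have "(\<forall>i. (if i < N then \<phi> a i else \<phi>' b (i - N)) = 0) \<longleftrightarrow>
        (\<forall>i<N. \<phi> a i = 0) \<and> (\<forall>i. \<phi>' b i = 0)"
      by (metis add_diff_cancel_left' not_add_less1)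
    ultimately have "\<psi> x = 0 \<longleftrightarrow> \<phi> a = 0 \<and> \<phi>' b = 0"
      by (simp add: \<psi>_def x fun_eq_iff fun_apply) (metis leI)
    then show ?thesis using \<phi>(2) \<phi>'(2) x by auto
  qed
  moreover have "\<psi> ` (Z \<times> Z') = {f. \<forall>i\<ge>N + N'. f i = 0}"
  proof (intro equalityI subsetI)
    fix f assume "f \<in> \<psi> ` (Z \<times> Z')"
    then obtain a b where "a \<in> Z" "b \<in> Z'" "f = \<psi> (a, b)" by auto
    moreover from this have "\<forall>i\<ge>N'. \<phi>' b i = 0" using \<phi>'(3) by blast
    ultimately show "f \<in> {f. \<forall>i\<ge>N + N'. f i = 0}" by (auto simp: \<psi>_def)
  next
    fix f :: "nat \<Rightarrow> rat" assume f: "f \<in> {f. \<forall>i\<ge>N + N'. f i = 0}"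
    have "(\<lambda>i. if i < N then f i else 0) \<in> \<phi> ` Z" "(\<lambda>i. f (i + N)) \<in> \<phi>' ` Z'"
      using f by (auto simp: \<phi>(3) \<phi>'(3))
    then obtain a b where ab: "a \<in> Z" "b \<in> Z'" "(\<lambda>i. if i < N then f i else 0) = \<phi> a" "(\<lambda>i. f (i + N)) = \<phi>' b"
      unfolding image_iff by blast
    then have "f = \<psi> (a, b)" by (auto simp: \<psi>_def fun_eq_iff simp flip: ab(3,4))
    then show "f \<in> \<psi> ` (Z \<times> Z')" using ab by blast
  qed
  ultimately show ?thesis unfolding quot_dim_def by blast
qed

lemma quot_dim_zero: "0 \<in> B \<Longrightarrow> quot_dim {0} B 0"
  unfolding quot_dim_def
  by (intro exI[of _ "\<lambda>_. 0"]) (auto simp: fun_eq_iff fun_apply)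

text \<open>A finite direct sum is encoded by functions vanishing outside S. The induction splits
  off one summand through the pair \<open>(U s, U(s := 0))\<close>.\<close>

lemma quot_dim_family:
  assumes "finite S" "\<And>s. s \<in> S \<Longrightarrow> quot_dim (Z s) (B s) (N s)"
  shows "quot_dim {U. (\<forall>s\<in>S. U s \<in> Z s) \<and> (\<forall>s. s \<notin> S \<longrightarrow> U s = 0)} {U. \<forall>s\<in>S. U s \<in> B s} (\<Sum>s\<in>S. N s)"
  using assms
proof (induction S rule: finite_induct)
  case empty
  have "{U :: 'a \<Rightarrow> 'b. \<forall>s. U s = 0} = {0}" by (auto simp: fun_eq_iff fun_apply)
  then show ?case by (simp add: quot_dim_zero)
next
  case (insert s S)
  let ?F = "\<lambda>S. {U. (\<forall>s\<in>S. U s \<in> Z s) \<and> (\<forall>s. s \<notin> S \<longrightarrow> U s = 0)}"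
  have "quot_dim (Z s \<times> ?F S) (B s \<times> {U. \<forall>s\<in>S. U s \<in> B s}) (N s + (\<Sum>s\<in>S. N s))"
    by (intro quot_dim_Times insert) (use insert in auto)
  then have "quot_dim (?F (insert s S)) {U. \<forall>t\<in>insert s S. U t \<in> B t} (N s + (\<Sum>s\<in>S. N s))"
  proof (rule quot_dim_iso[where g = "\<lambda>U. (U s, U(s := 0))"])
    show "(\<lambda>U. (U s, U(s := 0))) ` ?F (insert s S) = Z s \<times> ?F S"
    proof (intro equalityI subsetI)
      fix p assume p: "p \<in> Z s \<times> ?F S"
      then have "p = (\<lambda>U. (U s, U(s := 0))) ((snd p)(s := fst p))"
        using insert.hyps by (auto simp: prod_eq_iff fun_eq_iff)
      moreover have "(snd p)(s := fst p) \<in> ?F (insert s S)" using p insert.hyps by auto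
      ultimately show "p \<in> (\<lambda>U. (U s, U(s := 0))) ` ?F (insert s S)" by blast
    qed (use insert.hyps in auto)
  qed (use insert.hyps in \<open>auto simp: fun_eq_iff fun_apply\<close>)
  then show ?case using insert.hyps by simp
qed

text \<open>Being a relation, it includes the finiteness of the dimension. The coboundaries are not
  cut down to bidegree d, because \<open>quot_dim\<close> only sees their intersection with the
  cocycles.\<close>

definition hdim :: "nat set \<Rightarrow> 'b bicomplex \<Rightarrow> int \<Rightarrow> int \<times> int \<Rightarrow> nat \<Rightarrow> bool" where
  "hdim V C j d N \<longleftrightarrow> quot_dim (hcocycles V C j \<inter> degree_part C d) (hcoboundaries V C j) N"


subsection \<open>Slices of a tensor product\<close>

definition slice :: "'b \<Rightarrow> ('b list \<Rightarrow> qpoly) \<Rightarrow> 'b list \<Rightarrow> qpoly" where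
  "slice x c = (\<lambda>ys. c (x # ys))"

text \<open>The inverse of slicing. The empty list is no generator of a tensor product, so the value
  there has to be 0.\<close>

definition glue :: "('b \<Rightarrow> 'b list \<Rightarrow> qpoly) \<Rightarrow> 'b list \<Rightarrow> qpoly" where
  "glue U zs = (case zs of [] \<Rightarrow> 0 | x # ys \<Rightarrow> U x ys)"

lemma slice_glue [simp]: "slice x (glue U) = U x" "glue U [] = 0"
  by (simp_all add: slice_def glue_def)

lemma slice_add: "slice x (c + c') = slice x c + slice x c'"
  by (simp add: slice_def fun_eq_iff fun_apply)

lemma slice_0 [simp]: "slice x 0 = 0"
  by (simp add: slice_def fun_eq_iff fun_apply)

lemma eq_iff_slices: "c = c' \<longleftrightarrow> c [] = c' [] \<and> (\<forall>x. slice x c = slice x c')"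
proof
  assume *: "c [] = c' [] \<and> (\<forall>x. slice x c = slice x c')"
  show "c = c'"
  proof
    fix zs show "c zs = c' zs" using * by (cases zs) (auto simp: slice_def fun_eq_iff)
  qed
qed simp

lemma cochains_tensor_iff:
  "c \<in> cochains V (tensor C D) j \<longleftrightarrow>
    c [] = 0 \<and> (\<forall>x. x \<notin> gens C \<longrightarrow> slice x c = 0) \<and> (\<forall>x\<in>gens C. slice x c \<in> cochains V D (j - cdeg C x))"
  (is "?l \<longleftrightarrow> ?r")
proof
  assume ?l
  then show ?r by (auto simp: cochains_def slice_def fun_eq_iff fun_apply)
next
  assume r: ?r
  have "c zs \<in> polys V \<and> (c zs \<noteq> 0 \<longrightarrow> zs \<in> gens (tensor C D) \<and> cdeg (tensor C D) zs = j)" for zs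
  proof (cases zs)
    case (Cons x ys)
    have "x \<notin> gens C \<Longrightarrow> c (x # ys) = 0" using r by (auto simp: slice_def fun_eq_iff fun_apply)
    moreover have "c (x # ys) \<in> polys V \<and> (c (x # ys) \<noteq> 0 \<longrightarrow> ys \<in> gens D \<and> cdeg D ys = j - cdeg C x)"
      if "x \<in> gens C" using r that by (auto simp: slice_def cochains_def)
    ultimately show ?thesis using Cons by (cases "x \<in> gens C") auto
  qed (use r in simp)
  then show ?l by (simp add: cochains_def)
qed

lemma degree_part_tensor_iff:
  assumes "c [] = 0"
  shows "c \<in> degree_part (tensor C D) d \<longleftrightarrow> (\<forall>x. slice x c \<in> degree_part D (d - bideg C x))"
proof -
  have all_list: "(\<forall>zs. P zs) \<longleftrightarrow> P [] \<and> (\<forall>x ys. P (x # ys))" for P :: "'a list \<Rightarrow> bool"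
    by (metis neq_Nil_conv)
  have "c \<in> degree_part (tensor C D) d \<longleftrightarrow>
      (\<forall>x ys. \<forall>m\<in>keys (c (x # ys)). bideg (tensor C D) (x # ys) + (0, int (mdeg m)) = d)"
    unfolding degree_part_def mem_Collect_eq by (subst all_list) (simp add: assms)
  then show ?thesis by (auto simp: degree_part_def slice_def prod_eq_iff algebra_simps)
qed

text \<open>The matrix of a tensor product in block form, the blocks being indexed by generators of
  C: A contributes scalar blocks, and A' contributes signed copies of itself on the
  diagonal.\<close>

lemma slice_apply_tensor_matrix:
  assumes fin: "finite (gens C)" "finite (gens D)" and y: "y \<in> gens C" and c: "c \<in> cochains V (tensor C D) j"
  shows "slice y (apply_matrix (tensor C D) (tensor_matrix s A A') c) =
    (\<Sum>x\<in>gens C. scale (A x y) (slice x c)) + scale (koszul_sign (s y)) (apply_matrix D A' (slice y c))"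
proof
  fix ys
  have sum_apply: "sum f S ys = (\<Sum>s\<in>S. f s ys)" for f :: "'a \<Rightarrow> 'a list \<Rightarrow> qpoly" and S
    by (induction S rule: infinite_finite_induct) (auto simp: fun_apply)
  show "slice y (apply_matrix (tensor C D) (tensor_matrix s A A') c) ys =
    ((\<Sum>x\<in>gens C. scale (A x y) (slice x c)) + scale (koszul_sign (s y)) (apply_matrix D A' (slice y c))) ys"
  proof (cases "ys \<in> gens D")
    case True
    have "slice y (apply_matrix (tensor C D) (tensor_matrix s A A') c) ys =
        (\<Sum>x\<in>gens C. \<Sum>xs\<in>gens D. c (x # xs) * (if xs = ys then A x y else 0)) +
        (\<Sum>x\<in>gens C. \<Sum>xs\<in>gens D. c (x # xs) * (if x = y then koszul_sign (s x) * A' xs ys else 0))"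
      using y True
      by (simp add: slice_def apply_matrix_def sum_gens_tensor distrib_left sum.distrib)
    also have "(\<Sum>x\<in>gens C. \<Sum>xs\<in>gens D. c (x # xs) * (if xs = ys then A x y else 0)) =
        (\<Sum>x\<in>gens C. c (x # ys) * A x y)"
      using fin True by (subst sum_if_mult(2)) auto
    also have "(\<Sum>x\<in>gens C. \<Sum>xs\<in>gens D. c (x # xs) * (if x = y then koszul_sign (s x) * A' xs ys else 0)) =
        (\<Sum>xs\<in>gens D. \<Sum>x\<in>gens C. c (x # xs) * (if x = y then koszul_sign (s x) * A' xs ys else 0))"
      by (rule sum.swap)
    also have "\<dots> = (\<Sum>xs\<in>gens D. c (y # xs) * (koszul_sign (s y) * A' xs ys))"
      using fin y by (subst sum_if_mult(2)) auto
    finally show ?thesis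
      using True by (simp add: fun_apply sum_apply scale_def slice_def apply_matrix_def sum_distrib_left ac_simps)
  next
    case False
    then have "c (x # ys) = 0" for x using c by (auto simp: cochains_def)
    then show ?thesis
      using False by (simp add: fun_apply sum_apply scale_def slice_def apply_matrix_def)
  qed
qed

lemma scale_koszul_sign_eq_0_iff: "scale (koszul_sign k) c = 0 \<longleftrightarrow> c = 0"
  by (auto simp: koszul_sign_def scale_def fun_eq_iff fun_apply)

lemma scale_koszul_sign_square: "scale (koszul_sign k) (scale (koszul_sign k) c) = c"
  by (simp add: scale_simps(3)[symmetric]) (simp add: scale_simps)

lemma apply_tensor_matrix_Nil: "apply_matrix (tensor C D) A c [] = 0"
  and slice_apply_tensor_matrix_outside: "x \<notin> gens C \<Longrightarrow> slice x (apply_matrix (tensor C D) A c) = 0"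
  by (simp_all add: apply_matrix_def slice_def fun_eq_iff fun_apply)

text \<open>Without a horizontal differential on C the tensor product splits into one shifted copy
  of D for each generator of C, with the differential changed by a sign at most. This covers vertex
  factors and also loops, where x_i - x_i = 0.\<close>

lemma hdim_tensor_zero_hdiff:
  assumes C: "wf_bicomplex V C" and D: "wf_bicomplex V D"
    and zero: "\<And>x y. x \<in> gens C \<Longrightarrow> y \<in> gens C \<Longrightarrow> hdiff C x y = 0"
    and dims: "\<And>x. x \<in> gens C \<Longrightarrow> hdim V D (j - cdeg C x) (d - bideg C x) (N x)"
  shows "hdim V (tensor C D) j d (\<Sum>x\<in>gens C. N x)"
proof -
  note fin = finite_gens[OF C] finite_gens[OF D]
  let ?h = "apply_matrix (tensor C D) (hdiff (tensor C D))" and ?hD = "apply_matrix D (hdiff D)"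
  let ?s = "\<lambda>x. koszul_sign (hdeg C x)"
  let ?Z = "\<lambda>x. hcocycles V D (j - cdeg C x) \<inter> degree_part D (d - bideg C x)"
  have slice_h: "slice x (?h c) = scale (?s x) (?hD (slice x c))" if "x \<in> gens C" "c \<in> cochains V (tensor C D) j" for x c
    using slice_apply_tensor_matrix[OF fin that] that zero by (simp add: scale_simps)
  let ?F = "{U. (\<forall>s\<in>gens C. U s \<in> ?Z s) \<and> (\<forall>s. s \<notin> gens C \<longrightarrow> U s = 0)}"
  let ?G = "{U. \<forall>s\<in>gens C. U s \<in> hcoboundaries V D (j - cdeg C s)}"
  have "quot_dim ?F ?G (\<Sum>x\<in>gens C. N x)"
    by (rule quot_dim_family[OF fin(1) dims[unfolded hdim_def]])
  then show ?thesis
    unfolding hdim_def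
  proof (rule quot_dim_iso[where g = "\<lambda>c x. slice x c"])
    let ?Z' = "hcocycles V (tensor C D) j \<inter> degree_part (tensor C D) d"
    have Z'_iff: "c \<in> ?Z' \<longleftrightarrow> c [] = 0 \<and> (\<lambda>x. slice x c) \<in> ?F" for c
    proof -
      have "?h c = 0 \<longleftrightarrow> (\<forall>x\<in>gens C. ?hD (slice x c) = 0)" if "c \<in> cochains V (tensor C D) j"
      proof -
        have "?h c = 0 \<longleftrightarrow> (\<forall>x. slice x (?h c) = 0)"
          using eq_iff_slices[of "?h c" 0] by (simp add: apply_tensor_matrix_Nil fun_apply del: tensor_simps)
        also have "\<dots> \<longleftrightarrow> (\<forall>x\<in>gens C. slice x (?h c) = 0)"
          using slice_apply_tensor_matrix_outside by fast
        also have "\<dots> \<longleftrightarrow> (\<forall>x\<in>gens C. ?hD (slice x c) = 0)"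
          by (rule ball_cong[OF refl]) (simp only: slice_h[OF _ that] scale_koszul_sign_eq_0_iff)
        finally show ?thesis .
      qed
      moreover have "\<forall>x. x \<notin> gens C \<longrightarrow> slice x c = 0 \<Longrightarrow>
          (\<forall>x. slice x c \<in> degree_part D (d - bideg C x)) \<longleftrightarrow> (\<forall>x\<in>gens C. slice x c \<in> degree_part D (d - bideg C x))"
        using add_subgroupD(1)[OF degree_part_subgroup] by metis
      ultimately show ?thesis
        using degree_part_tensor_iff[of c C D d] cochains_tensor_iff[of c V C D j]
        by (auto simp: hcocycles_def)
    qed
    show "(\<lambda>c x. slice x c) ` ?Z' = ?F"
    proof (intro equalityI subsetI)
      fix U assume U: "U \<in> ?F"
      then have "glue U \<in> ?Z'" unfolding Z'_iff by simp
      then show "U \<in> (\<lambda>c x. slice x c) ` ?Z'" by (rule rev_image_eqI) simp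
    qed (use Z'_iff in blast)
    fix c assume c: "c \<in> ?Z'"
    then have cc: "c \<in> cochains V (tensor C D) j" by (simp add: hcocycles_def)
    show "(\<lambda>x. slice x c) \<in> ?G \<longleftrightarrow> c \<in> hcoboundaries V (tensor C D) j"
    proof
      assume "c \<in> hcoboundaries V (tensor C D) j"
      then obtain b where b: "b \<in> cochains V (tensor C D) j" "c = ?h b" by (auto simp: hcoboundaries_def)
      have "slice x c \<in> hcoboundaries V D (j - cdeg C x)" if "x \<in> gens C" for x
      proof -
        have "slice x c = ?hD (scale (?s x) (slice x b))" using slice_h[OF that b(1)] b by (simp add: apply_matrix_scale)
        moreover have "scale (?s x) (slice x b) \<in> cochains V D (j - cdeg C x)"
          using b that by (intro scale_cochains) (auto simp: cochains_tensor_iff)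
        ultimately show ?thesis by (auto simp: hcoboundaries_def)
      qed
      then show "(\<lambda>x. slice x c) \<in> ?G" by simp
    next
      assume "(\<lambda>x. slice x c) \<in> ?G"
      then have "\<forall>x\<in>gens C. \<exists>b\<in>cochains V D (j - cdeg C x). slice x c = ?hD b" by (auto simp: hcoboundaries_def)
      then obtain b where b: "\<And>x. x \<in> gens C \<Longrightarrow> b x \<in> cochains V D (j - cdeg C x) \<and> slice x c = ?hD (b x)" by metis
      \<comment> \<open>The preimages are chosen slice by slice; the factor \<open>?s x\<close>
        undoes the sign of the differential on the slice at x.\<close>
      let ?b = "glue (\<lambda>x. if x \<in> gens C then scale (?s x) (b x) else 0)"
      have b': "?b \<in> cochains V (tensor C D) j"
        using b by (auto simp: cochains_tensor_iff intro!: scale_cochains)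
      have "?h ?b = c"
      proof (rule iffD2[OF eq_iff_slices], intro conjI allI)
        show "?h ?b [] = c []" using cc by (simp add: apply_tensor_matrix_Nil cochains_tensor_iff)
        fix x show "slice x (?h ?b) = slice x c"
        proof (cases "x \<in> gens C")
          case True
          then show ?thesis
            using slice_h[OF True b'] b[OF True] by (simp add: apply_matrix_scale scale_koszul_sign_square)
        next
          case False
          then show ?thesis using cc slice_apply_tensor_matrix_outside[OF False] by (simp add: cochains_tensor_iff)
        qed
      qed
      then show "c \<in> hcoboundaries V (tensor C D) j" using b' by (auto simp: hcoboundaries_def)
    qed
  qed (auto simp: slice_add fun_eq_iff fun_apply)
qed

subsection \<open>Identifying two variables\<close>

text \<open>Base change along a homomorphism of polynomial rings; the case of interest is the
  identification of x_k with x_i.\<close>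

definition rename_bicomplex :: "(nat \<Rightarrow> nat) \<Rightarrow> 'b bicomplex \<Rightarrow> 'b bicomplex" where
  "rename_bicomplex \<sigma> C = C\<lparr>hdiff := \<lambda>x y. rename_vars \<sigma> (hdiff C x y),
     vdiff := \<lambda>x y. rename_vars \<sigma> (vdiff C x y)\<rparr>"

lemma rename_bicomplex_simps [simp]:
  "gens (rename_bicomplex \<sigma> C) = gens C" "cdeg (rename_bicomplex \<sigma> C) = cdeg C"
  "hdeg (rename_bicomplex \<sigma> C) = hdeg C" "bideg (rename_bicomplex \<sigma> C) = bideg C"
  "hdiff (rename_bicomplex \<sigma> C) x y = rename_vars \<sigma> (hdiff C x y)"
  "vdiff (rename_bicomplex \<sigma> C) x y = rename_vars \<sigma> (vdiff C x y)"
  by (simp_all add: rename_bicomplex_def)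

lemma bicomplex_eqI:
  fixes C D :: "'b bicomplex"
  assumes "gens C = gens D" "hdeg C = hdeg D" "bideg C = bideg D" "hdiff C = hdiff D"
    "cdeg C = cdeg D" "vdiff C = vdiff D"
  shows "C = D"
  using assms by (cases C, cases D) simp

lemma rename_bicomplex_tensor:
  "rename_bicomplex \<sigma> (tensor C D) = tensor (rename_bicomplex \<sigma> C) (rename_bicomplex \<sigma> D)"
  by (rule bicomplex_eqI)
    (auto simp: tensor_def fun_eq_iff rename_vars_add rename_vars_mult)

lemma rename_bicomplex_tensor_list:
  "rename_bicomplex \<sigma> (tensor_list Cs) = tensor_list (map (rename_bicomplex \<sigma>) Cs)"
proof (induction Cs)
  case Nil
  show ?case by (rule bicomplex_eqI) (auto simp: tensor_unit_def fun_eq_iff)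
qed (simp add: rename_bicomplex_tensor)

lemma rename_bicomplex_edge_factor:
  "rename_bicomplex \<sigma> (edge_factor i j) = edge_factor (\<sigma> i) (\<sigma> j)"
  by (rule bicomplex_eqI) (auto simp: factor_defs fun_eq_iff rename_vars_diff split: sum.split)

lemma rename_bicomplex_vertex_factor: "rename_bicomplex \<sigma> vertex_factor = vertex_factor"
  by (rule bicomplex_eqI) (auto simp: factor_defs fun_eq_iff split: sum.split)

text \<open>Exactness of multiplication by x_i - x_k followed by base change, applied to each
  coefficient. The quotient loses one in the exponent of q because x_i - x_k has degree one.\<close>

lemma divide_cochain:
  assumes i: "i \<in> V" "k \<in> V" and c: "c \<in> cochains V T j"
    and zero: "\<And>ys. rename_vars (id(k := i)) (c ys) = 0"
  shows "\<exists>w\<in>cochains V T j. c = scale (var i - var k) w \<and>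
    (\<forall>d. c \<in> degree_part T d \<longrightarrow> w \<in> degree_part T (d - (0, 1)))"
proof -
  have "\<exists>q\<in>polys V. c ys = (var i - var k) * q \<and> (\<forall>m\<in>keys q. mdeg m + 1 \<in> mdeg ` keys (c ys))" for ys
    using diff_rename_divisible[of "c ys" V i k] i c zero[of ys] by (simp add: cochains_def)
  then obtain w where w: "\<And>ys. w ys \<in> polys V" "\<And>ys. c ys = (var i - var k) * w ys"
    "\<And>ys m. m \<in> keys (w ys) \<Longrightarrow> mdeg m + 1 \<in> mdeg ` keys (c ys)"
    by metis
  \<comment> \<open>The degree control on w yields its support: without monomials in
    \<open>c ys\<close> there can be none in \<open>w ys\<close>.\<close>
  have "w ys = 0" if "c ys = 0" for ys
  proof -
    have "keys (w ys) = {}"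
      using w(3)[of _ ys] unfolding that keys_zero image_empty empty_iff by blast
    then show ?thesis by simp
  qed
  then have "w \<in> cochains V T j" using c w(1) by (auto simp: cochains_def)
  moreover have "c = scale (var i - var k) w" using w(2) by (auto simp: scale_def)
  moreover have "w \<in> degree_part T (d - (0, 1))" if d: "c \<in> degree_part T d" for d
    unfolding degree_part_def
  proof (intro CollectI allI ballI)
    fix ys m assume "m \<in> keys (w ys)"
    then obtain m' where m': "m' \<in> keys (c ys)" "mdeg m + 1 = mdeg m'" using w(3) by blast
    then have "bideg T ys + (0, int (mdeg m')) = d" using d by (auto simp: degree_part_def)
    then show "bideg T ys + (0, int (mdeg m)) = d - (0, 1)"
      using m'(2)[symmetric] by (auto simp: prod_eq_iff)
  qed
  ultimately show ?thesis by blast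
qed

lemma scale_var_diff_cancel:
  assumes "i \<noteq> k" "scale (var i - var k) c = scale (var i - var k) c'"
  shows "c = c'"
proof
  fix x
  have "(var i - var k) * c x = (var i - var k) * c' x" using fun_cong[OF assms(2), of x] by (simp only: scale_def)
  then show "c x = c' x" using var_diff_nonzero[OF assms(1)] by (metis mult_cancel_left)
qed

text \<open>I marks the part of an edge factor in cohomological degree -1, J the part in degree 0; L
  and R are the left and right terms of the horizontal complex.\<close>

abbreviation "IL \<equiv> Inl LeftTerm :: side + side"
abbreviation "IR \<equiv> Inl RightTerm :: side + side"
abbreviation "JL \<equiv> Inr LeftTerm :: side + side"
abbreviation "JR \<equiv> Inr RightTerm :: side + side"

lemma all_side_sum: "(\<forall>x::side + side. P x) \<longleftrightarrow> P IL \<and> P IR \<and> P JL \<and> P JR"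
proof -
  have "(\<forall>y. Q y) \<longleftrightarrow> Q LeftTerm \<and> Q RightTerm" for Q
    by (metis side.exhaust)
  then show ?thesis by (simp add: split_sum_all)
qed

lemma edge_factor_degrees [simp]:
  "cdeg (edge_factor i k) IL = -1" "cdeg (edge_factor i k) IR = -1"
  "cdeg (edge_factor i k) JL = 0" "cdeg (edge_factor i k) JR = 0"
  "bideg (edge_factor i k) IL = (-1, 2)" "bideg (edge_factor i k) IR = (0, 1)"
  "bideg (edge_factor i k) JL = (-1, 1)" "bideg (edge_factor i k) JR = (0, 0)"
  by (simp_all add: factor_defs)

text \<open>The only horizontal entry of the edge factor leads from \<open>IL\<close> to
  \<open>IR\<close>. The minus signs come from the horizontal degree -1 of left terms.\<close>

lemma slice_hdiff_edge_factor:
  assumes "finite (gens T)" and c: "c \<in> cochains V (tensor (edge_factor i k) T) j"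
  shows "slice IL (apply_matrix (tensor (edge_factor i k) T) (hdiff (tensor (edge_factor i k) T)) c) =
      - apply_matrix T (hdiff T) (slice IL c)" (is ?IL)
    "slice IR (apply_matrix (tensor (edge_factor i k) T) (hdiff (tensor (edge_factor i k) T)) c) =
      scale (var i - var k) (slice IL c) + apply_matrix T (hdiff T) (slice IR c)" (is ?IR)
    "slice JL (apply_matrix (tensor (edge_factor i k) T) (hdiff (tensor (edge_factor i k) T)) c) =
      - apply_matrix T (hdiff T) (slice JL c)" (is ?JL)
    "slice JR (apply_matrix (tensor (edge_factor i k) T) (hdiff (tensor (edge_factor i k) T)) c) =
      apply_matrix T (hdiff T) (slice JR c)" (is ?JR)
proof -
  have minus: "scale (-1) c = - c" for c :: "'z \<Rightarrow> qpoly" by (simp add: scale_def fun_eq_iff fun_apply)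
  have fin: "finite (gens (edge_factor i k))" by (simp add: gens_edge_factor)
  have h: "hdiff (edge_factor i k) x y = (if x = IL \<and> y = IR then var i - var k else 0)" for x y
    by (auto simp: factor_defs split: sum.split side.split)
  have s: "hdeg (edge_factor i k) IL = -1" "hdeg (edge_factor i k) IR = 0"
    "hdeg (edge_factor i k) JL = -1" "hdeg (edge_factor i k) JR = 0"
    by (simp_all add: factor_defs)
  have sign: "koszul_sign (-1) = -1" by (simp add: koszul_sign_def)
  note slice = slice_apply_tensor_matrix[OF fin assms(1) _ c, of _ "hdeg (edge_factor i k)" "hdiff (edge_factor i k)" "hdiff T"]
  show ?IL ?IR ?JL ?JR
    unfolding tensor_simps
    by (subst slice; simp add: gens_edge_factor h s sign minus scale_simps)+
qed

text \<open>The complex \<open>0 \<rightarrow> R \<rightarrow> R \<rightarrow> 0\<close> given by \<open>x\<^sub>i - x\<^sub>k\<close> is a resolution of the quotient ring in which \<open>x\<^sub>k\<close>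
  is identified with \<open>x\<^sub>i\<close>; tensoring with it amounts to this identification.\<close>

lemma hdim_tensor_edge_factor:
  assumes i: "i \<in> V" "k \<in> V" "i \<noteq> k" and T: "wf_bicomplex V T"
    and N1: "hdim (V - {k}) (rename_bicomplex (id(k := i)) T) (j + 1) (d - (0, 1)) N1"
    and N2: "hdim V T j (d - (-1, 1)) N2" and N3: "hdim V T j d N3"
  shows "hdim V (tensor (edge_factor i k) T) j d (N1 + (N2 + N3))"
proof -
  let ?C = "tensor (edge_factor i k) T" and ?f = "id(k := i)" and ?W = "V - {k}" and ?a = "var i - var k"
  let ?T = "rename_bicomplex ?f T"
  let ?h = "apply_matrix ?C (hdiff ?C)" and ?hT = "apply_matrix T (hdiff T)" and ?hW = "apply_matrix ?T (hdiff ?T)"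
  note fin = finite_gens[OF T]
  \<comment> \<open>R is base change on cochains. Its kernel consists of the multiples of
    \<open>?a\<close>, and the cochains without the variable x_k form a section of it.\<close>
  define R where "R = (\<lambda>(c :: (side + side) list \<Rightarrow> qpoly) ys. rename_vars ?f (c ys))"
  have R_add: "R (c + c') = R c + R c'" and R_diff: "R (c - c') = R c - R c'" and R_0: "R 0 = 0"
    and R_scale: "R (scale p c) = scale (rename_vars ?f p) (R c)" for c c' :: "(side + side) list \<Rightarrow> qpoly" and p
    by (auto simp: R_def fun_eq_iff fun_apply scale_def rename_vars_add rename_vars_diff rename_vars_mult)
  have ra: "rename_vars ?f ?a = 0" using i by (simp add: rename_vars_diff)
  have R_scale_a: "R (scale ?a c) = 0" for c :: "(side + side) list \<Rightarrow> qpoly" by (simp add: R_scale ra scale_simps)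
  have R_h: "?hW (R c) = R (?hT c)" for c
    by (auto simp: R_def apply_matrix_def fun_eq_iff rename_vars_sum rename_vars_mult)
  have R_cochains: "R c \<in> cochains ?W ?T l" if "c \<in> cochains V T l" for c l
  proof -
    have "rename_vars ?f (c ys) \<in> polys ?W" for ys
      by (rule rename_vars_in_polys[of _ V]) (use that i in \<open>auto simp: cochains_def\<close>)
    moreover have "rename_vars ?f (c ys) \<noteq> 0 \<Longrightarrow> c ys \<noteq> 0" for ys by auto
    ultimately show ?thesis using that by (simp add: cochains_def R_def)
  qed
  have W_cochains: "c \<in> cochains V T l \<and> R c = c" if "c \<in> cochains ?W ?T l" for c l
  proof -
    have "rename_vars ?f (c ys) = c ys" for ys
      by (rule rename_vars_ident[of _ ?W]) (use that in \<open>auto simp: cochains_def\<close>)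
    moreover have "c ys \<in> polys V" for ys
      by (rule polys_mono[of ?W]) (use that in \<open>auto simp: cochains_def\<close>)
    ultimately show ?thesis using that by (auto simp: cochains_def R_def)
  qed
  have R_degree: "R c \<in> degree_part ?T e" if "c \<in> degree_part T e" for c e
    unfolding degree_part_def
  proof (intro CollectI allI ballI)
    fix ys m assume "m \<in> keys (R c ys)"
    then obtain m' where "m' \<in> keys (c ys)" "m = rename_monom ?f m'" using keys_rename_vars unfolding R_def by blast
    then show "bideg ?T ys + (0, int (mdeg m)) = e" using that by (auto simp: degree_part_def)
  qed
  have divide: "\<exists>w\<in>cochains V T l. c = scale ?a w \<and> (\<forall>e. c \<in> degree_part T e \<longrightarrow> w \<in> degree_part T (e - (0, 1)))"
    if "c \<in> cochains V T l" "R c = 0" for c l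
    by (rule divide_cochain) (use that i in \<open>auto simp: R_def fun_eq_iff fun_apply\<close>)
  note slice_h = slice_hdiff_edge_factor[OF fin]
  note cancel = scale_var_diff_cancel[OF i(3)]
  have cochains: "c \<in> cochains V ?C l \<longleftrightarrow> c [] = 0 \<and> slice IL c \<in> cochains V T (l + 1) \<and>
      slice IR c \<in> cochains V T (l + 1) \<and> slice JL c \<in> cochains V T l \<and> slice JR c \<in> cochains V T l" for c l
    unfolding cochains_tensor_iff gens_edge_factor using side.exhaust sum.exhaust
    by (simp add: all_side_sum)
  have degree: "c \<in> degree_part ?C d \<longleftrightarrow> slice IL c \<in> degree_part T (d - (-1, 2)) \<and>
      slice IR c \<in> degree_part T (d - (0, 1)) \<and> slice JL c \<in> degree_part T (d - (-1, 1)) \<and>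
      slice JR c \<in> degree_part T d" if "c [] = 0" for c
    unfolding degree_part_tensor_iff[of c, OF that] all_side_sum by (simp add: zero_prod_def[symmetric])
  have cocycle: "?h c = 0 \<longleftrightarrow> ?hT (slice IL c) = 0 \<and> scale ?a (slice IL c) + ?hT (slice IR c) = 0 \<and>
      ?hT (slice JL c) = 0 \<and> ?hT (slice JR c) = 0" if c: "c \<in> cochains V ?C l" for c l
  proof -
    have "?h c = 0 \<longleftrightarrow> (\<forall>x. slice x (?h c) = 0)"
      using eq_iff_slices[of "?h c" 0] by (simp add: apply_tensor_matrix_Nil fun_apply del: tensor_simps)
    then show ?thesis unfolding all_side_sum by (simp only: slice_h[OF c] neg_equal_0_iff_equal)
  qed
  let ?Z = "hcocycles V ?C j \<inter> degree_part ?C d"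
  \<comment> \<open>\<open>j + 1\<close> and \<open>d - (0, 1)\<close> remove the cohomological
    degree and the bidegree of \<open>IR\<close>; the shifts in \<open>?Z2\<close> and
    \<open>?Z3\<close> belong to \<open>JL\<close> and \<open>JR\<close>.\<close>
  let ?Z1 = "hcocycles ?W ?T (j + 1) \<inter> degree_part ?T (d - (0, 1))"
  let ?Z2 = "hcocycles V T j \<inter> degree_part T (d - (-1, 1))" and ?Z3 = "hcocycles V T j \<inter> degree_part T d"
  let ?B1 = "hcoboundaries ?W ?T (j + 1)" and ?B2 = "hcoboundaries V T j"
  define g where "g = (\<lambda>c. (R (slice IR c), (slice JL c, slice JR c)))"
  have "quot_dim (?Z1 \<times> (?Z2 \<times> ?Z3)) (?B1 \<times> (?B2 \<times> ?B2)) (N1 + (N2 + N3))"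
    using N1 N2 N3 unfolding hdim_def by (intro quot_dim_Times)
  then show ?thesis
    unfolding hdim_def
  proof (rule quot_dim_iso[where g = g])
    show "g (x + y) = g x + g y" for x y by (simp add: g_def slice_add R_add)
    show "g ` ?Z = ?Z1 \<times> (?Z2 \<times> ?Z3)"
    proof (intro equalityI subsetI)
      fix p assume "p \<in> g ` ?Z"
      then obtain c where c: "c \<in> ?Z" "p = g c" by blast
      then have cc: "c \<in> cochains V ?C j" and hc: "?h c = 0" by (auto simp: hcocycles_def)
      have s: "c [] = 0" "slice IR c \<in> cochains V T (j + 1)" "slice JL c \<in> cochains V T j" "slice JR c \<in> cochains V T j"
        using cc by (simp_all add: cochains)
      have z: "scale ?a (slice IL c) + ?hT (slice IR c) = 0" "?hT (slice JL c) = 0" "?hT (slice JR c) = 0"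
        using hc cocycle[OF cc] by auto
      have "R (scale ?a (slice IL c) + ?hT (slice IR c)) = 0" using z R_0 by simp
      then have "?hW (R (slice IR c)) = 0" by (simp add: R_add R_scale_a R_h)
      moreover have "c \<in> degree_part ?C d" using c by blast
      ultimately show "p \<in> ?Z1 \<times> (?Z2 \<times> ?Z3)"
        using s z R_cochains R_degree degree[of c, OF s(1)] by (simp add: c(2) g_def hcocycles_def)
    next
      fix p assume p: "p \<in> ?Z1 \<times> (?Z2 \<times> ?Z3)"
      obtain z1 z2 z3 where z: "p = (z1, (z2, z3))" by (cases p) auto
      have z1: "z1 \<in> cochains ?W ?T (j + 1)" "?hW z1 = 0" "z1 \<in> degree_part T (d - (0, 1))"
        and z2: "z2 \<in> cochains V T j" "?hT z2 = 0" "z2 \<in> degree_part T (d - (-1, 1))"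
        and z3: "z3 \<in> cochains V T j" "?hT z3 = 0" "z3 \<in> degree_part T d"
        using p by (auto simp: z hcocycles_def degree_part_def)
      have z1': "z1 \<in> cochains V T (j + 1)" "R z1 = z1" using W_cochains[OF z1(1)] by auto
      \<comment> \<open>To lift \<open>z1\<close> to a cocycle, regard it as a cochain over the
        larger ring. Its differential vanishes only after base change, so it equals
        \<open>?a\<close> times some w, and \<open>- w\<close> becomes the slice at
        \<open>IL\<close>.\<close>
      have "R (?hT z1) = 0" using R_h[of z1] z1(2) z1'(2) by simp
      then obtain w where w: "w \<in> cochains V T (j + 1)" "?hT z1 = scale ?a w"
        "\<And>e. ?hT z1 \<in> degree_part T e \<Longrightarrow> w \<in> degree_part T (e - (0, 1))"
        using divide[OF hdiff_cochains[OF T z1'(1)]] by blast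
      have "?hT z1 \<in> degree_part T (d - (0, 1) + (1, 0))"
        by (rule apply_matrix_degree_part[OF hom_hdiff[OF T] z1(3)])
      then have "w \<in> degree_part T (d - (0, 1) + (1, 0) - (0, 1))" by (rule w(3))
      \<comment> \<open>The horizontal differential adds (1, 0) and the division removes (0, 1),
        which leads precisely to the bidegree required at \<open>IL\<close>.\<close>
      also have "d - (0, 1) + (1, 0) - (0, 1) = d - (-1, 2)" by (simp add: prod_eq_iff)
      finally have w_degree: "w \<in> degree_part T (d - (-1, 2))" .
      \<comment> \<open>The slice at \<open>IL\<close> must itself be a cocycle; this follows from
        the vanishing square of the differential by cancelling \<open>?a\<close>.\<close>
      have "scale ?a (?hT w) = scale ?a 0"
        using hdiff_hdiff[OF T, of z1] w(2) by (simp add: apply_matrix_scale scale_simps)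
      then have hw: "?hT w = 0" by (rule cancel)
      let ?c = "glue (\<lambda>x. if x = IL then - w else if x = IR then z1 else if x = JL then z2 else z3)"
      have c: "?c \<in> cochains V ?C j"
        using w(1) z1'(1) z2(1) z3(1) add_subgroupD(4)[OF cochains_subgroup] by (simp add: cochains)
      have "?h ?c = 0"
        unfolding cocycle[OF c] using hw w(2) z2(2) z3(2)
        by (simp add: apply_matrix_uminus) (simp add: scale_def fun_eq_iff fun_apply)
      moreover have "?c \<in> degree_part ?C d"
        using w_degree z1(3) z2(3) z3(3) add_subgroupD(4)[OF degree_part_subgroup] by (simp add: degree)
      ultimately have "?c \<in> ?Z" using c by (simp add: hcocycles_def)
      moreover have "p = g ?c" using z1'(2) by (simp add: g_def z)
      ultimately show "p \<in> g ` ?Z" by blast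
    qed
    fix c assume "c \<in> ?Z"
    then have cc: "c \<in> cochains V ?C j" and hc: "?h c = 0" by (auto simp: hcocycles_def)
    have s: "c [] = 0" "slice IL c \<in> cochains V T (j + 1)" "slice IR c \<in> cochains V T (j + 1)"
      "slice JL c \<in> cochains V T j" "slice JR c \<in> cochains V T j"
      using cc by (simp_all add: cochains)
    show "g c \<in> ?B1 \<times> (?B2 \<times> ?B2) \<longleftrightarrow> c \<in> hcoboundaries V ?C j"
    proof
      assume "c \<in> hcoboundaries V ?C j"
      then obtain b where b: "b \<in> cochains V ?C j" "c = ?h b" by (auto simp: hcoboundaries_def)
      have sb: "slice IR b \<in> cochains V T (j + 1)" "slice JL b \<in> cochains V T j" "slice JR b \<in> cochains V T j"
        using b(1) by (simp_all add: cochains)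
      have "R (slice IR c) = ?hW (R (slice IR b))"
        unfolding b(2) slice_h(2)[OF b(1)] by (simp add: R_add R_scale_a R_h)
      moreover have "slice JL c = ?hT (- slice JL b)"
        unfolding b(2) slice_h(3)[OF b(1)] by (simp add: apply_matrix_uminus)
      moreover have "slice JR c = ?hT (slice JR b)"
        unfolding b(2) slice_h(4)[OF b(1)] ..
      ultimately show "g c \<in> ?B1 \<times> (?B2 \<times> ?B2)"
        using sb R_cochains add_subgroupD(4)[OF cochains_subgroup]
        unfolding g_def hcoboundaries_def by (simp only: mem_Times_iff fst_conv snd_conv) blast
    next
      assume "g c \<in> ?B1 \<times> (?B2 \<times> ?B2)"
      then obtain v b2 b3 where v: "v \<in> cochains ?W ?T (j + 1)" "R (slice IR c) = ?hW v"
        and b: "b2 \<in> cochains V T j" "slice JL c = ?hT b2" "b3 \<in> cochains V T j" "slice JR c = ?hT b3"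
        unfolding g_def hcoboundaries_def by auto
      have v': "v \<in> cochains V T (j + 1)" "R v = v" using W_cochains[OF v(1)] by auto
      \<comment> \<open>The slice at \<open>IR\<close> is a coboundary only after base change. The
        discrepancy is \<open>?a\<close> times some w, and w as slice at \<open>IL\<close> of the
        new preimage accounts for it.\<close>
      have "R (slice IR c - ?hT v) = 0" using v(2) R_h[of v] v'(2) by (simp add: R_diff)
      moreover have "slice IR c - ?hT v \<in> cochains V T (j + 1)"
        using add_subgroupD(2)[OF cochains_subgroup] s(3) hdiff_cochains[OF T v'(1)] by blast
      ultimately obtain w where w: "w \<in> cochains V T (j + 1)" "slice IR c - ?hT v = scale ?a w"
        using divide by blast
      have IR: "slice IR c = scale ?a w + ?hT v" using w(2) by (simp add: algebra_simps)
      have "scale ?a (slice IL c) + ?hT (slice IR c) = 0" using hc cocycle[OF cc] by blast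
      then have "scale ?a (slice IL c) + scale ?a (?hT w) = 0"
        by (simp add: IR apply_matrix_add apply_matrix_scale hdiff_hdiff[OF T])
      then have "scale ?a (slice IL c) = scale ?a (- ?hT w)"
        by (simp add: scale_def fun_eq_iff fun_apply add_eq_0_iff)
      then have IL: "slice IL c = - ?hT w" by (rule cancel)
      \<comment> \<open>\<open>b2\<close> is negated to match the sign of the differential on the
        slice at \<open>JL\<close>.\<close>
      let ?b = "glue (\<lambda>x. if x = IL then w else if x = IR then v else if x = JL then - b2 else b3)"
      have bb: "?b \<in> cochains V ?C j"
        using w(1) v'(1) b(1,3) add_subgroupD(4)[OF cochains_subgroup] by (simp add: cochains)
      have "c = ?h ?b"
      proof (rule iffD2[OF eq_iff_slices], intro conjI)
        show "c [] = ?h ?b []" using s(1) by (simp add: apply_tensor_matrix_Nil)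
        show "\<forall>x. slice x c = slice x (?h ?b)"
          unfolding all_side_sum slice_h[OF bb] by (simp add: IL IR b apply_matrix_uminus)
      qed
      then show "c \<in> hcoboundaries V ?C j" using bb by (auto simp: hcoboundaries_def)
    qed
  qed
qed


subsection \<open>Monomials\<close>

definition monomials :: "nat set \<Rightarrow> nat \<Rightarrow> (nat \<Rightarrow>\<^sub>0 nat) set" where
  "monomials V l = {m. keys m \<subseteq> V \<and> mdeg m = l}"

lemma monomials_empty: "monomials {} l = (if l = 0 then {0} else {})"
  by (auto simp: monomials_def keys_eq_empty mdeg_def) 

lemma monomials_0: "monomials V 0 = {0}"
proof -
  have "m = 0" if "mdeg m = 0" for m
    using that by (intro poly_mapping_eqI) (auto simp: mdeg_def in_keys_iff)
  then show ?thesis by (auto simp: monomials_def)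
qed

text \<open>Monomials of positive degree either avoid v or are divisible by it. The union is
  disjoint, which gives the recursion for their number.\<close>

lemma monomials_insert_Suc:
  assumes "v \<notin> V"
  shows "monomials (insert v V) (Suc l) =
    monomials V (Suc l) \<union> (\<lambda>m. m + single v 1) ` monomials (insert v V) l" (is "?l = ?r")
proof (intro equalityI subsetI)
  fix m assume m: "m \<in> ?l"
  show "m \<in> ?r"
  proof (cases "v \<in> keys m")
    case True
    then have eq: "m = (m - single v 1) + single v 1"
      by (intro poly_mapping_eqI) (auto simp: lookup_add lookup_minus lookup_single when_def in_keys_iff)
    then have "mdeg m = mdeg (m - single v 1) + 1" "keys m = keys (m - single v 1) \<union> {v}"
      by (metis mdeg_add mdeg_single, metis keys_plus_nat keys_single one_neq_zero)
    then have "m - single v 1 \<in> monomials (insert v V) l" using m by (auto simp: monomials_def)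
    then show ?thesis using eq by blast
  next
    case False
    then show ?thesis using m by (auto simp: monomials_def)
  qed
qed (auto simp: monomials_def keys_plus_nat)

text \<open>The Hilbert series of a polynomial ring, 1/(1 - x) to the number of variables. Stating
  it as a power of the geometric series lets it be compared directly with the expansion in
  q.\<close>

lemma finite_monomials_card:
  assumes "finite V"
  shows "finite (monomials V l) \<and> card (monomials V l) = fps_nth (Abs_fps (\<lambda>_. 1) ^ card V) l"
  using assms
proof (induction V arbitrary: l rule: finite_induct)
  case empty
  then show ?case by (simp add: monomials_empty)
next
  case (insert v V)
  let ?g = "Abs_fps (\<lambda>_. 1 :: nat)"
  \<comment> \<open>Multiplication by the geometric series forms partial sums of
    coefficients.\<close>
  have nth: "fps_nth (?g ^ Suc n) l = (\<Sum>i\<le>l. fps_nth (?g ^ n) i)" for n l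
    unfolding power_Suc2 fps_mult_nth by (simp add: atLeast0AtMost)
  have "finite (monomials (insert v V) l) \<and> card (monomials (insert v V) l) = fps_nth (?g ^ Suc (card V)) l"
  proof (induction l)
    case 0
    show ?case unfolding nth using insert.IH[of 0] by (simp add: monomials_0)
  next
    case (Suc l)
    have "monomials V (Suc l) \<inter> (\<lambda>m. m + single v 1) ` monomials (insert v V) l = {}"
      using insert.hyps by (auto simp: monomials_def keys_plus_nat)
    moreover have "inj_on (\<lambda>m. m + single v (1::nat)) (monomials (insert v V) l)" by (auto simp: inj_on_def)
    ultimately show ?case
      using insert Suc unfolding monomials_insert_Suc[OF insert.hyps(2)] nth
      by (simp add: card_Un_disjoint card_image)
  qed
  then show ?case using insert.hyps by simp
qed

text \<open>The unit is the polynomial ring itself with zero differential, so the coefficients at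
  the monomials of degree l serve as coordinates.\<close>

lemma hdim_tensor_unit:
  assumes V: "finite V"
  shows "hdim V tensor_unit j (k, l) (if j = 0 \<and> k = 0 \<and> l \<ge> 0 then card (monomials V (nat l)) else 0)"
proof -
  let ?Z = "hcocycles V tensor_unit j \<inter> degree_part (tensor_unit :: 'a list bicomplex) (k, l)"
  let ?B = "hcoboundaries V (tensor_unit :: 'a list bicomplex) j"
  have h: "apply_matrix tensor_unit (hdiff tensor_unit) c = 0" for c :: "'a list \<Rightarrow> qpoly"
    by (simp add: apply_matrix_def tensor_unit_def fun_eq_iff fun_apply)
  have B: "?B = {0}"
    using add_subgroupD(1)[OF cochains_subgroup] unfolding hcoboundaries_def h by fast
  have Z: "c \<in> ?Z \<longleftrightarrow> c [] \<in> polys V \<and> (\<forall>zs. zs \<noteq> [] \<longrightarrow> c zs = 0) \<and> (c [] \<noteq> 0 \<longrightarrow> j = 0) \<and>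
      (\<forall>m\<in>keys (c []). k = 0 \<and> int (mdeg m) = l)" for c
  proof -
    have "c \<in> ?Z \<longleftrightarrow> (\<forall>x. c x \<in> polys V) \<and> (\<forall>x. c x \<noteq> 0 \<longrightarrow> x = [] \<and> j = 0) \<and>
        (\<forall>x. \<forall>m\<in>keys (c x). k = 0 \<and> int (mdeg m) = l)"
      by (auto simp: hcocycles_def h cochains_def degree_part_def)
        (simp_all add: tensor_unit_def zero_prod_def)
    also have "\<dots> \<longleftrightarrow> c [] \<in> polys V \<and> (\<forall>zs. zs \<noteq> [] \<longrightarrow> c zs = 0) \<and> (c [] \<noteq> 0 \<longrightarrow> j = 0) \<and>
        (\<forall>m\<in>keys (c []). k = 0 \<and> int (mdeg m) = l)" (is "?A \<longleftrightarrow> ?B")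
    proof
      assume r: ?B
      have "c x \<in> polys V \<and> (c x \<noteq> 0 \<longrightarrow> x = [] \<and> j = 0) \<and> (\<forall>m\<in>keys (c x). k = 0 \<and> int (mdeg m) = l)" for x
        by (cases "x = []") (use r in auto)
      then show ?A by blast
    qed auto
    finally show ?thesis .
  qed
  show ?thesis
  proof (cases "j = 0 \<and> k = 0 \<and> l \<ge> 0")
    case True
    let ?M = "monomials V (nat l)"
    define N where "N = card ?M"
    obtain e where e: "bij_betw e {..<N} ?M"
      using ex_bij_betw_nat_finite[of ?M] finite_monomials_card[OF V] by (auto simp: N_def atLeast0LessThan)
    define \<phi> where "\<phi> = (\<lambda>(c :: 'a list \<Rightarrow> qpoly) i. if i < N then lookup (c []) (e i) else 0)"
    have "\<phi> (x + y) = \<phi> x + \<phi> y" for x y by (auto simp: \<phi>_def fun_eq_iff fun_apply lookup_add)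
    moreover have "\<phi> c = 0 \<longleftrightarrow> c \<in> ?B" if c: "c \<in> ?Z" for c
    proof
      assume \<phi>: "\<phi> c = 0"
      have "lookup (c []) m = 0" for m
      proof (cases "m \<in> ?M")
        case True
        then obtain i where "i < N" "m = e i" using e by (auto simp: bij_betw_def)
        then show ?thesis using fun_cong[OF \<phi>, of i] by (simp add: \<phi>_def fun_apply)
      next
        case False
        then show ?thesis using c unfolding Z by (auto simp: monomials_def polys_def in_keys_iff)
      qed
      then have "c [] = 0" by (intro poly_mapping_eqI) simp
      then have "c = 0" using c unfolding Z by (metis fun_eq_iff zero_fun_apply)
      then show "c \<in> ?B" by (simp add: B)
    qed (auto simp: B \<phi>_def fun_eq_iff fun_apply)
    moreover have "\<phi> ` ?Z = {f. \<forall>i\<ge>N. f i = 0}"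
    proof (intro equalityI subsetI)
      fix f :: "nat \<Rightarrow> rat" assume f: "f \<in> {f. \<forall>i\<ge>N. f i = 0}"
      let ?p = "\<Sum>i<N. single (e i) (f i)"
      let ?c = "\<lambda>zs. if zs = [] then ?p else 0"
      have eM: "e i \<in> ?M" if "i < N" for i using e that by (auto simp: bij_betw_def)
      have "m \<in> ?M" if "m \<in> keys ?p" for m
        using subsetD[OF keys_sum_subset that] eM by (auto split: if_splits)
      then have "?c \<in> ?Z" using True unfolding Z by (auto simp: polys_def monomials_def)
      moreover have "\<phi> ?c = f"
      proof
        fix i
        show "\<phi> ?c i = f i"
        proof (cases "i < N")
          case True
          have "lookup ?p (e i) = (\<Sum>i'<N. if i' = i then f i else 0)"
            unfolding lookup_sum
            by (rule sum.cong) (use e True in \<open>auto simp: lookup_single when_def bij_betw_def inj_on_def\<close>)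
          then show ?thesis using True by (simp add: \<phi>_def)
        qed (use f in \<open>auto simp: \<phi>_def\<close>)
      qed
      ultimately show "f \<in> \<phi> ` ?Z" using rev_image_eqI[of ?c ?Z f \<phi>] by simp
    qed (auto simp: \<phi>_def)
    ultimately have "quot_dim ?Z ?B N" unfolding quot_dim_def by blast
    then show ?thesis using True by (simp add: hdim_def N_def)
  next
    case False
    have "c [] = 0" if c: "c \<in> ?Z" for c
    proof (rule ccontr)
      assume nz: "c [] \<noteq> 0"
      then obtain m where "m \<in> keys (c [])" by (metis in_keys_iff lookup_zero poly_mapping_eqI)
      then show False using c nz False unfolding Z by auto
    qed
    then have "c = 0" if "c \<in> ?Z" for c using that unfolding Z by (metis fun_eq_iff zero_fun_apply)
    moreover have "0 \<in> ?Z" unfolding Z by (simp add: fun_apply)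
    ultimately have "?Z = {0}" by blast
    then have "quot_dim ?Z ?B 0" using quot_dim_zero[of ?B] B by simp
    then show ?thesis using False by (simp only: hdim_def if_False)
  qed
qed

subsection \<open>Dimensions of vector spaces of cosets\<close>

lemma const_simps: "const (a + b) = const a + const b" "const (a * b) = const a * const b" "const 1 = 1" "const 0 = 0"
  by (simp_all add: const_def single_add mult_single)

text \<open>This is what entitles \<open>quot_dim\<close> to ask for additivity only.\<close>

lemma additive_imp_rat_linear:
  fixes \<phi> :: "('b \<Rightarrow> qpoly) \<Rightarrow> 'i \<Rightarrow> rat"
  assumes A: "add_subgroup A" "\<And>r x. x \<in> A \<Longrightarrow> scale (const r) x \<in> A"
    and add: "\<And>x y. x \<in> A \<Longrightarrow> y \<in> A \<Longrightarrow> \<phi> (x + y) = \<phi> x + \<phi> y" and x: "x \<in> A"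
  shows "\<phi> (scale (const r) x) i = r * \<phi> x i"
proof -
  have zero: "\<phi> 0 = 0" using add[OF add_subgroupD(1,1)[OF A(1)]] by simp
  have nat: "\<phi> (scale (const (of_nat n)) y) i = of_nat n * \<phi> y i" if y: "y \<in> A" for n y
  proof (induction n)
    case 0
    have "\<phi> 0 i = 0" by (simp only: zero zero_fun_apply)
    then show ?case by (simp add: const_simps scale_simps)
  next
    case (Suc n)
    have "scale (const (of_nat (Suc n))) y = scale (const (of_nat n)) y + y"
      by (simp add: const_simps scale_simps)
    then have "\<phi> (scale (const (of_nat (Suc n))) y) = \<phi> (scale (const (of_nat n)) y) + \<phi> y"
      by (simp only: add[OF A(2)[OF y] y])
    then have "\<phi> (scale (const (of_nat (Suc n))) y) i = \<phi> (scale (const (of_nat n)) y) i + \<phi> y i"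
      by (simp only: plus_fun_apply)
    then show ?case using Suc by (simp add: algebra_simps)
  qed
  have neg: "\<phi> (- y) i = - \<phi> y i" if y: "y \<in> A" for y
  proof -
    have "\<phi> (- y + y) i = \<phi> (- y) i + \<phi> y i"
      using add[OF add_subgroupD(4)[OF A(1) y] y] by (simp add: fun_apply)
    then show ?thesis by (simp add: zero fun_apply)
  qed
  have int: "\<phi> (scale (const (of_int z)) y) i = of_int z * \<phi> y i" if y: "y \<in> A" for z y
  proof (cases z rule: int_cases2)
    case (nonneg n)
    then show ?thesis using nat[OF y] by simp
  next
    case (nonpos n)
    have "const (- of_nat n) + const (of_nat n) = 0" by (simp add: const_simps(1,4)[symmetric])
    then have "const (- of_nat n) = - const (of_nat n)" by (simp add: add_eq_0_iff2)
    then have "scale (const (of_int z)) y = - scale (const (of_nat n)) y"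
      using nonpos by (auto simp: scale_def fun_eq_iff fun_apply)
    then show ?thesis using nonpos nat[OF y] neg[OF A(2)[OF y]] by simp
  qed
  \<comment> \<open>Integral scalars are settled, so it remains to clear the denominator.\<close>
  obtain a b where "r = of_int a / of_int b" "b > 0"
    by (metis quotient_of_div quotient_of_denom_pos surj_pair)
  then have r: "of_int b * r = of_int a" "(of_int b :: rat) \<noteq> 0" by auto
  have "of_int b * \<phi> (scale (const r) x) i = \<phi> (scale (const (of_int b)) (scale (const r) x)) i"
    using int[OF A(2)[OF x]] by simp
  also have "scale (const (of_int b)) (scale (const r) x) = scale (const (of_int a)) x"
    by (simp add: scale_simps(3)[symmetric] const_simps(2)[symmetric] r(1))
  also have "\<phi> (scale (const (of_int a)) x) i = of_int b * (r * \<phi> x i)"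
    by (simp add: int[OF x] mult.assoc[symmetric] r(1))
  finally show ?thesis using r(2) by simp
qed

context graded_subquotient
begin

text \<open>Turns coordinates on cocycles into dimensions of vector spaces of cosets. The
  isomorphism is built out of the coordinate space, so that it is given by choosing representatives
  and no map has to be defined on cosets.\<close>

lemma dim_piece:
  assumes dim: "quot_dim (Z \<inter> P d) B N"
  shows "vectorspace.fin_dim class_ring (piece_space Q d)" "vectorspace.dim class_ring (piece_space Q d) = N"
proof -
  let ?V = "piece_space Q d" and ?A = "Z \<inter> P d"
  have A: "add_subgroup ?A" using Z P[of d] by (auto simp: add_subgroup_def)
  have "homogeneous 0 (const r)" for r by (auto simp: homogeneous_def const_def split: if_splits)
  then have scale_A: "scale (const r) x \<in> ?A" if "x \<in> ?A" for r x
    using that scale_Z[of "const r"] scale_P[of 0 "const r" x d] by (simp add: zero_prod_def[symmetric])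
  have V: "carrier ?V = coset B ` ?A" "zero ?V = coset B 0" "\<And>x y. add ?V (coset B x) (coset B y) = coset B (x + y)"
    "\<And>r x. smult ?V r (coset B x) = coset B (scale (const r) x)"
    using add_coset smult_coset by (simp_all add: piece_space_def piece_Q zero_Q)
  have "abelian_group ?V"
  proof (rule abelian_groupI)
    fix X assume "X \<in> carrier ?V"
    then obtain x where "x \<in> ?A" "X = coset B x" by (auto simp: V)
    then show "\<exists>Y\<in>carrier ?V. Y \<oplus>\<^bsub>?V\<^esub> X = \<zero>\<^bsub>?V\<^esub>"
      by (intro bexI[of _ "coset B (- x)"])
        (use add_subgroupD(4)[OF A] in \<open>auto simp: V simp del: coset_0\<close>)
  qed (use add_subgroupD(1,3)[OF A] in \<open>auto simp: V simp del: coset_0 intro!: imageI, (simp add: ac_simps)+\<close>)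
  then have "module class_ring ?V"
    by (intro moduleI) (use scale_A class_cring.cring_axioms in \<open>auto simp: V const_simps scale_simps\<close>)
  then have vs: "vectorspace class_ring ?V"
    by (simp add: vectorspace_def class_field)
  obtain \<phi> where \<phi>: "\<And>x y. x \<in> ?A \<Longrightarrow> y \<in> ?A \<Longrightarrow> \<phi> (x + y) = \<phi> x + \<phi> y"
    "\<And>x. x \<in> ?A \<Longrightarrow> \<phi> x = 0 \<longleftrightarrow> x \<in> B" "\<phi> ` ?A = {f::nat \<Rightarrow> rat. \<forall>i\<ge>N. f i = 0}"
    using dim unfolding quot_dim_def by blast
  have \<phi>_eq: "coset B x = coset B y \<longleftrightarrow> \<phi> x = \<phi> y" if "x \<in> ?A" "y \<in> ?A" for x y
  proof -
    have xy: "x - y \<in> ?A" using add_subgroupD(2)[OF A] that by blast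
    have "\<phi> x = \<phi> (x - y) + \<phi> y" using \<phi>(1)[OF xy that(2)] by simp
    then show ?thesis using \<phi>(2)[OF xy] by (simp add: coset_eq_iff B)
  qed
  \<comment> \<open>Entries of a vector beyond its length are not specified, so they are replaced by
    0.\<close>
  let ?f = "\<lambda>v i. if i < N then vec_index v i else 0"
  have "\<exists>z\<in>?A. \<phi> z = ?f v" for v :: "rat vec"
  proof -
    have "?f v \<in> \<phi> ` ?A" unfolding \<phi>(3) by simp
    then obtain x where "?f v = \<phi> x" "x \<in> ?A" by (rule imageE)
    then show ?thesis by (intro bexI[of _ x]) simp_all
  qed
  \<comment> \<open>The choice z need not be additive on cocycles; it becomes linear modulo B
    because \<open>\<phi>\<close> separates cosets.\<close>
  then obtain z where z: "\<And>v. z v \<in> ?A" "\<And>v. \<phi> (z v) = ?f v" by metis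
  interpret W: vec_space "TYPE(rat)" N .
  let ?W = "module_vec TYPE(rat) N"
  let ?T = "\<lambda>v. coset B (z v)"
  have hom: "?T \<in> module_hom class_ring ?W ?V"
    unfolding module_hom_def
  proof (intro CollectI conjI allI impI)
    show "?T \<in> carrier ?W \<rightarrow> carrier ?V" using z(1) by (simp add: V)
    fix v w assume "v \<in> carrier ?W \<and> w \<in> carrier ?W"
    then have vw: "v \<in> carrier_vec N" "w \<in> carrier_vec N" by (auto simp: module_vec_simps)
    have "\<phi> (z v + z w) = \<phi> (z (v + w))"
      using \<phi>(1)[OF z(1) z(1)] vw by (auto simp: z(2) fun_eq_iff fun_apply)
    then show "?T (v \<oplus>\<^bsub>?W\<^esub> w) = ?T v \<oplus>\<^bsub>?V\<^esub> ?T w"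
      using \<phi>_eq[OF z(1) add_subgroupD(3)[OF A z(1) z(1)]] by (simp add: V module_vec_simps)
  next
    fix r v assume "r \<in> carrier (class_ring :: rat ring) \<and> v \<in> carrier ?W"
    then have v: "v \<in> carrier_vec N" by (auto simp: module_vec_simps)
    have "\<phi> (scale (const r) (z v)) i = \<phi> (z (r \<cdot>\<^sub>v v)) i" for i
      using additive_imp_rat_linear[OF A scale_A \<phi>(1) z(1)] v by (auto simp: z(2))
    then have "\<phi> (z (r \<cdot>\<^sub>v v)) = \<phi> (scale (const r) (z v))" by auto
    then show "?T (r \<odot>\<^bsub>?W\<^esub> v) = r \<odot>\<^bsub>?V\<^esub> ?T v"
      using \<phi>_eq[OF z(1) scale_A[OF z(1)]] by (simp add: V module_vec_simps)
  qed
  interpret T: linear_map class_ring ?W ?V ?T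
    using vs hom vec_vs[where 'a = rat and n = N]
    by (simp add: linear_map_def mod_hom_def mod_hom_axioms_def vectorspace_def)
  have fin: "vectorspace.fin_dim class_ring ?W" using W.fin_dim by simp
  have inj: "inj_on ?T (carrier ?W)"
  proof (rule inj_onI)
    fix v w assume vw: "v \<in> carrier ?W" "w \<in> carrier ?W" "?T v = ?T w"
    then have "?f v = ?f w" using \<phi>_eq[OF z(1) z(1)] z(2) by metis
    then have "vec_index v i = vec_index w i" if "i < N" for i using that by (metis (mono_tags, lifting))
    then show "v = w" using vw by (intro eq_vecI) (auto simp: module_vec_simps)
  qed
  have surj: "?T ` carrier ?W = carrier ?V"
  proof (intro equalityI subsetI)
    fix X assume "X \<in> carrier ?V"
    then obtain x where x: "x \<in> ?A" "X = coset B x" by (auto simp: V)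
    have "\<forall>i\<ge>N. \<phi> x i = 0" using \<phi>(3) x by blast
    then have "\<phi> x = ?f (vec N (\<phi> x))" by (auto simp: fun_eq_iff)
    then have "\<phi> x = \<phi> (z (vec N (\<phi> x)))" by (simp only: z(2))
    then have "X = ?T (vec N (\<phi> x))" using \<phi>_eq[OF x(1) z(1)] x(2) by simp
    then show "X \<in> ?T ` carrier ?W" by (auto simp: module_vec_simps)
  qed (use z(1) in \<open>auto simp: V\<close>)
  show "vectorspace.fin_dim class_ring ?V" by (rule T.surj_fin_dim[OF fin surj])
  show "vectorspace.dim class_ring ?V = N" using T.dim_eq[OF fin inj surj] W.dim_is_n by simp
qed

end


section \<open>The Euler characteristic\<close>

text \<open>The outer Laurent series is in q and the inner one in t, so the index l comes first when
  coefficients are extracted.\<close>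

definition tq_coeff :: "rat fls fls \<Rightarrow> int \<Rightarrow> int \<Rightarrow> rat" where
  "tq_coeff S k l = fls_nth (fls_nth S l) k"

text \<open>The graded rank 1 + t^-1 q of a Koszul complex with zero differential, with generators
  in bidegrees (0, 0) and (-1, 1).\<close>

definition shift_factor :: "rat fls fls" where
  "shift_factor = 1 + inverse (fls_const fls_X) * fls_X"

lemma tq_coeff_diff: "tq_coeff (S - S') k l = tq_coeff S k l - tq_coeff S' k l"
  by (simp add: tq_coeff_def)

lemma tq_coeff_X_mult: "tq_coeff (fls_X * S) k l = tq_coeff S k (l - 1)"
  by (simp add: tq_coeff_def fls_X_times_conv_shift)

lemma tq_coeff_shift_factor_mult: "tq_coeff (shift_factor * S) k l = tq_coeff S k l + tq_coeff S (k + 1) (l - 1)"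
proof -
  have "inverse (fls_const fls_X :: rat fls fls) = fls_const fls_X_inv"
  proof (rule inverse_unique)
    have "fls_X * fls_X_inv = (1 :: rat fls)"
      using right_inverse[of "fls_X :: rat fls"] by (simp add: fls_inverse_X)
    then show "fls_const fls_X * fls_const fls_X_inv = (1 :: rat fls fls)" by simp
  qed
  then have "shift_factor * S = S + fls_const fls_X_inv * (fls_X * S)"
    by (simp add: shift_factor_def algebra_simps)
  then show ?thesis
    by (simp add: tq_coeff_def fls_X_times_conv_shift fls_X_inv_times_conv_shift)
qed

lemma shift_factor_nonzero: "shift_factor \<noteq> 0"
proof
  assume "shift_factor = 0"
  then have "tq_coeff (shift_factor * 1) 0 0 = 0" by (simp add: tq_coeff_def)
  then show False unfolding tq_coeff_shift_factor_mult by (simp add: tq_coeff_def)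
qed

text \<open>m counts edge factors. The vanishing outside -m, ..., 0 is included so that the range of
  summation can grow when an edge is added.\<close>

definition has_euler_char :: "nat set \<Rightarrow> 'b bicomplex \<Rightarrow> nat \<Rightarrow> rat fls fls \<Rightarrow> bool" where
  "has_euler_char V C m S \<longleftrightarrow> (\<exists>N. (\<forall>j k l. hdim V C j (k, l) (N j k l)) \<and>
     (\<forall>j k l. j < - int m \<or> 0 < j \<longrightarrow> N j k l = 0) \<and>
     (\<forall>k l. (\<Sum>j = - int m..0. (-1) powi j * of_nat (N j k l)) = tq_coeff S k l))"

text \<open>The second equation applies to the part of an edge factor in cohomological degree -1.
  The shift of j by one produces the minus sign of the deletion-contraction formula.\<close>

lemma alternating_sum_extend:
  fixes f :: "int \<Rightarrow> rat"
  assumes "\<And>j. j < - int m \<or> 0 < j \<Longrightarrow> f j = 0"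
  shows "(\<Sum>j = - int (Suc m)..0. (-1) powi j * f j) = (\<Sum>j = - int m..0. (-1) powi j * f j)"
    "(\<Sum>j = - int (Suc m)..0. (-1) powi j * f (j + 1)) = - (\<Sum>j = - int m..0. (-1) powi j * f j)"
proof -
  show "(\<Sum>j = - int (Suc m)..0. (-1) powi j * f j) = (\<Sum>j = - int m..0. (-1) powi j * f j)"
    by (rule sum.mono_neutral_right) (use assms in auto)
  have "(\<Sum>j = - int (Suc m)..0. (-1) powi j * f (j + 1)) = (\<Sum>j = - int m..1. (-1) powi (j - 1) * f j)"
    by (rule sum.reindex_bij_witness[of _ "\<lambda>j. j - 1" "\<lambda>j. j + 1"]) auto
  also have "\<dots> = (\<Sum>j = - int m..0. (-1) powi (j - 1) * f j)"
    by (rule sum.mono_neutral_right) (use assms in auto)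
  also have "\<dots> = - (\<Sum>j = - int m..0. (-1) powi j * f j)"
    by (simp add: power_int_diff sum_negf)
  finally show "(\<Sum>j = - int (Suc m)..0. (-1) powi j * f (j + 1)) = - (\<Sum>j = - int m..0. (-1) powi j * f j)" .
qed

section \<open>Euler characteristics of the unit and of products with one more factor\<close>

lemma has_euler_char_unit:
  assumes "finite V"
  shows "has_euler_char V (tensor_unit :: 'b list bicomplex) 0 ((1 / (1 - fls_X)) ^ card V)"
proof -
  let ?g = "Abs_fps (\<lambda>_. 1) :: rat fls fps"
  let ?N = "\<lambda>j k l. if j = 0 \<and> k = (0::int) \<and> l \<ge> 0 then card (monomials V (nat l)) else 0"
  have "?g * (1 - fps_X) = 1"
    using inverse_mult_eq_1'[of ?g] by (simp add: fps_inverse_gp')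
  then have "fps_to_fls ?g * (1 - fls_X) = 1"
    by (metis fls_times_fps_to_fls fps_X_to_fls fps_one_to_fls fps_to_fls_minus)
  moreover from this have "1 - fls_X \<noteq> (0 :: rat fls fls)" by auto
  ultimately have "1 / (1 - fls_X) = fps_to_fls ?g" by (simp add: field_simps)
  then have "(1 / (1 - fls_X)) ^ card V = fps_to_fls (?g ^ card V)" by (simp add: fps_to_fls_power)
  \<comment> \<open>The same power series over the naturals counts monomials.\<close>
  moreover have "fps_nth (?g ^ n) l = of_nat (fps_nth (Abs_fps (\<lambda>_. 1 :: nat) ^ n) l)" for n l
    by (induction n arbitrary: l) (simp_all add: fps_mult_nth)
  ultimately have "tq_coeff ((1 / (1 - fls_X)) ^ card V) k l = of_nat (?N 0 k l)" for k l
    using finite_monomials_card[OF assms, of "nat l"] by (simp add: tq_coeff_def fls_of_nat)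
  moreover have "hdim V (tensor_unit :: 'b list bicomplex) j (k, l) (?N j k l)" for j k l
    by (rule hdim_tensor_unit[OF assms])
  ultimately show ?thesis
    unfolding has_euler_char_def by (intro exI[of _ ?N]) auto
qed

lemma has_euler_char_vertex_factor:
  assumes T: "wf_bicomplex V T" and "has_euler_char V T m S"
  shows "has_euler_char V (tensor vertex_factor T) m (shift_factor * S)"
proof -
  obtain N where N: "\<And>j k l. hdim V T j (k, l) (N j k l)" "\<And>j k l. j < - int m \<or> 0 < j \<Longrightarrow> N j k l = 0"
    "\<And>k l. (\<Sum>j = - int m..0. (-1) powi j * of_nat (N j k l)) = tq_coeff S k l"
    using assms(2) unfolding has_euler_char_def by blast
  have d: "cdeg vertex_factor x = 0" "bideg vertex_factor JL = (-1, 1)" "bideg vertex_factor JR = (0, 0)"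
    if "x \<in> gens vertex_factor" for x
    using that by (auto simp: factor_defs gens_vertex_factor)
  have "hdim V (tensor vertex_factor T) j (k, l)
      (\<Sum>x\<in>gens vertex_factor. if x = JL then N j (k + 1) (l - 1) else N j k l)" for j k l
  proof (rule hdim_tensor_zero_hdiff[OF wf_vertex_factor T])
    fix x assume x: "x \<in> gens vertex_factor"
    then show "hdim V T (j - cdeg vertex_factor x) ((k, l) - bideg vertex_factor x)
        (if x = JL then N j (k + 1) (l - 1) else N j k l)"
      using N(1) d[OF x] by (auto simp: gens_vertex_factor)
  qed (auto simp: factor_defs)
  then have "hdim V (tensor vertex_factor T) j (k, l) (N j (k + 1) (l - 1) + N j k l)" for j k l
    by (simp add: gens_vertex_factor)
  then show ?thesis
    unfolding has_euler_char_def
    by (intro exI[of _ "\<lambda>j k l. N j (k + 1) (l - 1) + N j k l"])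
      (auto simp: N(2,3) distrib_left sum.distrib tq_coeff_shift_factor_mult)
qed

text \<open>All four generators contribute. Those in cohomological degree -1 repeat those in degree
  0 with an extra q and the opposite sign, whence the factor 1 - q.\<close>

lemma has_euler_char_loop:
  assumes i: "i \<in> V" and T: "wf_bicomplex V T" and "has_euler_char V T m S"
  shows "has_euler_char V (tensor (edge_factor i i) T) (Suc m) (shift_factor * S - fls_X * (shift_factor * S))"
proof -
  obtain N where N: "\<And>j k l. hdim V T j (k, l) (N j k l)" "\<And>j k l. j < - int m \<or> 0 < j \<Longrightarrow> N j k l = 0"
    "\<And>k l. (\<Sum>j = - int m..0. (-1) powi j * of_nat (N j k l)) = tq_coeff S k l"
    using assms(3) unfolding has_euler_char_def by blast
  let ?E = "edge_factor i i"
  let ?n = "\<lambda>j k l x. if x = IL then N (j + 1) (k + 1) (l - 2)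
    else if x = IR then N (j + 1) k (l - 1) else if x = JL then N j (k + 1) (l - 1) else N j k l"
  let ?N = "\<lambda>j k l. N (j + 1) (k + 1) (l - 2) + N (j + 1) k (l - 1) + N j (k + 1) (l - 1) + N j k l"
  have "hdim V (tensor ?E T) j (k, l) (\<Sum>x\<in>gens ?E. ?n j k l x)" for j k l
  proof (rule hdim_tensor_zero_hdiff[OF wf_edge_factor[OF i i] T])
    fix x assume x: "x \<in> gens ?E"
    then show "hdim V T (j - cdeg ?E x) ((k, l) - bideg ?E x) (?n j k l x)"
      using N(1) by (auto simp: gens_edge_factor)
  qed (auto simp: factor_defs gens_edge_factor)
  then have dim: "hdim V (tensor ?E T) j (k, l) (?N j k l)" for j k l
    by (simp add: gens_edge_factor add.assoc)
  have sums: "(\<Sum>j = - int (Suc m)..0. (-1) powi j * of_nat (N j k l)) = tq_coeff S k l"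
    "(\<Sum>j = - int (Suc m)..0. (-1) powi j * of_nat (N (j + 1) k l)) = - tq_coeff S k l" for k l
    using alternating_sum_extend[of m "\<lambda>j. of_nat (N j k l)"] N(2,3) by simp_all
  have "(\<Sum>j = - int (Suc m)..0. (-1) powi j * of_nat (?N j k l)) =
      tq_coeff (shift_factor * S - fls_X * (shift_factor * S)) k l" for k l
    unfolding of_nat_add distrib_left sum.distrib sums
    by (simp add: tq_coeff_diff tq_coeff_X_mult tq_coeff_shift_factor_mult)
  then show ?thesis
    unfolding has_euler_char_def using dim N(2)
    by (intro exI[of _ ?N]) auto
qed

text \<open>The part in degree 0 gives \<open>shift_factor * S\<close>. The part in degree -1 gives
  S' without a \<open>shift_factor\<close>, because its horizontal complex resolves the quotient
  ring instead of having zero differential.\<close>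

lemma has_euler_char_edge:
  assumes i: "i \<in> V" "k \<in> V" "i \<noteq> k" and T: "wf_bicomplex V T" and "has_euler_char V T m S"
    and "has_euler_char (V - {k}) (rename_bicomplex (id(k := i)) T) m S'"
  shows "has_euler_char V (tensor (edge_factor i k) T) (Suc m) (shift_factor * S - fls_X * S')"
proof -
  obtain N where N: "\<And>j k l. hdim V T j (k, l) (N j k l)" "\<And>j k l. j < - int m \<or> 0 < j \<Longrightarrow> N j k l = 0"
    "\<And>k l. (\<Sum>j = - int m..0. (-1) powi j * of_nat (N j k l)) = tq_coeff S k l"
    using assms(5) unfolding has_euler_char_def by blast
  obtain N' where N': "\<And>j a l. hdim (V - {k}) (rename_bicomplex (id(k := i)) T) j (a, l) (N' j a l)"
    "\<And>j k l. j < - int m \<or> 0 < j \<Longrightarrow> N' j k l = 0"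
    "\<And>k l. (\<Sum>j = - int m..0. (-1) powi j * of_nat (N' j k l)) = tq_coeff S' k l"
    using assms(6) unfolding has_euler_char_def by blast
  let ?N = "\<lambda>j k l. N' (j + 1) k (l - 1) + (N j (k + 1) (l - 1) + N j k l)"
  have dim: "hdim V (tensor (edge_factor i k) T) j (a, l) (?N j a l)" for j a l
    by (rule hdim_tensor_edge_factor[OF i T]) (use N(1) N'(1) in simp_all)
  have sums: "(\<Sum>j = - int (Suc m)..0. (-1) powi j * of_nat (N j k l)) = tq_coeff S k l"
    "(\<Sum>j = - int (Suc m)..0. (-1) powi j * of_nat (N' (j + 1) k l)) = - tq_coeff S' k l" for k l
    using alternating_sum_extend[of m "\<lambda>j. of_nat (N j k l)"] N(2,3)
      alternating_sum_extend[of m "\<lambda>j. of_nat (N' j k l)"] N'(2,3) by simp_all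
  have "(\<Sum>j = - int (Suc m)..0. (-1) powi j * of_nat (?N j a l)) = tq_coeff (shift_factor * S - fls_X * S') a l" for a l
    unfolding of_nat_add distrib_left sum.distrib sums
    by (simp add: tq_coeff_diff tq_coeff_X_mult tq_coeff_shift_factor_mult)
  then show ?thesis
    unfolding has_euler_char_def using dim N(2) N'(2)
    by (intro exI[of _ ?N]) auto
qed

section \<open>Evaluation of the dichromatic polynomial\<close>

lemma map_poly_of_int_diff: "map_poly of_int (p - q) = (map_poly of_int p - map_poly of_int q :: 'a::ring_1 poly)"
  by (rule poly_eqI) (simp add: coeff_map_poly)

lemma eval_qv_diff_mult:
  "eval_qv (P - [:[:0, 1:]:] * P') q v = eval_qv P q v - q * eval_qv P' q (v :: 'a::comm_ring_1)"
proof -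
  let ?h = "\<lambda>c. poly (map_poly of_int c) q :: 'a"
  have "?h (a - [:0, 1:] * b) = ?h a - q * ?h b" for a b
    by (simp add: map_poly_of_int_diff map_poly_pCons)
  then have "map_poly ?h (P - [:[:0, 1:]:] * P') = map_poly ?h P - Polynomial.smult q (map_poly ?h P')"
    by (intro poly_eqI) (simp add: coeff_map_poly)
  then show ?thesis by (simp add: eval_qv_def)
qed

lemma eval_qv_power: "eval_qv ([:0, 1:] ^ n) q v = (v :: 'a::comm_ring_1) ^ n"
proof -
  have "([:0, 1:] :: int poly poly) ^ n = monom 1 n" by (simp add: monom_altdef)
  then show ?thesis by (simp add: eval_qv_def map_poly_monom poly_monom)
qed

text \<open>Vertices are sent to variables by any injection, as contraction leaves a gap among the
  indices. For a graph without edges the ring contributes 1/(1 - q) per vertex, whereas the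
  evaluation has \<open>shift_factor / (1 - fls_X)\<close>; dividing by
  \<open>shift_factor ^ card (verts G)\<close> corrects this. A quotient of powers is used since
  \<open>card (verts G)\<close> may exceed \<open>length es + r\<close>.\<close>

lemma has_euler_char_graph:
  fixes G :: "('v, 'e) graph"
  assumes "finite_graph G" "inj_on pos (verts G)" "distinct es" "set es = edges G"
    "\<And>e. e \<in> edges G \<Longrightarrow> Upair (fst (ori e)) (snd (ori e)) = ends G e"
  shows "has_euler_char (pos ` verts G)
    (tensor_list (map (\<lambda>e. edge_factor (pos (fst (ori e))) (pos (snd (ori e)))) es @ replicate r vertex_factor))
    (length es)
    (shift_factor ^ (length es + r) / shift_factor ^ card (verts G) *
      eval_qv (dichromatic_poly G) fls_X (shift_factor / (1 - fls_X)))"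
  using assms
proof (induction es arbitrary: G ori)
  case Nil
  let ?V = "pos ` verts G"
  have V: "finite ?V" "card ?V = card (verts G)"
    using Nil.prems by (auto simp: finite_graph_def card_image)
  have "has_euler_char ?V (tensor_list (replicate r vertex_factor)) 0 (shift_factor ^ r * (1 / (1 - fls_X)) ^ card (verts G))"
  proof (induction r)
    case 0
    show ?case using has_euler_char_unit[OF V(1)] V(2) by simp
  next
    case (Suc r)
    have "wf_bicomplex ?V (tensor_list (replicate r vertex_factor))"
      by (rule wf_tensor_list) (auto simp: wf_vertex_factor)
    from has_euler_char_vertex_factor[OF this Suc] show ?case by (simp add: mult.assoc)
  qed
  moreover have "dichromatic_poly G = [:0, 1:] ^ card (verts G)"
    using is_dichromatic_dichromatic_poly Nil.prems unfolding is_dichromatic_def by auto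
  ultimately show ?case
    using shift_factor_nonzero by (simp add: eval_qv_power power_divide)
next
  case (Cons e es)
  let ?V = "pos ` verts G"
  let ?F = "\<lambda>ori e. edge_factor (pos (fst (ori e))) (pos (snd (ori e)))"
  let ?T = "tensor_list (map (?F ori) es @ replicate r vertex_factor)"
  let ?P = "\<lambda>G. eval_qv (dichromatic_poly G) fls_X (shift_factor / (1 - fls_X))"
  let ?a = shift_factor
  obtain u w where uw: "ori e = (u, w)" by fastforce
  have e: "e \<in> edges G" "ends G e = Upair u w" using Cons.prems(4) Cons.prems(5)[of e, symmetric] uw by auto
  have mem: "fst (ori e') \<in> verts G \<and> snd (ori e') \<in> verts G" if "e' \<in> edges G" for e'
  proof -
    have "set_uprod (Upair (fst (ori e')) (snd (ori e'))) \<subseteq> verts G"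
      using Cons.prems(1,5) that by (simp add: finite_graph_def)
    then show ?thesis by simp
  qed
  have uwV: "u \<in> verts G" "w \<in> verts G" using mem[OF e(1)] uw by auto
  let ?D = "delete_edge G e" and ?H = "contract_edge G e u w"
  have es: "distinct es" "set es = edges G - {e}" using Cons.prems by auto
  have rec: "?P G = ?P ?D - fls_X * ?P ?H"
  proof -
    have "dichromatic_poly G = dichromatic_poly ?D - [:[:0, 1:]:] * dichromatic_poly ?H"
      using is_dichromatic_dichromatic_poly Cons.prems(1) e unfolding is_dichromatic_def by blast
    then show ?thesis by (simp only: eval_qv_diff_mult)
  qed
  have wfT: "wf_bicomplex ?V ?T"
  proof (rule wf_tensor_list)
    fix C assume "C \<in> set (map (?F ori) es @ replicate r vertex_factor)"
    then show "wf_bicomplex ?V C"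
      using mem es by (auto simp: wf_vertex_factor intro!: wf_edge_factor)
  qed
  have D: "has_euler_char ?V ?T (length es) (?a ^ (length es + r) / ?a ^ card (verts G) * ?P ?D)"
  proof -
    have "has_euler_char (pos ` verts ?D) ?T (length es) (?a ^ (length es + r) / ?a ^ card (verts ?D) * ?P ?D)"
      by (rule Cons.IH) (use Cons.prems es finite_graph_delete in \<open>auto simp: delete_edge_def\<close>)
    then show ?thesis by (simp add: delete_edge_def)
  qed
  show ?case
  proof (cases "u = w")
    case True
    \<comment> \<open>Contracting a loop identifies nothing and coincides with deleting it, so the
      recursion gives a factor 1 - q as well.\<close>
    have "id(w := w) = (id :: 'v \<Rightarrow> 'v)" by (rule fun_upd_idem) simp
    then have "?H = ?D"
      by (cases G) (simp add: contract_edge_def delete_edge_def True uprod.map_id0)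
    then have PG: "?P G = ?P ?D - fls_X * ?P ?D" using rec by simp
    let ?S = "?a ^ (length es + r) / ?a ^ card (verts G) * ?P ?D"
    have "?a * ?S - fls_X * (?a * ?S) = ?a ^ (length (e # es) + r) / ?a ^ card (verts G) * ?P G"
      unfolding PG by (simp add: algebra_simps)
    then show ?thesis
      using has_euler_char_loop[OF imageI[OF uwV(1)] wfT D] True uw by simp
  next
    case False
    \<comment> \<open>The merged vertex is represented by u. Accordingly the variable of w is
      renamed to that of u, and the endpoints of the remaining edges follow.\<close>
    let ?f = "id(w := u)" and ?\<sigma> = "id(pos w := pos u)"
    let ?ori = "\<lambda>e. (?f (fst (ori e)), ?f (snd (ori e)))"
    have neq: "pos u \<noteq> pos w" using False uwV Cons.prems(2) by (auto simp: inj_on_def)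
    have vH: "verts ?H = verts G - {w}" using False uwV by (auto simp: contract_edge_def)
    have V': "pos ` verts ?H = ?V - {pos w}"
      using Cons.prems(2) uwV vH by (auto simp: inj_on_def)
    have card: "card (verts G) = Suc (card (verts ?H))"
      using Cons.prems(1) uwV unfolding vH finite_graph_def by (metis card_Suc_Diff1)
    have pos_f: "?\<sigma> (pos v) = pos (?f v)" if "v \<in> verts G" for v
      using that uwV Cons.prems(2) by (auto simp: inj_on_def)
    have "map (rename_bicomplex ?\<sigma>) (map (?F ori) es @ replicate r vertex_factor) =
        map (?F ?ori) es @ replicate r vertex_factor"
      using mem es pos_f by (simp add: rename_bicomplex_edge_factor rename_bicomplex_vertex_factor)
    then have rename: "rename_bicomplex ?\<sigma> ?T = tensor_list (map (?F ?ori) es @ replicate r vertex_factor)"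
      by (simp only: rename_bicomplex_tensor_list)
    have "has_euler_char (pos ` verts ?H) (tensor_list (map (?F ?ori) es @ replicate r vertex_factor)) (length es)
        (?a ^ (length es + r) / ?a ^ card (verts ?H) * ?P ?H)"
    proof (rule Cons.IH)
      show "finite_graph ?H" by (rule finite_graph_contract[OF Cons.prems(1)])
      show "inj_on pos (verts ?H)" using Cons.prems(2) vH by (auto intro: inj_on_subset)
      show "Upair (fst (?ori e')) (snd (?ori e')) = ends ?H e'" if "e' \<in> edges ?H" for e'
        using that Cons.prems(5)[of e', symmetric] by (simp add: contract_edge_def)
    qed (use es in \<open>auto simp: contract_edge_def\<close>)
    then have H: "has_euler_char (?V - {pos w}) (rename_bicomplex ?\<sigma> ?T) (length es)
        (?a ^ (length es + r) / ?a ^ card (verts ?H) * ?P ?H)"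
      unfolding V' rename .
    \<comment> \<open>The contracted graph has one vertex less, so its normalization supplies the
      \<open>shift_factor\<close> that the resolved part of the edge factor lacks.\<close>
    have "?a * (?a ^ (length es + r) / ?a ^ card (verts G) * ?P ?D) -
        fls_X * (?a ^ (length es + r) / ?a ^ card (verts ?H) * ?P ?H) =
        ?a ^ (length (e # es) + r) / ?a ^ card (verts G) * ?P G"
      unfolding rec card using shift_factor_nonzero by (simp add: field_simps)
    then show ?thesis
      using has_euler_char_edge[OF imageI[OF uwV(1)] imageI[OF uwV(2)] neq wfT D H] uw by simp
  qed
qed

theorem theorem3:
  fixes G :: "('v, 'e) graph"
  assumes "finite_graph G"
  shows "(\<forall>vs es ori vs' es' ori'.
            is_presentation G vs es ori \<longrightarrow> is_presentation G vs' es' ori' \<longrightarrow>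
            homotopy_equivalent (card (verts G))
              (graph_complex vs es ori)
              (relabel_complex (relabeling vs vs') (graph_complex vs' es' ori')))
       \<and> (\<forall>vs es ori. is_presentation G vs es ori \<longrightarrow>
            (\<forall>j. finite_dim_pieces (obj (graph_complex vs es ori) j)) \<and>
            (\<forall>k l. (\<Sum>j = - int (card (edges G))..0.
                      (-1) powi j * of_nat (qdim (obj (graph_complex vs es ori) j) k l))
                   = fls_nth (fls_nth (dichromatic_series G) l) k))"
proof (intro conjI allI impI)
  fix vs es ori vs' es' ori'
  assume "is_presentation G vs es ori" "is_presentation G vs' es' ori'"
  with assms show "homotopy_equivalent (card (verts G)) (graph_complex vs es ori)
      (relabel_complex (relabeling vs vs') (graph_complex vs' es' ori'))"
    by (rule graph_complex_presentation_independent)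
next
  fix vs es ori
  assume P: "is_presentation G vs es ori"
  let ?C = "graph_bicomplex vs es ori" and ?n = "length vs"
  have vs: "distinct vs" "set vs = verts G" and es: "distinct es" "set es = edges G"
    using P by (auto simp: is_presentation_def)
  have inj: "inj_on (position vs) (verts G)"
    using position_nth(2)[OF vs(1)] vs(2) by (metis inj_onI)
  have "position vs ` verts G = {..<?n}"
  proof (intro equalityI subsetI)
    fix i assume "i \<in> {..<?n}"
    then have "i = position vs (vs ! i)" "vs ! i \<in> verts G"
      using position_of_nth[OF vs(1)] vs(2) by auto
    then show "i \<in> position vs ` verts G" by (rule image_eqI)
  qed (use position_nth(1)[OF vs(1)] vs(2) in auto)
  moreover have "?C = tensor_list (map (\<lambda>e. edge_factor (position vs (fst (ori e))) (position vs (snd (ori e)))) es @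
      replicate ?n vertex_factor)"
    by (simp add: graph_bicomplex_def map_replicate_const)
  moreover have "?n = card (verts G)" "length es = card (edges G)"
    using vs es by (metis distinct_card)+
  \<comment> \<open>With one vertex factor per vertex, r equals \<open>card (verts G)\<close>, and
    the quotient of powers reduces to the exponent m of the dichromatic series.\<close>
  ultimately have "has_euler_char {..<?n} ?C (card (edges G))
      (shift_factor ^ card (edges G) * eval_qv (dichromatic_poly G) fls_X (shift_factor / (1 - fls_X)))"
    using has_euler_char_graph[OF assms inj es, of ori ?n] P shift_factor_nonzero
    by (simp add: is_presentation_def power_add)
  then have "has_euler_char {..<?n} ?C (card (edges G)) (dichromatic_series G)"
    by (simp add: dichromatic_series_def shift_factor_def Let_def)
  then obtain N where N: "\<And>j k l. hdim {..<?n} ?C j (k, l) (N j k l)"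
    "\<And>k l. (\<Sum>j = - int (card (edges G))..0. (-1) powi j * of_nat (N j k l)) = tq_coeff (dichromatic_series G) k l"
    unfolding has_euler_char_def by blast
  have sub: "graded_subquotient ?n (hcocycles {..<?n} ?C j) (hcoboundaries {..<?n} ?C j) (degree_part ?C) (component ?C)" for j
    by (rule graded_subquotient_cohomology[OF wf_graph_bicomplex[OF P assms]])
  note dim = graded_subquotient.dim_piece[OF sub N(1)[unfolded hdim_def]]
  have obj: "obj (graph_complex vs es ori) j =
      quotient_module (hcocycles {..<?n} ?C j) (hcoboundaries {..<?n} ?C j) (degree_part ?C)" for j
    by (simp add: graph_complex_def obj_cohomology_complex)
  show "finite_dim_pieces (obj (graph_complex vs es ori) j)" for j
    unfolding finite_dim_pieces_def obj using dim(1) by auto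
  show "(\<Sum>j = - int (card (edges G))..0. (-1) powi j * of_nat (qdim (obj (graph_complex vs es ori) j) k l)) =
      fls_nth (fls_nth (dichromatic_series G) l) k" for k l
    using N(2)[of k l] by (simp add: qdim_def obj dim(2) tq_coeff_def)
qed

end
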